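(* Consider the deterministic attack design problem $$\inf_{(\rho,\tau)\in\mathscr{A}^{\mathrm{det}}}\ \mathcal{S}(\rho,\tau)-\lambda\,\mathcal{D}(\rho,\tau)+\frac12\int_0^T\rho_t^{\top}P_t\rho_t\,dt,\qquad \mathscr{A}^{\mathrm{det}}:=\{(\rho,\tau):\rho\in C([0,T];\mathbb{R}^d),\ \tau\in C([0,T];\mathbb{R}^m)\},$$ with $\lambda\ge0$, $P\in C([0,T];\mathbb{S}^{d\times d}_{++})$, and with $\mathcal{S}$, $\mathcal{D}$ and all other objects as in the context. The optimal deterministic attacks $(\rho^*,\tau^* )\in\mathscr{A}^{\mathrm{det}}$ are given by $$\rho^*_t=-P_t^{-1}(F^c_tm^c_t+F^a_tm^a_t+\mathbf{f}^\rho_t),$$ $$\tau^*_t=-(H_tR_tG^c_t+H_t)m^c_t-(H_tR_tG^a_t-H_t)m^a_t-H_tR_t\mathbf{g}^\tau_t,$$ where $m^c_t=\mathbb{E}X^c_t$ and $m^a_t=\mathbb{E}\hat X^a_t$ are the mean states (under $(\rho^*,\tau^* )$), and $F^c,F^a,G^c,G^a\in C([0,T];\mathbb{R}^{d\times d})$, $\mathbf{f}^\rho,\mathbf{g}^\tau\in C([0,T];\mathbb{R}^d)$ satisfy the system \begin{align*} &\dot F^c_t+F^c_tA_t+A_t^{\top}F^c_t-F^c_tP_t^{-1}F^c_t-F^a_t\Lambda_tG^c_t-2\lambda Q_t=0,\\ &\dot F^a_t+F^a_t(A_t-K_tF_t)+A_t^{\top}F^a_t-F^c_tK_tF_t-F^c_tP_t^{-1}F^a_t-F^a_t\Lambda_tG^a_t=0,\\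 &\dot G^c_t+G^c_tA_t+(A_t^{\top}-F_tK_t)G^c_t-F_tK_tF^c_t-G^a_t\Lambda_tG^c_t-G^c_tP_t^{-1}F^c_t=0,\\ &\dot G^a_t+G^a_t(A_t-K_tF_t)+(A_t^{\top}-F_tK_t)G^a_t-F_tK_tF^a_t-G^c_tK_tF_t-G^c_tP_t^{-1}F^a_t-G^a_t\Lambda_tG^a_t-2\lambda F_tK_tF_t=0,\\ &\dot{\mathbf f}^\rho_t+(A_t^{\top}-F^c_tP_t^{-1})\mathbf f^\rho_t+F^c_t(a_t-\tfrac12K_t\mathbf f_t)-F^a_t\Lambda_t\mathbf g^\tau_t+F^a_t(a_t-\tfrac12K_t\mathbf f_t)+2\lambda Q_tr_t=0,\\ &\dot{\mathbf g}^\tau_t+(A_t^{\top}-F_tK_t)\mathbf g^\tau_t-G^c_tP_t^{-1}\mathbf f^\rho_t-G^a_t\Lambda_t\mathbf g^\tau_t-F_tK_t\mathbf f^\rho_t+G^c_t(a_t-\tfrac12K_t\mathbf f_t)+G^a_t(a_t-\tfrac12K_t\mathbf f_t)-\lambda F_tK_t\mathbf f_t=0, \end{align*} with terminal conditions $F^c_T=F^a_T=G^c_T=G^a_T=0$, $\mathbf f^\rho_T=\mathbf g^\tau_T=0$, where $\Lambda_t:=R_tH_t^{\top}(\sigma_W\sigma_W^{\top})^{-1}H_tR_t$. Moreover, this ODE system admits a unique solution on $[0,T]$, provided that $$T<\frac{\pi/2}{\sqrt{\big[2\lambda\max\{\|Q\|,\|FKF\|\}+b_{\mathcal P}\big]\big(\max\{\|P^{-1}\|,\|\Lambda\|\}+b_{\mathcal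 P}\big)}},\qquad b_{\mathcal P}:=\max\{\|A\|,\|A-KF\|\}+\|KF\|.$$ In particular, when $\lambda=0$, the ODE system admits a unique solution on $[0,T]$ for any $T>0$.
   Context: Basic data. Fix $T>0$ and dimensions $d,m,c,p,q$ with $d\le p$, $m\le q$. $V,W$ are independent standard Brownian motions in $\mathbb{R}^p,\mathbb{R}^q$; $\sigma_V\in\mathbb{R}^{d\times p}$ has rank $d$ and $\sigma_W\in\mathbb{R}^{m\times q}$ has rank $m$. The coefficients $A_t\in\mathbb{R}^{d\times d}$, $B_t\in\mathbb{R}^{d\times c}$, $H_t\in\mathbb{R}^{m\times d}$, $a_t\in\mathbb{R}^d$, $h_t\in\mathbb{R}^m$ are deterministic and continuous on $[0,T]$. $\mathbb{S}^{n\times n}$, $\mathbb{S}^{n\times n}_+$, $\mathbb{S}^{n\times n}_{++}$ denote symmetric, positive semidefinite, positive definite matrices. $Q\in C([0,T];\mathbb{S}^{d\times d}_+)$, $S\in C([0,T];\mathbb{S}^{c\times c}_{++})$, $r\in C([0,T];\mathbb{R}^d)$, $x_0\in\mathbb{R}^d$, $R_0\in\mathbb{S}^{d\times d}_+$. For a process $Z$, $\mathscr{F}^Z_t:=\sigma(Z_s,\ s\le t)$. For a matrix function $M$ on $[0,T]$, $\|M\|:=\sup_{t\in[0,T]}\|M_t\|$ with the matrix 2-norm; products such as $FKF$ are taken pointwise in $t$. Agent's feedback. Let $K_t:=B_tS_t^{-1}B_t^{\top}$, and let $F\in C([0,T];\mathbb{S}^{d\times d})$, $\mathbf{f}\in C([0,T];\mathbb{R}^d)$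 solve $\dot F_t+A_t^{\top}F_t+F_tA_t+Q_t-F_tK_tF_t=0$, $\dot{\mathbf f}_t+A_t^{\top}\mathbf f_t+2F_ta_t-2Q_tr_t-F_tK_t\mathbf f_t=0$, $F_T=0$, $\mathbf f_T=0$. Put $u^*(t,x):=-S_t^{-1}B_t^{\top}F_tx-\tfrac12S_t^{-1}B_t^{\top}\mathbf f_t$. Let $R$ solve $\dot R_t=A_tR_t+R_tA_t^{\top}+\sigma_V\sigma_V^{\top}-R_tH_t^{\top}(\sigma_W\sigma_W^{\top})^{-1}H_tR_t$ with initial value $R_0$. Attacked system. $X^c_0\sim N(x_0,R_0)$ is independent of $(V,W)$, $Y^c_0=0$, and $$dX^c_t=(A_tX^c_t+B_tu^a_t+a_t+\rho_t)dt+\sigma_V dV_t,\qquad dY^c_t=(H_tX^c_t+h_t+\tau_t)dt+\sigma_W dW_t,$$ where $u^a_t:=u^*(t,\hat X^a_t)$ and the agent's filter $\hat X^a$ solves $$d\hat X^a_t=(A_t\hat X^a_t+B_tu^a_t+a_t)dt+R_tH_t^{\top}(\sigma_W\sigma_W^{\top})^{-1}(dY^c_t-(H_t\hat X^a_t+h_t)dt),\quad \hat X^a_0=x_0.$$ Let $\hat X^c_t:=\mathbb{E}(X^c_t\mid\mathscr{F}^{Y^c}_t)$ and $\Delta X_t:=\hat X^c_t-\hat X^a_t$; then $$d\Delta X_t=\big([A_t-R_tH_t^{\top}(\sigma_W\sigma_W^{\top})^{-1}H_t]\Delta X_t+\rho_t-R_tH_t^{\top}(\sigma_W\sigma_W^{\top})^{-1}\tau_t\big)dt,\quad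 \Delta X_0=0.$$ Criteria. $$\mathcal{D}(\rho,\tau):=\mathbb{E}\int_0^T[(X^c_t-r_t)^{\top}Q_t(X^c_t-r_t)+(u^a_t)^{\top}S_tu^a_t]dt,$$ $$\mathcal{S}(\rho,\tau)=\frac12\mathbb{E}\int_0^T(H_t\Delta X_t+\tau_t)^{\top}(\sigma_W\sigma_W^{\top})^{-1}(H_t\Delta X_t+\tau_t)dt.$$ Mean dynamics. With $\Theta_t:=R_tH_t^{\top}(\sigma_W\sigma_W^{\top})^{-1}H_t$ and $\mathcal{T}_t:=R_tH_t^{\top}(\sigma_W\sigma_W^{\top})^{-1}$, the means satisfy $m^c_0=m^a_0=x_0$, $$\dot m^c_t=A_tm^c_t-K_tF_tm^a_t+a_t-\tfrac12K_t\mathbf f_t+\rho_t,\qquad \dot m^a_t=\Theta_tm^c_t+(A_t-K_tF_t-\Theta_t)m^a_t+a_t-\tfrac12K_t\mathbf f_t+\mathcal{T}_t\tau_t.$$ The optimality formula is understood for $T$ such that the stated ODE system has a solution on $[0,T]$. *)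

theory Defs
  imports "HOL-Probability.Probability"
begin

section \<open>Matrices\<close>

definition sym_mat :: "real^'n^'n \<Rightarrow> bool" where
  "sym_mat M \<longleftrightarrow> transpose M = M"

definition psd_mat :: "real^'n^'n \<Rightarrow> bool" where
  "psd_mat M \<longleftrightarrow> sym_mat M \<and> (\<forall>x. 0 \<le> x \<bullet> (M *v x))"

definition pd_mat :: "real^'n^'n \<Rightarrow> bool" where
  "pd_mat M \<longleftrightarrow> sym_mat M \<and> (\<forall>x. x \<noteq> 0 \<longrightarrow> 0 < x \<bullet> (M *v x))"

text \<open>The matrix 2-norm is the operator norm; \<open>norm\<close> on \<open>real^'n^'m\<close> is the Frobenius norm.\<close>

definition sup_norm2 :: "real \<Rightarrow> (real \<Rightarrow> real^'n^'m) \<Rightarrow> real" where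
  "sup_norm2 T M = (SUP t\<in>{0..T}. onorm ((*v) (M t)))"

section \<open>Processes\<close>

definition process_sigma :: "'w measure \<Rightarrow> real set \<Rightarrow> (real \<Rightarrow> 'w \<Rightarrow> 'b::topological_space) \<Rightarrow> 'w measure" where
  "process_sigma M I Z =
     sigma (space M) (\<Union>s\<in>I. {Z s -` E \<inter> space M | E. E \<in> sets borel})"

definition continuous_process :: "'w measure \<Rightarrow> real set \<Rightarrow> (real \<Rightarrow> 'w \<Rightarrow> 'b::topological_space) \<Rightarrow> bool" where
  "continuous_process M I Z \<longleftrightarrow>
     (\<forall>t\<in>I. Z t \<in> borel_measurable M) \<and> (\<forall>\<omega>\<in>space M. continuous_on I (\<lambda>t. Z t \<omega>))"

text \<open>The normal law \<open>N(\<mu>, C)\<close> is given by its characteristic function, so that singular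
  covariance matrices are allowed.\<close>

definition gaussian_vector :: "'w measure \<Rightarrow> ('w \<Rightarrow> real^'n) \<Rightarrow> real^'n \<Rightarrow> real^'n^'n \<Rightarrow> bool" where
  "gaussian_vector M X \<mu> C \<longleftrightarrow> X \<in> borel_measurable M \<and>
     (\<forall>v. (CLINT \<omega>|M. iexp (v \<bullet> X \<omega>)) =
            exp (\<i> * complex_of_real (v \<bullet> \<mu>) - complex_of_real (v \<bullet> (C *v v) / 2)))"

definition brownian_motion :: "'w measure \<Rightarrow> (real \<Rightarrow> 'w \<Rightarrow> real^'n) \<Rightarrow> bool" where
  "brownian_motion M W \<longleftrightarrow>
     continuous_process M {0..} W \<and> (\<forall>\<omega>\<in>space M. W 0 \<omega> = 0) \<and>
     (\<forall>s t. 0 \<le> s \<and> s \<le> t \<longrightarrow>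
        gaussian_vector M (\<lambda>\<omega>. W t \<omega> - W s \<omega>) 0 ((t - s) *\<^sub>R mat 1) \<and>
        prob_space.indep_set M (sets (process_sigma M {0..s} W))
          (sets (vimage_algebra (space M) (\<lambda>\<omega>. W t \<omega> - W s \<omega>) borel)))"

text \<open>\<open>I = \<integral>\<^sub>0\<^sup>t f\<^sub>s dZ\<^sub>s\<close> for a continuous deterministic integrand \<open>f\<close> and a continuous
  semimartingale \<open>Z\<close>, as the limit in probability of the left-point Riemann sums.\<close>

definition stoch_sum :: "(real \<Rightarrow> real^'n^'m) \<Rightarrow> (real \<Rightarrow> 'w \<Rightarrow> real^'n) \<Rightarrow> real \<Rightarrow> nat \<Rightarrow> 'w \<Rightarrow> real^'m" where
  "stoch_sum f Z t n \<omega> =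
     (\<Sum>k<n. f (t * real k / real n) *v
        (Z (t * real (Suc k) / real n) \<omega> - Z (t * real k / real n) \<omega>))"

definition has_stoch_integral ::
  "'w measure \<Rightarrow> (real \<Rightarrow> real^'n^'m) \<Rightarrow> (real \<Rightarrow> 'w \<Rightarrow> real^'n) \<Rightarrow> real \<Rightarrow> ('w \<Rightarrow> real^'m) \<Rightarrow> bool" where
  "has_stoch_integral M f Z t I \<longleftrightarrow> I \<in> borel_measurable M \<and>
     (\<forall>\<epsilon>>0. (\<lambda>n. measure M {\<omega> \<in> space M. \<epsilon> < dist (stoch_sum f Z t n \<omega>) (I \<omega>)}) \<longlonglongrightarrow> 0)"

definition vec_cond_exp :: "'w measure \<Rightarrow> 'w measure \<Rightarrow> ('w \<Rightarrow> real^'n) \<Rightarrow> 'w \<Rightarrow> real^'n" where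
  "vec_cond_exp M G X \<omega> = (\<chi> i. real_cond_exp M G (\<lambda>\<omega>. X \<omega> $ i) \<omega>)"

section \<open>The agent and the attacked system\<close>

definition agent_feedback_system ::
  "real \<Rightarrow> (real \<Rightarrow> real^'d^'d) \<Rightarrow> (real \<Rightarrow> real^'d^'d) \<Rightarrow> (real \<Rightarrow> real^'d^'d) \<Rightarrow>
   (real \<Rightarrow> real^'d) \<Rightarrow> (real \<Rightarrow> real^'d) \<Rightarrow>
   (real \<Rightarrow> real^'d^'d) \<Rightarrow> (real \<Rightarrow> real^'d) \<Rightarrow> bool" where
  "agent_feedback_system T A K Q a r F f \<longleftrightarrow>
     (\<forall>t\<in>{0..T}.
        sym_mat (F t) \<and>
        (F has_vector_derivative
           - (transpose (A t) ** F t + F t ** A t + Q t - F t ** K t ** F t)) (at t within {0..T}) \<and>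
        (f has_vector_derivative
           - (transpose (A t) *v f t + 2 *\<^sub>R (F t *v a t) - 2 *\<^sub>R (Q t *v r t) - F t *v (K t *v f t)))
           (at t within {0..T})) \<and>
     F T = 0 \<and> f T = 0"

definition filter_riccati ::
  "real \<Rightarrow> (real \<Rightarrow> real^'d^'d) \<Rightarrow> (real \<Rightarrow> real^'d^'m) \<Rightarrow> real^'p^'d \<Rightarrow> real^'q^'m \<Rightarrow>
   real^'d^'d \<Rightarrow> (real \<Rightarrow> real^'d^'d) \<Rightarrow> bool" where
  "filter_riccati T A H \<sigma>V \<sigma>W R0 R \<longleftrightarrow>
     (\<forall>t\<in>{0..T}. (R has_vector_derivative
        A t ** R t + R t ** transpose (A t) + \<sigma>V ** transpose \<sigma>V
          - R t ** transpose (H t) ** matrix_inv (\<sigma>W ** transpose \<sigma>W) ** H t ** R t)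
        (at t within {0..T})) \<and>
     R 0 = R0"

definition u_star ::
  "(real \<Rightarrow> real^'c^'d) \<Rightarrow> (real \<Rightarrow> real^'c^'c) \<Rightarrow> (real \<Rightarrow> real^'d^'d) \<Rightarrow> (real \<Rightarrow> real^'d) \<Rightarrow>
   real \<Rightarrow> real^'d \<Rightarrow> real^'c" where
  "u_star B S F f t x =
     - ((matrix_inv (S t) ** transpose (B t) ** F t) *v x)
     - (1/2) *\<^sub>R ((matrix_inv (S t) ** transpose (B t)) *v f t)"

text \<open>\<open>\<T> = R H\<^sup>T (\<sigma>\<^sub>W \<sigma>\<^sub>W\<^sup>T)\<^sup>-\<^sup>1\<close> is the agent's filter gain and \<open>u\<close> the agent's feedback map.
  Since the noise of \<open>X\<^sup>c\<close> and \<open>Y\<^sup>c\<close> is additive with constant coefficients, their equations involve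
  no stochastic integral. The filter equation says that what remains of \<open>Xa\<close> after removing all
  \<open>dt\<close>-terms is \<open>\<integral> \<T> dYc\<close>. The last condition makes \<open>Xh\<close> the continuous version of
  \<open>\<E>(Xc\<^sub>t | \<F>\<^sub>t)\<close>, with \<open>\<F>\<close> the filtration of \<open>Yc\<close>.\<close>

definition attacked_system ::
  "'w measure \<Rightarrow> real \<Rightarrow> (real \<Rightarrow> real^'d^'d) \<Rightarrow> (real \<Rightarrow> real^'c^'d) \<Rightarrow> (real \<Rightarrow> real^'d^'m) \<Rightarrow>
   (real \<Rightarrow> real^'d) \<Rightarrow> (real \<Rightarrow> real^'m) \<Rightarrow> real^'p^'d \<Rightarrow> real^'q^'m \<Rightarrow>
   (real \<Rightarrow> real^'m^'d) \<Rightarrow> (real \<Rightarrow> real^'d \<Rightarrow> real^'c) \<Rightarrow>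
   real^'d \<Rightarrow> ('w \<Rightarrow> real^'d) \<Rightarrow> (real \<Rightarrow> 'w \<Rightarrow> real^'p) \<Rightarrow> (real \<Rightarrow> 'w \<Rightarrow> real^'q) \<Rightarrow>
   (real \<Rightarrow> real^'d) \<Rightarrow> (real \<Rightarrow> real^'m) \<Rightarrow>
   (real \<Rightarrow> 'w \<Rightarrow> real^'d) \<Rightarrow> (real \<Rightarrow> 'w \<Rightarrow> real^'m) \<Rightarrow> (real \<Rightarrow> 'w \<Rightarrow> real^'d) \<Rightarrow>
   (real \<Rightarrow> 'w \<Rightarrow> real^'d) \<Rightarrow> bool" where
  "attacked_system M T A B H a h \<sigma>V \<sigma>W \<T> u x0 X0 V W \<rho> \<tau> Xc Yc Xa Xh \<longleftrightarrow>
     continuous_process M {0..T} Xc \<and> continuous_process M {0..T} Yc \<and>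
     continuous_process M {0..T} Xa \<and> continuous_process M {0..T} Xh \<and>
     (AE \<omega> in M. \<forall>t\<in>{0..T}.
        Xc t \<omega> = X0 \<omega>
          + integral {0..t} (\<lambda>s. A s *v Xc s \<omega> + B s *v u s (Xa s \<omega>) + a s + \<rho> s) + \<sigma>V *v V t \<omega>) \<and>
     (AE \<omega> in M. \<forall>t\<in>{0..T}.
        Yc t \<omega> = integral {0..t} (\<lambda>s. H s *v Xc s \<omega> + h s + \<tau> s) + \<sigma>W *v W t \<omega>) \<and>
     (\<forall>t\<in>{0..T}. has_stoch_integral M \<T> Yc t
        (\<lambda>\<omega>. Xa t \<omega> - x0
          - integral {0..t} (\<lambda>s. A s *v Xa s \<omega> + B s *v u s (Xa s \<omega>) + a s
              - \<T> s *v (H s *v Xa s \<omega> + h s)))) \<and>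
     (\<forall>t\<in>{0..T}. AE \<omega> in M. Xh t \<omega> = vec_cond_exp M (process_sigma M {0..t} Yc) (Xc t) \<omega>)"

definition cost_D ::
  "'w measure \<Rightarrow> real \<Rightarrow> (real \<Rightarrow> real^'d^'d) \<Rightarrow> (real \<Rightarrow> real^'c^'c) \<Rightarrow> (real \<Rightarrow> real^'d) \<Rightarrow>
   (real \<Rightarrow> real^'d \<Rightarrow> real^'c) \<Rightarrow> (real \<Rightarrow> 'w \<Rightarrow> real^'d) \<Rightarrow> (real \<Rightarrow> 'w \<Rightarrow> real^'d) \<Rightarrow> real" where
  "cost_D M T Q S r u Xc Xa =
     (LINT \<omega>|M. integral {0..T} (\<lambda>t.
        (Xc t \<omega> - r t) \<bullet> (Q t *v (Xc t \<omega> - r t)) + u t (Xa t \<omega>) \<bullet> (S t *v u t (Xa t \<omega>))))"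

definition cost_S ::
  "'w measure \<Rightarrow> real \<Rightarrow> (real \<Rightarrow> real^'d^'m) \<Rightarrow> real^'q^'m \<Rightarrow> (real \<Rightarrow> real^'m) \<Rightarrow>
   (real \<Rightarrow> 'w \<Rightarrow> real^'d) \<Rightarrow> (real \<Rightarrow> 'w \<Rightarrow> real^'d) \<Rightarrow> real" where
  "cost_S M T H \<sigma>W \<tau> Xh Xa =
     (1/2) * (LINT \<omega>|M. integral {0..T} (\<lambda>t.
        (H t *v (Xh t \<omega> - Xa t \<omega>) + \<tau> t) \<bullet>
          (matrix_inv (\<sigma>W ** transpose \<sigma>W) *v (H t *v (Xh t \<omega> - Xa t \<omega>) + \<tau> t))))"

definition det_attacks :: "real \<Rightarrow> ((real \<Rightarrow> real^'d) \<times> (real \<Rightarrow> real^'m)) set" where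
  "det_attacks T = {(\<rho>, \<tau>). continuous_on {0..T} \<rho> \<and> continuous_on {0..T} \<tau>}"

section \<open>The attacker's ODE system\<close>

text \<open>Here \<open>Pinv\<close> stands for \<open>P\<^sup>-\<^sup>1\<close>.\<close>

definition attack_ode ::
  "real \<Rightarrow> real \<Rightarrow> (real \<Rightarrow> real^'d^'d) \<Rightarrow> (real \<Rightarrow> real^'d^'d) \<Rightarrow> (real \<Rightarrow> real^'d^'d) \<Rightarrow>
   (real \<Rightarrow> real^'d^'d) \<Rightarrow> (real \<Rightarrow> real^'d^'d) \<Rightarrow> (real \<Rightarrow> real^'d^'d) \<Rightarrow>
   (real \<Rightarrow> real^'d) \<Rightarrow> (real \<Rightarrow> real^'d) \<Rightarrow> (real \<Rightarrow> real^'d) \<Rightarrow>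
   (real \<Rightarrow> real^'d^'d) \<Rightarrow> (real \<Rightarrow> real^'d^'d) \<Rightarrow> (real \<Rightarrow> real^'d^'d) \<Rightarrow> (real \<Rightarrow> real^'d^'d) \<Rightarrow>
   (real \<Rightarrow> real^'d) \<Rightarrow> (real \<Rightarrow> real^'d) \<Rightarrow> bool" where
  "attack_ode T lam A K F Q Pinv \<Lambda> a r f Fc Fa Gc Ga f\<rho> g\<tau> \<longleftrightarrow>
     (\<forall>t\<in>{0..T}.
        (Fc has_vector_derivative
           - (Fc t ** A t + transpose (A t) ** Fc t - Fc t ** Pinv t ** Fc t
              - Fa t ** \<Lambda> t ** Gc t - (2 * lam) *\<^sub>R Q t)) (at t within {0..T}) \<and>
        (Fa has_vector_derivative
           - (Fa t ** (A t - K t ** F t) + transpose (A t) ** Fa t - Fc t ** K t ** F t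
              - Fc t ** Pinv t ** Fa t - Fa t ** \<Lambda> t ** Ga t)) (at t within {0..T}) \<and>
        (Gc has_vector_derivative
           - (Gc t ** A t + (transpose (A t) - F t ** K t) ** Gc t - F t ** K t ** Fc t
              - Ga t ** \<Lambda> t ** Gc t - Gc t ** Pinv t ** Fc t)) (at t within {0..T}) \<and>
        (Ga has_vector_derivative
           - (Ga t ** (A t - K t ** F t) + (transpose (A t) - F t ** K t) ** Ga t
              - F t ** K t ** Fa t - Gc t ** K t ** F t - Gc t ** Pinv t ** Fa t
              - Ga t ** \<Lambda> t ** Ga t - (2 * lam) *\<^sub>R (F t ** K t ** F t))) (at t within {0..T}) \<and>
        (f\<rho> has_vector_derivative
           - ((transpose (A t) - Fc t ** Pinv t) *v f\<rho> t
              + Fc t *v (a t - (1/2) *\<^sub>R (K t *v f t)) - (Fa t ** \<Lambda> t) *v g\<tau> t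
              + Fa t *v (a t - (1/2) *\<^sub>R (K t *v f t)) + (2 * lam) *\<^sub>R (Q t *v r t)))
           (at t within {0..T}) \<and>
        (g\<tau> has_vector_derivative
           - ((transpose (A t) - F t ** K t) *v g\<tau> t - (Gc t ** Pinv t) *v f\<rho> t
              - (Ga t ** \<Lambda> t) *v g\<tau> t - (F t ** K t) *v f\<rho> t
              + Gc t *v (a t - (1/2) *\<^sub>R (K t *v f t)) + Ga t *v (a t - (1/2) *\<^sub>R (K t *v f t))
              - lam *\<^sub>R ((F t ** K t) *v f t)))
           (at t within {0..T})) \<and>
     Fc T = 0 \<and> Fa T = 0 \<and> Gc T = 0 \<and> Ga T = 0 \<and> f\<rho> T = 0 \<and> g\<tau> T = 0"

definition attack_ode_uniquely_solvable ::
  "real \<Rightarrow> real \<Rightarrow> (real \<Rightarrow> real^'d^'d) \<Rightarrow> (real \<Rightarrow> real^'d^'d) \<Rightarrow> (real \<Rightarrow> real^'d^'d) \<Rightarrow>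
   (real \<Rightarrow> real^'d^'d) \<Rightarrow> (real \<Rightarrow> real^'d^'d) \<Rightarrow> (real \<Rightarrow> real^'d^'d) \<Rightarrow>
   (real \<Rightarrow> real^'d) \<Rightarrow> (real \<Rightarrow> real^'d) \<Rightarrow> (real \<Rightarrow> real^'d) \<Rightarrow> bool" where
  "attack_ode_uniquely_solvable T lam A K F Q Pinv \<Lambda> a r f \<longleftrightarrow>
     (\<exists>Fc Fa Gc Ga f\<rho> g\<tau>. attack_ode T lam A K F Q Pinv \<Lambda> a r f Fc Fa Gc Ga f\<rho> g\<tau> \<and>
        (\<forall>Fc' Fa' Gc' Ga' f\<rho>' g\<tau>'.
           attack_ode T lam A K F Q Pinv \<Lambda> a r f Fc' Fa' Gc' Ga' f\<rho>' g\<tau>' \<longrightarrow>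
           (\<forall>t\<in>{0..T}. Fc' t = Fc t \<and> Fa' t = Fa t \<and> Gc' t = Gc t \<and> Ga' t = Ga t \<and>
              f\<rho>' t = f\<rho> t \<and> g\<tau>' t = g\<tau> t)))"

text \<open>The horizon bound \<open>T < (\<pi>/2) / sqrt(\<dots>)\<close> is multiplied out, so that a vanishing root
  means no restriction on \<open>T\<close> (in HOL, \<open>x / 0 = 0\<close>).\<close>

definition horizon_bound ::
  "real \<Rightarrow> real \<Rightarrow> (real \<Rightarrow> real^'d^'d) \<Rightarrow> (real \<Rightarrow> real^'d^'d) \<Rightarrow> (real \<Rightarrow> real^'d^'d) \<Rightarrow>
   (real \<Rightarrow> real^'d^'d) \<Rightarrow> (real \<Rightarrow> real^'d^'d) \<Rightarrow> (real \<Rightarrow> real^'d^'d) \<Rightarrow> bool" where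
  "horizon_bound T lam A K F Q Pinv \<Lambda> \<longleftrightarrow>
     (let b = max (sup_norm2 T A) (sup_norm2 T (\<lambda>t. A t - K t ** F t))
                + sup_norm2 T (\<lambda>t. K t ** F t)
      in T * sqrt ((2 * lam * max (sup_norm2 T Q) (sup_norm2 T (\<lambda>t. F t ** K t ** F t)) + b)
                 * (max (sup_norm2 T Pinv) (sup_norm2 T \<Lambda>) + b)) < pi / 2)"

end

theory Submission
  imports Defs
begin

text \<open>
  For deterministic attacks the differences between the attacked and the unattacked processes are
  deterministic, being solutions of a linear ODE. Hence the fluctuations of \<open>Xc\<close>, \<open>Xa\<close> and \<open>Xh\<close> around
  their means do not depend on the attack, and the objective equals a constant plus a deterministic
  linear-quadratic functional of the means. In the control variables \<open>\<rho>\<close> and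
  \<open>w = H (m\<^sup>c - m\<^sup>a) + \<tau>\<close> the four matrix equations become a single Riccati equation for a symmetric
  \<open>2d \<times> 2d\<close> matrix, and the problem, which is not convex because of the term \<open>- \<lambda> \<D>\<close>, is solved by
  completing squares. The Riccati equation is solvable under the horizon bound because the norm of
  its solution is dominated by the solution of \<open>y' = c\<^sub>0 + c\<^sub>1 y\<^sup>2\<close>, a tangent.
\<close>

section \<open>Ordinary differential equations on a compact interval\<close>

text \<open>The agent's filter is driven by an integral given only as a limit in probability of
  left-point sums. Inserting the observation equation splits these sums into Wiener sums, common to
  all attacks, and sums that converge path by path; second moments then come from finite sums of
  independent increments. In terms of \<open>w\<close> the filter term \<open>\<Theta>\<close>
  leaves the mean drift, and the control penalties are \<open>P\<close> and the inverse of
  \<open>\<sigma>W ** transpose \<sigma>W\<close>. This is where \<open>\<Lambda>\<close> comes from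
  and why the block matrix is symmetric. Convexity is replaced by existence of the Riccati solution
  on all of \<open>{0..T}\<close>: it provides a quadratic value function whose derivative along any
  trajectory rewrites the objective of every attack as a nonnegative gap plus one common constant.
  Minimisers are therefore exactly the attacks with zero gap. The feedback formula is implicit,
  since the means depend on the attack, so that such an attack exists has to be shown through the
  closed-loop equation. The term \<open>b\<close> occurs in both factors of the horizon bound
  because the linear part of the Riccati equation is estimated by
  \<open>2 |X| <= 1 + |X|^2\<close>.\<close>

lemma picard_lindelof_integral:
  fixes f :: "real \<Rightarrow> 'a::banach \<Rightarrow> 'a"
  assumes T: "0 \<le> T" and L: "0 < L"
    and cont: "continuous_on ({0..T} \<times> UNIV) (\<lambda>(t, x). f t x)"
    and lip: "\<And>t x y. t \<in> {0..T} \<Longrightarrow> norm (f t x - f t y) \<le> L * norm (x - y)"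
  shows "\<exists>x. continuous_on {0..T} x \<and> (\<forall>t\<in>{0..T}. x t = x0 + integral {0..t} (\<lambda>s. f s (x s)))"
proof -
  \<comment> \<open>Clamping time to \<open>{0..T}\<close> extends the iterates to the whole real
    line, the domain of the complete space of bounded continuous functions in which the fixed point
    is sought.\<close>
  define c where "c t = min T (max 0 t)" for t :: real
  have c: "c t \<in> {0..T}" for t using T by (auto simp: c_def)
  have c_id: "c t = t" if "t \<in> {0..T}" for t using that by (auto simp: c_def)
  have c_cont: "continuous_on UNIV c" unfolding c_def by (intro continuous_intros)
  \<comment> \<open>The unknown is \<open>y t = exp (- 2 * L * t) x t\<close>. With this weight the
    integral operator contracts by \<open>1/2\<close> whatever the length of the interval, so no
    gluing of short-time solutions occurs.\<close>
  define g where "g y s = f s (exp (2 * L * s) *\<^sub>R apply_bcontfun y s)" for y :: "real \<Rightarrow>\<^sub>C 'a" and s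
  have g_cont: "continuous_on {0..T} (g y)" for y
  proof -
    have "continuous_on {0..T} (\<lambda>s. (\<lambda>(t, x). f t x) (s, exp (2 * L * s) *\<^sub>R apply_bcontfun y s))"
      by (rule continuous_on_compose2[OF cont]) (auto intro!: continuous_intros)
    then show ?thesis by (simp add: g_def)
  qed
  define G where "G y t = exp (- 2 * L * t) *\<^sub>R (x0 + integral {0..t} (g y))" for y t
  have G_cont: "continuous_on {0..T} (G y)" for y
    unfolding G_def
    by (intro continuous_intros indefinite_integral_continuous_1 integrable_continuous_real g_cont)
  have G_bc: "(\<lambda>t. G y (c t)) \<in> bcontfun" for y
  proof -
    have "continuous_on UNIV (\<lambda>t. G y (c t))"
      by (rule continuous_on_compose2[OF G_cont c_cont]) (use c in auto)
    moreover have "bounded (range (\<lambda>t. G y (c t)))"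
      by (rule bounded_subset[OF compact_imp_bounded[OF compact_continuous_image[OF G_cont]]])
        (use c in auto)
    ultimately show ?thesis by (auto simp: bcontfun_def)
  qed
  define \<Phi> where "\<Phi> y = Bcontfun (\<lambda>t. G y (c t))" for y
  have \<Phi>: "apply_bcontfun (\<Phi> y) t = G y (c t)" for y t
    by (simp add: \<Phi>_def Bcontfun_inverse[OF G_bc])
  have "dist (\<Phi> y) (\<Phi> z) \<le> 1/2 * dist y z" for y z
  proof (rule dist_bound)
    fix t' :: real
    define t where "t = c t'"
    have t: "t \<in> {0..T}" using c by (auto simp: t_def)
    have sub: "{0..t} \<subseteq> {0..T}" using t by auto
    have int: "g y integrable_on {0..t}" for y
      by (rule integrable_continuous_real, rule continuous_on_subset[OF g_cont sub])
    have "norm (integral {0..t} (g y) - integral {0..t} (g z))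
        = norm (integral {0..t} (\<lambda>s. g y s - g z s))"
      by (simp add: integral_diff int)
    also have "\<dots> \<le> integral {0..t} (\<lambda>s. (L * dist y z) * exp (2 * L * s))"
    proof (rule integral_norm_bound_integral)
      show "(\<lambda>s. g y s - g z s) integrable_on {0..t}" by (intro integrable_diff int)
      show "(\<lambda>s. (L * dist y z) * exp (2 * L * s)) integrable_on {0..t}"
        by (intro integrable_continuous_real continuous_intros)
      fix s assume "s \<in> {0..t}"
      then have "s \<in> {0..T}" using sub by auto
      then have "norm (g y s - g z s)
          \<le> L * norm (exp (2 * L * s) *\<^sub>R apply_bcontfun y s - exp (2 * L * s) *\<^sub>R apply_bcontfun z s)"
        unfolding g_def by (rule lip)
      also have "\<dots> = L * (exp (2 * L * s) * dist (apply_bcontfun y s) (apply_bcontfun z s))"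
        by (simp add: dist_norm flip: scaleR_diff_right)
      also have "\<dots> \<le> L * (exp (2 * L * s) * dist y z)"
        using L by (intro mult_left_mono dist_bounded) auto
      finally show "norm (g y s - g z s) \<le> (L * dist y z) * exp (2 * L * s)" by (simp add: mult_ac)
    qed
    also have "\<dots> = (L * dist y z) * ((exp (2 * L * t) - 1) / (2 * L))"
    proof -
      have "((\<lambda>s. exp (2 * L * s)) has_integral (exp (2 * L * t) / (2 * L) - exp (2 * L * 0) / (2 * L))) {0..t}"
        using t L
        by (intro fundamental_theorem_of_calculus)
          (auto intro!: derivative_eq_intros simp flip: has_real_derivative_iff_has_vector_derivative)
      then show ?thesis by (simp add: integral_unique diff_divide_distrib)
    qed
    also have "\<dots> \<le> dist y z / 2 * exp (2 * L * t)"
      using L by (simp add: field_simps)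
    finally have *: "norm (integral {0..t} (g y) - integral {0..t} (g z)) \<le> dist y z / 2 * exp (2 * L * t)" .
    have "dist (G y t) (G z t) = exp (- 2 * L * t) * norm (integral {0..t} (g y) - integral {0..t} (g z))"
      by (simp add: G_def dist_norm flip: scaleR_diff_right)
    also have "\<dots> \<le> exp (- 2 * L * t) * (dist y z / 2 * exp (2 * L * t))"
      using * by (intro mult_left_mono) auto
    also have "\<dots> = dist y z / 2" by (simp add: exp_minus)
    finally show "dist (apply_bcontfun (\<Phi> y) t') (apply_bcontfun (\<Phi> z) t') \<le> 1/2 * dist y z"
      by (simp add: \<Phi> t_def)
  qed
  then have "\<exists>!y. \<Phi> y = y"
    by (intro banach_fix_type[of "1/2"]) auto
  then obtain y where y: "\<Phi> y = y" by auto
  define x where "x t = exp (2 * L * t) *\<^sub>R apply_bcontfun y t" for t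
  have "x t = x0 + integral {0..t} (\<lambda>s. f s (x s))" if "t \<in> {0..T}" for t
  proof -
    have "apply_bcontfun y t = G y t"
      using \<Phi>[of y t] y c_id[OF that] by simp
    moreover have "g y = (\<lambda>s. f s (x s))" by (auto simp: g_def x_def)
    ultimately show ?thesis by (simp add: x_def G_def exp_minus)
  qed
  moreover have "continuous_on {0..T} x" unfolding x_def by (intro continuous_intros) auto
  ultimately show ?thesis by blast
qed

lemma picard_lindelof:
  fixes f :: "real \<Rightarrow> 'a::banach \<Rightarrow> 'a"
  assumes T: "0 \<le> T"
    and cont: "continuous_on ({0..T} \<times> UNIV) (\<lambda>(t, x). f t x)"
    and lip: "\<And>t x y. t \<in> {0..T} \<Longrightarrow> norm (f t x - f t y) \<le> L * norm (x - y)"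
  shows "\<exists>x. x 0 = x0 \<and> (\<forall>t\<in>{0..T}. (x has_vector_derivative f t (x t)) (at t within {0..T}))"
proof -
  have "norm (f t x - f t y) \<le> max L 1 * norm (x - y)" if "t \<in> {0..T}" for t x y
    using lip[OF that, of x y] by (meson max.cobounded1 mult_right_mono norm_ge_zero order_trans)
  then have "\<exists>x. continuous_on {0..T} x \<and> (\<forall>t\<in>{0..T}. x t = x0 + integral {0..t} (\<lambda>s. f s (x s)))"
    by (intro picard_lindelof_integral[OF T _ cont, of "max L 1"]) auto
  then obtain x where xc: "continuous_on {0..T} x"
    and x: "\<And>t. t \<in> {0..T} \<Longrightarrow> x t = x0 + integral {0..t} (\<lambda>s. f s (x s))"
    by blast
  have fc: "continuous_on {0..T} (\<lambda>s. f s (x s))"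
    using continuous_on_compose2[OF cont continuous_on_Pair[OF continuous_on_id xc]] by (auto simp: id_def)
  have "(x has_vector_derivative f t (x t)) (at t within {0..T})" if "t \<in> {0..T}" for t
  proof -
    have "((\<lambda>u. x0 + integral {0..u} (\<lambda>s. f s (x s))) has_vector_derivative 0 + f t (x t)) (at t within {0..T})"
      by (intro has_vector_derivative_add has_vector_derivative_const
          integral_has_vector_derivative[OF fc] that)
    then show ?thesis
      using has_vector_derivative_transform[OF that, of x] x by auto
  qed
  moreover have "x 0 = x0" using x[of 0] T by simp
  ultimately show ?thesis by blast
qed

section \<open>Gronwall's inequality, time reversal and uniqueness\<close>

lemma gronwall:
  fixes g :: "real \<Rightarrow> real"
  assumes cont: "continuous_on {0..T} g" and L: "0 \<le> L"
    and g: "\<And>t. t \<in> {0..T} \<Longrightarrow> g t \<le> a + L * integral {0..t} g" and t: "t \<in> {0..T}"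
  shows "g t \<le> a * exp (L * t)"
proof -
  \<comment> \<open>\<open>h\<close> is the assumed upper bound times an integrating factor. Its
    derivative has the sign of \<open>g s\<close> minus that bound, hence is nonpositive, and
    \<open>h 0 = a\<close>.\<close>
  define h where "h s = exp (- L * s) * (a + L * integral {0..s} g)" for s
  have "h t \<le> h 0"
  proof (rule DERIV_nonpos_imp_decreasing_open[where f = h])
    show "0 \<le> t" using t by auto
    show "continuous_on {0..t} h"
      unfolding h_def using t
      by (intro continuous_intros indefinite_integral_continuous_1 integrable_continuous_real
          continuous_on_subset[OF cont]) auto
    fix s assume s: "0 < s" "s < t"
    have "((\<lambda>u. integral {0..u} g) has_vector_derivative g s) (at s within {0..T})"
      using s t by (intro integral_has_vector_derivative[OF cont]) auto
    moreover have "at s within {0..T} = at s" using s t by (intro at_within_interior) auto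
    ultimately have [derivative_intros]: "((\<lambda>u. integral {0..u} g) has_real_derivative g s) (at s)"
      by (simp add: has_real_derivative_iff_has_vector_derivative)
    have "(h has_real_derivative exp (- L * s) * (L * (g s - (a + L * integral {0..s} g)))) (at s)"
      unfolding h_def by (auto intro!: derivative_eq_intros simp: algebra_simps)
    moreover have "exp (- L * s) * (L * (g s - (a + L * integral {0..s} g))) \<le> 0"
      using g[of s] s t L by (intro mult_nonneg_nonpos) auto
    ultimately show "\<exists>y. DERIV h s :> y \<and> y \<le> 0" by blast
  qed
  then have "exp (- L * t) * (a + L * integral {0..t} g) \<le> a" by (simp add: h_def)
  then have "a + L * integral {0..t} g \<le> a * exp (L * t)"
    by (simp add: exp_minus field_simps)
  with g[OF t] show ?thesis by linarith
qed

text \<open>Time reversal: all equations of the attacker carry terminal conditions and are reduced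
  by it to initial value problems.\<close>

lemma has_vector_derivative_reflect:
  fixes x :: "real \<Rightarrow> 'a::real_normed_vector"
  assumes "(x has_vector_derivative D) (at (T - s) within {0..T})"
  shows "((\<lambda>s. x (T - s)) has_vector_derivative - D) (at s within {0..T})"
proof -
  have im: "(\<lambda>s. T - s) ` {0..T} = {0..T}"
    by (auto simp: image_iff intro!: bexI[of _ "T - _"])
  have "((\<lambda>s. T - s) has_vector_derivative - 1) (at s within {0..T})"
    by (auto intro!: derivative_eq_intros)
  from vector_diff_chain_within[OF this, of x D] assms show ?thesis
    by (simp add: im o_def)
qed

lemma ode_integral:
  fixes x :: "real \<Rightarrow> 'a::banach"
  assumes x: "\<And>t. t \<in> {0..T} \<Longrightarrow> (x has_vector_derivative D t) (at t within {0..T})" and t: "t \<in> {0..T}"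
  shows "(D has_integral (x t - x 0)) {0..t}"
proof (rule fundamental_theorem_of_calculus)
  fix s assume s: "s \<in> {0..t}"
  show "(x has_vector_derivative D s) (at s within {0..t})"
    by (rule has_vector_derivative_within_subset[OF x]) (use s t in auto)
qed (use t in auto)

lemma derivative_imp_continuous:
  fixes x :: "real \<Rightarrow> 'a::real_normed_vector"
  assumes "\<And>t. t \<in> S \<Longrightarrow> (x has_vector_derivative D t) (at t within S)"
  shows "continuous_on S x"
  by (auto simp: continuous_on_eq_continuous_within intro: has_vector_derivative_continuous assms)

lemma integral_inequality_zero:
  fixes y :: "real \<Rightarrow> 'a::real_normed_vector"
  assumes cont: "continuous_on {0..T} y" and L: "0 \<le> L"
    and y: "\<And>t. t \<in> {0..T} \<Longrightarrow> norm (y t) \<le> L * integral {0..t} (\<lambda>s. norm (y s))" and t: "t \<in> {0..T}"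
  shows "y t = 0"
  using gronwall[of T "\<lambda>t. norm (y t)" L 0 t] assms by (auto intro: continuous_intros)

text \<open>The Lipschitz estimate is asked for only along the two given curves. A Riccati equation,
  which is merely locally Lipschitz, qualifies in this form because its solutions are bounded on a
  compact interval.\<close>

lemma ode_unique:
  fixes x y :: "real \<Rightarrow> 'a::banach"
  assumes x: "\<And>t. t \<in> {0..T} \<Longrightarrow> (x has_vector_derivative x' t) (at t within {0..T})"
    and y: "\<And>t. t \<in> {0..T} \<Longrightarrow> (y has_vector_derivative y' t) (at t within {0..T})"
    and lip: "\<And>t. t \<in> {0..T} \<Longrightarrow> norm (x' t - y' t) \<le> L * norm (x t - y t)"
    and "x 0 = y 0" and t: "t \<in> {0..T}"
  shows "x t = y t"
proof -
  have d: "((\<lambda>t. x t - y t) has_vector_derivative x' t - y' t) (at t within {0..T})"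
    if "t \<in> {0..T}" for t using x y that by (intro has_vector_derivative_diff) auto
  have cont: "continuous_on {0..T} (\<lambda>t. x t - y t)" by (rule derivative_imp_continuous[OF d])
  have lip': "norm (x' t - y' t) \<le> \<bar>L\<bar> * norm (x t - y t)" if "t \<in> {0..T}" for t
    using lip[OF that] by (meson abs_ge_self mult_right_mono norm_ge_zero order_trans)
  have "norm (x t - y t) \<le> \<bar>L\<bar> * integral {0..t} (\<lambda>s. norm (x s - y s))" if t: "t \<in> {0..T}" for t
  proof -
    have "((\<lambda>s. x' s - y' s) has_integral ((x t - y t) - (x 0 - y 0))) {0..t}"
      by (rule ode_integral[OF d t])
    then have I: "((\<lambda>s. x' s - y' s) has_integral (x t - y t)) {0..t}" using assms by simp
    have "norm (integral {0..t} (\<lambda>s. x' s - y' s)) \<le> integral {0..t} (\<lambda>s. \<bar>L\<bar> * norm (x s - y s))"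
    proof (rule integral_norm_bound_integral)
      show "(\<lambda>s. \<bar>L\<bar> * norm (x s - y s)) integrable_on {0..t}"
        using t by (auto intro!: integrable_continuous_real continuous_intros continuous_on_subset[OF cont])
    qed (use I lip' t in auto)
    then show ?thesis using I by (simp add: integral_unique)
  qed
  then have "x t - y t = 0" by (intro integral_inequality_zero[OF cont _ _ t, of "\<bar>L\<bar>"]) auto
  then show ?thesis by simp
qed

lemma ode_unique_terminal:
  fixes x y :: "real \<Rightarrow> 'a::banach"
  assumes x: "\<And>t. t \<in> {0..T} \<Longrightarrow> (x has_vector_derivative x' t) (at t within {0..T})"
    and y: "\<And>t. t \<in> {0..T} \<Longrightarrow> (y has_vector_derivative y' t) (at t within {0..T})"
    and lip: "\<And>t. t \<in> {0..T} \<Longrightarrow> norm (x' t - y' t) \<le> L * norm (x t - y t)"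
    and "x T = y T" and t: "t \<in> {0..T}"
  shows "x t = y t"
proof -
  have "x (T - (T - t)) = y (T - (T - t))"
  proof (rule ode_unique[where T = T and x = "\<lambda>s. x (T - s)" and y = "\<lambda>s. y (T - s)"
        and x' = "\<lambda>s. - x' (T - s)" and y' = "\<lambda>s. - y' (T - s)" and L = L])
    fix s assume s: "s \<in> {0..T}"
    then have s': "T - s \<in> {0..T}" by auto
    show "((\<lambda>s. x (T - s)) has_vector_derivative - x' (T - s)) (at s within {0..T})"
      "((\<lambda>s. y (T - s)) has_vector_derivative - y' (T - s)) (at s within {0..T})"
      by (rule has_vector_derivative_reflect, rule x[OF s'])
        (rule has_vector_derivative_reflect, rule y[OF s'])
    show "norm (- x' (T - s) - - y' (T - s)) \<le> L * norm (x (T - s) - y (T - s))"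
      using lip[OF s'] by (simp add: norm_minus_commute)
  qed (use assms in auto)
  then show ?thesis by simp
qed

lemma continuous_on_bounded_norm:
  fixes f :: "real \<Rightarrow> 'a::real_normed_vector"
  assumes "continuous_on {0..T} f"
  obtains B where "0 \<le> B" "\<And>t. t \<in> {0..T} \<Longrightarrow> norm (f t) \<le> B"
proof -
  have "bounded (f ` {0..T})" using assms by (intro compact_imp_bounded compact_continuous_image) auto
  then obtain B where "\<forall>y\<in>f ` {0..T}. norm y \<le> B" by (auto simp: bounded_iff)
  then have "norm (f t) \<le> \<bar>B\<bar>" if "t \<in> {0..T}" for t
    using that by (meson abs_ge_self imageI order_trans)
  then show thesis by (rule that[OF abs_ge_zero])
qed

section \<open>Linear equations\<close>

lemma linear_ode_exists:
  fixes L :: "real \<Rightarrow> 'a::banach \<Rightarrow>\<^sub>L 'a"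
  assumes "0 \<le> T" and L: "continuous_on {0..T} L" and b: "continuous_on {0..T} b"
  shows "\<exists>x. x 0 = x0 \<and> (\<forall>t\<in>{0..T}. (x has_vector_derivative L t (x t) + b t) (at t within {0..T}))"
proof -
  obtain B where B: "\<And>t. t \<in> {0..T} \<Longrightarrow> norm (L t) \<le> B"
    using continuous_on_bounded_norm[OF L] by blast
  show ?thesis
  proof (rule picard_lindelof[where L = B, OF \<open>0 \<le> T\<close>])
    show "continuous_on ({0..T} \<times> UNIV) (\<lambda>(t, x). blinfun_apply (L t) x + b t)"
      unfolding case_prod_beta
      by (intro continuous_intros continuous_on_compose2[OF L] continuous_on_compose2[OF b]) auto
    fix t x y assume t: "t \<in> {0..T}"
    have "norm (L t x + b t - (L t y + b t)) = norm (L t (x - y))"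
      by (simp add: blinfun.diff_right)
    also have "\<dots> \<le> norm (L t) * norm (x - y)" by (rule norm_blinfun)
    also have "\<dots> \<le> B * norm (x - y)" using B[OF t] by (intro mult_right_mono) auto
    finally show "norm (L t x + b t - (L t y + b t)) \<le> B * norm (x - y)" .
  qed
qed

lemma linear_ode_exists_terminal:
  fixes L :: "real \<Rightarrow> 'a::banach \<Rightarrow>\<^sub>L 'a"
  assumes T: "0 \<le> T" and L: "continuous_on {0..T} L" and b: "continuous_on {0..T} b"
  shows "\<exists>x. x T = x0 \<and> (\<forall>t\<in>{0..T}. (x has_vector_derivative L t (x t) + b t) (at t within {0..T}))"
proof -
  have refl: "continuous_on {0..T} (\<lambda>s. - g (T - s))" if "continuous_on {0..T} g"
    for g :: "real \<Rightarrow> 'c::real_normed_vector"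
    by (intro continuous_intros continuous_on_compose2[OF that]) auto
  obtain y where y0: "y 0 = x0"
    and y: "\<And>t. t \<in> {0..T} \<Longrightarrow> (y has_vector_derivative (- L (T - t)) (y t) + - b (T - t)) (at t within {0..T})"
    using linear_ode_exists[OF T refl[OF L] refl[OF b], of x0] by auto
  define x where "x t = y (T - t)" for t
  have "(x has_vector_derivative L t (x t) + b t) (at t within {0..T})" if "t \<in> {0..T}" for t
    using has_vector_derivative_reflect[of y _ T t, OF y] that
    by (simp add: x_def[abs_def] blinfun.minus_left add.commute)
  then show ?thesis using y0 by (intro exI[of _ x]) (auto simp: x_def)
qed

subsection \<open>Quadratic growth and Riccati equations\<close>

lemma tan_bound:
  fixes y :: "real \<Rightarrow> real"
  assumes y: "\<And>t. t \<in> {0..T} \<Longrightarrow> (y has_real_derivative y' t) (at t within {0..T})"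
    and y': "\<And>t. t \<in> {0..T} \<Longrightarrow> y' t \<le> c0 + c1 * (y t)\<^sup>2"
    and "y 0 = 0" and c: "0 < c0" "0 < c1" and T: "T * sqrt (c0 * c1) < pi / 2" and t: "t \<in> {0..T}"
  shows "y t \<le> sqrt (c0 / c1) * tan (T * sqrt (c0 * c1))"
proof -
  \<comment> \<open>With this \<open>k\<close>, \<open>k * (c0 + c1 * y^2)\<close> equals
    \<open>sqrt (c0 * c1) * (1 + (k * y)^2)\<close>, so \<open>arctan (k * y)\<close> grows at most
    at the constant rate \<open>sqrt (c0 * c1)\<close>.\<close>
  define k where "k = sqrt (c1 / c0)"
  have k: "0 < k" "k\<^sup>2 = c1 / c0" using c by (auto simp: k_def)
  have kc: "k * c0 = sqrt (c0 * c1)"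
    using c by (simp add: k_def real_sqrt_divide real_sqrt_mult field_simps)
  define h where "h s = arctan (k * y s) - s * sqrt (c0 * c1)" for s
  have ycont: "continuous_on {0..T} y"
    using y by (intro derivative_imp_continuous) (auto simp: has_real_derivative_iff_has_vector_derivative)
  have "h t \<le> h 0"
  proof (rule DERIV_nonpos_imp_decreasing_open[where f = h])
    show "0 \<le> t" using t by auto
    show "continuous_on {0..t} h"
      unfolding h_def using t by (intro continuous_intros continuous_on_subset[OF ycont]) auto
    fix s assume s: "0 < s" "s < t"
    have "at s within {0..T} = at s" using s t by (intro at_within_interior) auto
    then have [derivative_intros]: "(y has_real_derivative y' s) (at s)" using y[of s] s t by simp
    have "(h has_real_derivative k * y' s / (1 + (k * y s)\<^sup>2) - sqrt (c0 * c1)) (at s)"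
      unfolding h_def by (auto intro!: derivative_eq_intros simp: field_simps)
    moreover have "k * y' s \<le> sqrt (c0 * c1) * (1 + (k * y s)\<^sup>2)"
    proof -
      have "k * y' s \<le> k * (c0 + c1 * (y s)\<^sup>2)" using y'[of s] s t k by (intro mult_left_mono) auto
      also have "\<dots> = sqrt (c0 * c1) * (1 + (k * y s)\<^sup>2)"
        unfolding kc[symmetric] using k c by (simp add: power_mult_distrib field_simps)
      finally show ?thesis .
    qed
    then have "k * y' s / (1 + (k * y s)\<^sup>2) - sqrt (c0 * c1) \<le> 0"
      by (simp add: pos_divide_le_eq add_pos_nonneg)
    ultimately show "\<exists>z. DERIV h s :> z \<and> z \<le> 0" by blast
  qed
  then have "arctan (k * y t) \<le> t * sqrt (c0 * c1)" using \<open>y 0 = 0\<close> by (simp add: h_def)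
  also have "\<dots> \<le> T * sqrt (c0 * c1)" using t c by (intro mult_right_mono) auto
  finally have le: "arctan (k * y t) \<le> T * sqrt (c0 * c1)" .
  \<comment> \<open>\<open>tan\<close> is increasing only between \<open>- pi / 2\<close> and
    \<open>pi / 2\<close>; the horizon condition keeps the right-hand argument there.\<close>
  have "- (pi / 2) < arctan (k * y t)" by (simp add: arctan_lbound)
  then have "tan (arctan (k * y t)) \<le> tan (T * sqrt (c0 * c1))" using le T by (subst tan_mono_le_eq) auto
  then have "y t \<le> tan (T * sqrt (c0 * c1)) / k" using k by (simp add: tan_arctan field_simps)
  also have "1 / k = sqrt (c0 / c1)" using c by (simp add: k_def real_sqrt_divide)
  then have "tan (T * sqrt (c0 * c1)) / k = sqrt (c0 / c1) * tan (T * sqrt (c0 * c1))"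
    by (metis mult.commute times_divide_eq_right mult.right_neutral)
  finally show ?thesis .
qed

text \<open>The derivative \<open>x'\<close> is the only thing that is assumed about \<open>x\<close>, so the bound applies to the
  equation with truncated right-hand side.\<close>

lemma quadratic_growth_bound:
  fixes x :: "real \<Rightarrow> 'a::banach"
  assumes x: "\<And>t. t \<in> {0..T} \<Longrightarrow> (x has_vector_derivative x' t) (at t within {0..T})"
    and x': "\<And>t. t \<in> {0..T} \<Longrightarrow> norm (x' t) \<le> c0 + c1 * (norm (x t))\<^sup>2"
    and "x 0 = 0" and c: "0 < c0" "0 < c1" and T: "T * sqrt (c0 * c1) < pi / 2" and t: "t \<in> {0..T}"
  shows "norm (x t) \<le> sqrt (c0 / c1) * tan (T * sqrt (c0 * c1))"
proof -
  define g where "g s = c0 + c1 * (norm (x s))\<^sup>2" for s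
  have gc: "continuous_on {0..T} g"
    unfolding g_def by (intro continuous_intros derivative_imp_continuous[OF x])
  \<comment> \<open>\<open>norm (x s)\<close> need not be differentiable. The comparison therefore
    runs through its integral majorant \<open>y\<close>, which obeys the scalar inequality because
    \<open>norm (x s) \<le> y s\<close>.\<close>
  define y where "y s = integral {0..s} g" for s
  have xy: "norm (x s) \<le> y s" if s: "s \<in> {0..T}" for s
  proof -
    have I: "(x' has_integral x s) {0..s}" using ode_integral[OF x s] \<open>x 0 = 0\<close> by simp
    have "norm (integral {0..s} x') \<le> integral {0..s} g"
    proof (rule integral_norm_bound_integral)
      show "g integrable_on {0..s}"
        using s by (auto intro!: integrable_continuous_real continuous_on_subset[OF gc])
    qed (use I x' s in \<open>auto simp: g_def\<close>)
    then show ?thesis using I by (simp add: y_def integral_unique)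
  qed
  have "y t \<le> sqrt (c0 / c1) * tan (T * sqrt (c0 * c1))"
  proof (rule tan_bound[OF _ _ _ c T t])
    fix s assume s: "s \<in> {0..T}"
    show "(y has_real_derivative g s) (at s within {0..T})"
      unfolding y_def has_real_derivative_iff_has_vector_derivative
      by (rule integral_has_vector_derivative[OF gc s])
    show "g s \<le> c0 + c1 * (y s)\<^sup>2"
      unfolding g_def using xy[OF s] c by (intro add_left_mono mult_left_mono power_mono) auto
  qed (auto simp: y_def)
  then show ?thesis using xy[OF t] by linarith
qed

text \<open>Retraction onto the ball of radius \<open>\<rho>\<close>. Composing with it makes the
  quadratic Riccati right-hand side globally Lipschitz without changing it inside the ball.\<close>

definition radial_proj :: "real \<Rightarrow> 'a::real_normed_vector \<Rightarrow> 'a" where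
  "radial_proj \<rho> x = (\<rho> / max \<rho> (norm x)) *\<^sub>R x"

lemma radial_proj_id: "0 < \<rho> \<Longrightarrow> norm x \<le> \<rho> \<Longrightarrow> radial_proj \<rho> x = x"
  by (simp add: radial_proj_def max_def)

lemma norm_radial_proj:
  assumes "0 < \<rho>" shows "norm (radial_proj \<rho> x) \<le> \<rho>" "norm (radial_proj \<rho> x) \<le> norm x"
proof -
  have "0 < max \<rho> (norm x)" using assms by linarith
  then have *: "norm (radial_proj \<rho> x) = \<rho> * norm x / max \<rho> (norm x)"
    using assms by (simp add: radial_proj_def)
  show "norm (radial_proj \<rho> x) \<le> \<rho>" "norm (radial_proj \<rho> x) \<le> norm x"
    unfolding * using assms by (auto simp: divide_le_eq max_def mult_ac intro: mult_left_mono)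
qed

lemma radial_proj_lipschitz:
  assumes \<rho>: "0 < \<rho>" shows "norm (radial_proj \<rho> x - radial_proj \<rho> y) \<le> 2 * norm (x - y)"
proof -
  have *: "norm (radial_proj \<rho> x - radial_proj \<rho> y) \<le> 2 * norm (x - y)" if "norm y \<le> norm x"
    for x y :: 'a
  proof -
    define a b where "a = max \<rho> (norm x)" and "b = max \<rho> (norm y)"
    have ab: "0 < b" "b \<le> a" "\<rho> \<le> a" "norm y \<le> b" "a - b \<le> norm x - norm y" "0 < a"
      using \<rho> that by (auto simp: a_def b_def)
    \<comment> \<open>The first term moves the point with the scaling of \<open>x\<close>, the
      second corrects the scaling at \<open>y\<close>. Each costs at most
      \<open>norm (x - y)\<close>, hence the constant 2, valid in every normed space.\<close>
    have "radial_proj \<rho> x - radial_proj \<rho> y = (\<rho> / a) *\<^sub>R (x - y) - (\<rho> * (a - b) / (a * b)) *\<^sub>R y"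
      using ab by (simp add: radial_proj_def a_def[symmetric] b_def[symmetric] algebra_simps
          diff_divide_distrib flip: scaleR_add_left)
    then have "norm (radial_proj \<rho> x - radial_proj \<rho> y)
        \<le> norm ((\<rho> / a) *\<^sub>R (x - y)) + norm ((\<rho> * (a - b) / (a * b)) *\<^sub>R y)"
      using norm_triangle_ineq4 by metis
    also have "\<dots> = (\<rho> / a) * norm (x - y) + (\<rho> / a) * (a - b) * (norm y / b)"
      using ab \<rho> by simp
    also have "\<dots> \<le> 1 * norm (x - y) + 1 * norm (x - y) * 1"
    proof (intro add_mono mult_mono)
      show "a - b \<le> norm (x - y)" using ab norm_triangle_ineq2[of x y] by linarith
    qed (use ab \<rho> in auto)
    finally show ?thesis by simp
  qed
  show ?thesis
    using *[of x y] *[of y x] by (cases "norm x \<le> norm y") (auto simp: norm_minus_commute)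
qed

lemma radial_proj_continuous:
  assumes "0 < \<rho>" shows "continuous_on S (radial_proj \<rho>)"
proof -
  have "max \<rho> (norm x) \<noteq> 0" for x :: 'a using assms by linarith
  then show ?thesis unfolding radial_proj_def by (intro continuous_intros) auto
qed

text \<open>\<open>A'\<close> plays the part of the adjoint of \<open>A\<close>; it is a separate
  argument because \<open>'e\<close> carries no inner product here. The minus signs at the quadratic
  and constant terms follow the attacker's system, which reads
  \<open>X' = - riccati_map\<close>.\<close>

definition riccati_map ::
  "('e::real_normed_vector \<Rightarrow>\<^sub>L 'e) \<Rightarrow> ('e \<Rightarrow>\<^sub>L 'e) \<Rightarrow> ('e \<Rightarrow>\<^sub>L 'e) \<Rightarrow> ('e \<Rightarrow>\<^sub>L 'e) \<Rightarrow> ('e \<Rightarrow>\<^sub>L 'e) \<Rightarrow> 'e \<Rightarrow>\<^sub>L 'e"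
  where "riccati_map A A' S C X = (X o\<^sub>L A) + (A' o\<^sub>L X) - (X o\<^sub>L S o\<^sub>L X) - C"

text \<open>The quadratic term is handled by
  \<open>X S X - Y S Y = (X - Y) S X + Y S (X - Y)\<close>, which gives a Lipschitz constant on each
  ball.\<close>

lemma riccati_lipschitz:
  fixes X Y :: "'e::real_normed_vector \<Rightarrow>\<^sub>L 'e"
  assumes "norm A \<le> b" "norm A' \<le> b" "norm S \<le> s" "norm X \<le> \<rho>" "norm Y \<le> \<rho>"
  shows "norm (riccati_map A A' S C X - riccati_map A A' S C Y)
    \<le> (2 * b + 2 * s * \<rho>) * norm (X - Y)"
proof -
  have nn: "0 \<le> b" "0 \<le> s" "0 \<le> \<rho>" using assms norm_ge_zero order_trans by blast+
  have "riccati_map A A' S C X - riccati_map A A' S C Y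
      = ((X - Y) o\<^sub>L A) + (A' o\<^sub>L (X - Y)) - ((X - Y) o\<^sub>L S o\<^sub>L X) - (Y o\<^sub>L S o\<^sub>L (X - Y))"
    by (rule blinfun_eqI) (simp add: riccati_map_def blinfun.bilinear_simps)
  also have "norm \<dots> \<le> norm ((X - Y) o\<^sub>L A) + norm (A' o\<^sub>L (X - Y)) + norm ((X - Y) o\<^sub>L S o\<^sub>L X)
      + norm (Y o\<^sub>L S o\<^sub>L (X - Y))"
    by norm
  also have "\<dots> \<le> norm (X - Y) * b + b * norm (X - Y) + norm (X - Y) * s * \<rho> + \<rho> * s * norm (X - Y)"
    using nn assms
    by (intro add_mono order_trans[OF norm_blinfun_compose] mult_mono mult_nonneg_nonneg) auto
  finally show ?thesis by (simp add: algebra_simps)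
qed

text \<open>The linear terms \<open>2 b |X|\<close> are absorbed by
  \<open>2 |X| <= 1 + |X|^2\<close>. This turns the growth into the pure form
  \<open>c0 + c1 y^2\<close> and is the origin of the summand \<open>b\<close> in both factors of
  the horizon bound.\<close>

lemma riccati_growth:
  fixes X :: "'e::real_normed_vector \<Rightarrow>\<^sub>L 'e"
  assumes "norm A \<le> b" "norm A' \<le> b" "norm S \<le> s" "norm C \<le> c"
  shows "norm (riccati_map A A' S C X) \<le> (c + b) + (s + b) * (norm X)\<^sup>2"
proof -
  have nn: "0 \<le> b" "0 \<le> s" using assms norm_ge_zero order_trans by blast+
  have "norm (riccati_map A A' S C X)
      \<le> norm (X o\<^sub>L A) + norm (A' o\<^sub>L X) + norm (X o\<^sub>L S o\<^sub>L X) + norm C"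
    unfolding riccati_map_def by norm
  also have "\<dots> \<le> norm X * b + b * norm X + norm X * s * norm X + c"
    using nn assms
    by (intro add_mono order_trans[OF norm_blinfun_compose] mult_mono mult_nonneg_nonneg) auto
  also have "\<dots> = b * (2 * norm X) + s * (norm X)\<^sup>2 + c" by (simp add: power2_eq_square)
  also have "\<dots> \<le> b * (1 + (norm X)\<^sup>2) + s * (norm X)\<^sup>2 + c"
  proof -
    have "0 \<le> (norm X - 1)\<^sup>2" by simp
    then have "2 * norm X \<le> 1 + (norm X)\<^sup>2" by (simp add: power2_eq_square algebra_simps)
    then show ?thesis using nn by (intro add_right_mono mult_left_mono) auto
  qed
  finally show ?thesis by (simp add: algebra_simps)
qed

lemma riccati_exists_initial:
  fixes A A' S C :: "real \<Rightarrow> 'e::banach \<Rightarrow>\<^sub>L 'e"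
  assumes T: "0 \<le> T"
    and cont: "continuous_on {0..T} A" "continuous_on {0..T} A'" "continuous_on {0..T} S" "continuous_on {0..T} C"
    and bnd: "\<And>t. t \<in> {0..T} \<Longrightarrow> norm (A t) \<le> b" "\<And>t. t \<in> {0..T} \<Longrightarrow> norm (A' t) \<le> b"
      "\<And>t. t \<in> {0..T} \<Longrightarrow> norm (S t) \<le> s" "\<And>t. t \<in> {0..T} \<Longrightarrow> norm (C t) \<le> c"
    and small: "T * sqrt ((c + b) * (s + b)) < pi / 2"
  shows "\<exists>X. X 0 = 0 \<and> (\<forall>t\<in>{0..T}. (X has_vector_derivative
    riccati_map (A t) (A' t) (S t) (C t) (X t)) (at t within {0..T}))"
proof -
  have "0 \<in> {0..T}" using T by auto
  then have nn: "0 \<le> b" "0 \<le> s" "0 \<le> c" using bnd norm_ge_zero order_trans by blast+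
  \<comment> \<open>\<open>c + b\<close> or \<open>s + b\<close> may be 0, while the comparison with
    the tangent requires positive coefficients. The strict horizon inequality survives a small
    increase of both.\<close>
  obtain e where e: "0 < e" "T * sqrt ((c + b + e) * (s + b + e)) < pi / 2"
  proof -
    have "((\<lambda>e. T * sqrt ((c + b + e) * (s + b + e))) \<longlongrightarrow> T * sqrt ((c + b + 0) * (s + b + 0))) (at_right 0)"
      by (intro tendsto_intros)
    then have "\<forall>\<^sub>F e in at_right 0. T * sqrt ((c + b + e) * (s + b + e)) < pi / 2"
      using small by (intro order_tendstoD(2)) auto
    then have "\<forall>\<^sub>F e in at_right 0. (0::real) < e \<and> T * sqrt ((c + b + e) * (s + b + e)) < pi / 2"
      using eventually_at_right_less[of "0::real"] by eventually_elim auto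
    then show ?thesis using that eventually_happens[of _ "at_right (0::real)"] by auto
  qed
  define c0 c1 where "c0 = c + b + e" and "c1 = s + b + e"
  have c01: "0 < c0" "0 < c1" using e nn by (auto simp: c0_def c1_def)
  \<comment> \<open>The truncation radius is the a priori bound itself; the maximum with 1 secures
    positivity.\<close>
  define \<rho> where "\<rho> = max 1 (sqrt (c0 / c1) * tan (T * sqrt (c0 * c1)))"
  have \<rho>: "0 < \<rho>" by (auto simp: \<rho>_def)
  define g where "g t X = riccati_map (A t) (A' t) (S t) (C t) X" for t X
  have "\<exists>X. X 0 = 0 \<and> (\<forall>t\<in>{0..T}. (X has_vector_derivative g t (radial_proj \<rho> (X t))) (at t within {0..T}))"
  proof (rule picard_lindelof[OF T, where L = "(2 * b + 2 * s * \<rho>) * 2"])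
    show "continuous_on ({0..T} \<times> UNIV) (\<lambda>(t, X). g t (radial_proj \<rho> X))"
      unfolding g_def riccati_map_def case_prod_beta
      by (intro continuous_intros continuous_on_compose2[OF cont(1)] continuous_on_compose2[OF cont(2)]
          continuous_on_compose2[OF cont(3)] continuous_on_compose2[OF cont(4)]
          continuous_on_compose2[OF radial_proj_continuous[OF \<rho>, of UNIV]]) auto
    fix t X Y assume t: "t \<in> {0..T}"
    have "norm (g t (radial_proj \<rho> X) - g t (radial_proj \<rho> Y))
        \<le> (2 * b + 2 * s * \<rho>) * norm (radial_proj \<rho> X - radial_proj \<rho> Y)"
      unfolding g_def using t bnd norm_radial_proj(1)[OF \<rho>] by (intro riccati_lipschitz) auto
    also have "\<dots> \<le> (2 * b + 2 * s * \<rho>) * (2 * norm (X - Y))"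
      using nn \<rho> by (intro mult_left_mono radial_proj_lipschitz) auto
    finally show "norm (g t (radial_proj \<rho> X) - g t (radial_proj \<rho> Y)) \<le> (2 * b + 2 * s * \<rho>) * 2 * norm (X - Y)"
      by (simp only: mult.assoc)
  qed
  then obtain X where X0: "X 0 = 0"
    and X: "\<And>t. t \<in> {0..T} \<Longrightarrow> (X has_vector_derivative g t (radial_proj \<rho> (X t))) (at t within {0..T})"
    by blast
  \<comment> \<open>The retraction does not increase norms, so the truncated equation obeys the same
    growth bound as the original one. Its solution stays inside the ball, where truncation is the
    identity.\<close>
  have "norm (X t) \<le> \<rho>" if t: "t \<in> {0..T}" for t
  proof -
    have "norm (X t) \<le> sqrt (c0 / c1) * tan (T * sqrt (c0 * c1))"
    proof (rule quadratic_growth_bound[OF X _ X0 c01 _ t])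
      fix t assume t: "t \<in> {0..T}"
      have "norm (g t (radial_proj \<rho> (X t))) \<le> (c + b) + (s + b) * (norm (radial_proj \<rho> (X t)))\<^sup>2"
        unfolding g_def using t bnd by (intro riccati_growth) auto
      also have "\<dots> \<le> c0 + c1 * (norm (X t))\<^sup>2"
        unfolding c0_def c1_def using e nn norm_radial_proj(2)[OF \<rho>, of "X t"]
        by (intro add_mono[of "c + b"] mult_mono power_mono) auto
      finally show "norm (g t (radial_proj \<rho> (X t))) \<le> c0 + c1 * (norm (X t))\<^sup>2" .
    qed (use e in \<open>auto simp: c0_def c1_def\<close>)
    then show ?thesis by (simp add: \<rho>_def)
  qed
  then have "radial_proj \<rho> (X t) = X t" if "t \<in> {0..T}" for t
    using that by (intro radial_proj_id \<rho>) auto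
  then show ?thesis using X X0 unfolding g_def by (intro exI[of _ X]) auto
qed

lemma riccati_exists_terminal:
  fixes A A' S C :: "real \<Rightarrow> 'e::banach \<Rightarrow>\<^sub>L 'e"
  assumes T: "0 \<le> T"
    and cont: "continuous_on {0..T} A" "continuous_on {0..T} A'" "continuous_on {0..T} S" "continuous_on {0..T} C"
    and bnd: "\<And>t. t \<in> {0..T} \<Longrightarrow> norm (A t) \<le> b" "\<And>t. t \<in> {0..T} \<Longrightarrow> norm (A' t) \<le> b"
      "\<And>t. t \<in> {0..T} \<Longrightarrow> norm (S t) \<le> s" "\<And>t. t \<in> {0..T} \<Longrightarrow> norm (C t) \<le> c"
    and small: "T * sqrt ((c + b) * (s + b)) < pi / 2"
  shows "\<exists>X. X T = 0 \<and> (\<forall>t\<in>{0..T}. (X has_vector_derivative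
    - (riccati_map (A t) (A' t) (S t) (C t) (X t))) (at t within {0..T}))"
proof -
  have refl: "continuous_on {0..T} (\<lambda>s. g (T - s))" if "continuous_on {0..T} g"
    for g :: "real \<Rightarrow> 'e \<Rightarrow>\<^sub>L 'e"
    by (intro continuous_on_compose2[OF that] continuous_intros) auto
  obtain Y where Y0: "Y 0 = 0" and Y: "\<And>t. t \<in> {0..T} \<Longrightarrow> (Y has_vector_derivative
    riccati_map (A (T - t)) (A' (T - t)) (S (T - t)) (C (T - t)) (Y t)) (at t within {0..T})"
    using riccati_exists_initial[OF T refl[OF cont(1)] refl[OF cont(2)] refl[OF cont(3)] refl[OF cont(4)],
        of b s c] bnd small by auto
  define X where "X t = Y (T - t)" for t
  have "(X has_vector_derivative - (riccati_map (A t) (A' t) (S t) (C t) (X t))) (at t within {0..T})"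
    if "t \<in> {0..T}" for t
    using has_vector_derivative_reflect[of Y _ T t, OF Y] that by (simp add: X_def[abs_def])
  then show ?thesis using Y0 by (intro exI[of _ X]) (auto simp: X_def)
qed

text \<open>Two solutions are continuous, hence bounded on the interval, and on a common ball the
  Riccati map is Lipschitz.\<close>

lemma riccati_unique_terminal:
  fixes A A' S C X Y :: "real \<Rightarrow> 'e::banach \<Rightarrow>\<^sub>L 'e"
  assumes cont: "continuous_on {0..T} A" "continuous_on {0..T} A'" "continuous_on {0..T} S"
    and X: "\<And>t. t \<in> {0..T} \<Longrightarrow> (X has_vector_derivative
      - (riccati_map (A t) (A' t) (S t) (C t) (X t))) (at t within {0..T})"
    and Y: "\<And>t. t \<in> {0..T} \<Longrightarrow> (Y has_vector_derivative
      - (riccati_map (A t) (A' t) (S t) (C t) (Y t))) (at t within {0..T})"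
    and "X T = Y T" and t: "t \<in> {0..T}"
  shows "X t = Y t"
proof -
  obtain b1 where b1: "\<And>t. t \<in> {0..T} \<Longrightarrow> norm (A t) \<le> b1" using continuous_on_bounded_norm[OF cont(1)] by blast
  obtain b2 where b2: "\<And>t. t \<in> {0..T} \<Longrightarrow> norm (A' t) \<le> b2" using continuous_on_bounded_norm[OF cont(2)] by blast
  obtain s where s: "\<And>t. t \<in> {0..T} \<Longrightarrow> norm (S t) \<le> s" using continuous_on_bounded_norm[OF cont(3)] by blast
  obtain r1 where r1: "\<And>t. t \<in> {0..T} \<Longrightarrow> norm (X t) \<le> r1"
    using continuous_on_bounded_norm[OF derivative_imp_continuous[OF X]] by blast
  obtain r2 where r2: "\<And>t. t \<in> {0..T} \<Longrightarrow> norm (Y t) \<le> r2"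
    using continuous_on_bounded_norm[OF derivative_imp_continuous[OF Y]] by blast
  show ?thesis
  proof (rule ode_unique_terminal[OF X Y _ \<open>X T = Y T\<close> t])
    fix t assume t: "t \<in> {0..T}"
    have "norm ((riccati_map (A t) (A' t) (S t) (C t) (X t)) - (riccati_map (A t) (A' t) (S t) (C t) (Y t)))
      \<le> (2 * max b1 b2 + 2 * s * max r1 r2) * norm (X t - Y t)"
      using b1[OF t] b2[OF t] s[OF t] r1[OF t] r2[OF t] by (intro riccati_lipschitz) auto
    then show "norm (- (riccati_map (A t) (A' t) (S t) (C t) (X t))
        - - (riccati_map (A t) (A' t) (S t) (C t) (Y t)))
      \<le> (2 * max b1 b2 + 2 * s * max r1 r2) * norm (X t - Y t)"
      by (simp add: norm_minus_commute)
  qed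
qed

section \<open>Square integrable random vectors\<close>

definition sq_integrable :: "'w measure \<Rightarrow> ('w \<Rightarrow> 'b::euclidean_space) \<Rightarrow> bool" where
  "sq_integrable M X \<longleftrightarrow> X \<in> borel_measurable M \<and> integrable M (\<lambda>\<omega>. (norm (X \<omega>))\<^sup>2)"

lemma sq_integrable_bound:
  assumes "X \<in> borel_measurable M" "integrable M f" "\<And>\<omega>. \<omega> \<in> space M \<Longrightarrow> (norm (X \<omega>))\<^sup>2 \<le> f \<omega>"
  shows "sq_integrable M X"
  unfolding sq_integrable_def
proof (intro conjI assms)
  show "integrable M (\<lambda>\<omega>. (norm (X \<omega>))\<^sup>2)"
    by (rule Bochner_Integration.integrable_bound[OF assms(2)])
      (use assms in \<open>auto intro!: borel_measurable_power borel_measurable_norm intro: order_trans[OF _ abs_ge_self]\<close>)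
qed

lemma norm_le_one_plus_square: "norm x \<le> 1 + (norm x)\<^sup>2"
proof -
  have "0 \<le> (norm x - 1)\<^sup>2" by simp
  then have "2 * norm x \<le> 1 + (norm x)\<^sup>2" by (simp add: power2_eq_square algebra_simps)
  then show ?thesis by (smt (verit) norm_ge_zero)
qed

lemma norm_add_square_le:
  fixes x y :: "'a::real_normed_vector" shows "(norm (x + y))\<^sup>2 \<le> 2 * (norm x)\<^sup>2 + 2 * (norm y)\<^sup>2"
proof -
  have "(norm (x + y))\<^sup>2 \<le> (norm x + norm y)\<^sup>2" by (intro power_mono norm_triangle_ineq) auto
  also have "\<dots> \<le> 2 * (norm x)\<^sup>2 + 2 * (norm y)\<^sup>2"
    using sum_squares_bound[of "norm x" "norm y"] by (simp add: power2_eq_square algebra_simps)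
  finally show ?thesis .
qed

lemma (in prob_space) sq_integrable_imp_integrable:
  assumes "sq_integrable M X" shows "integrable M X"
  by (rule Bochner_Integration.integrable_bound[of M "\<lambda>\<omega>. 1 + (norm (X \<omega>))\<^sup>2"])
    (use assms norm_le_one_plus_square in \<open>auto simp: sq_integrable_def intro: order_trans[OF _ abs_ge_self]\<close>)

lemma sq_integrable_add:
  assumes "sq_integrable M X" "sq_integrable M Y" shows "sq_integrable M (\<lambda>\<omega>. X \<omega> + Y \<omega>)"
  by (rule sq_integrable_bound[of _ _ "\<lambda>\<omega>. 2 * (norm (X \<omega>))\<^sup>2 + 2 * (norm (Y \<omega>))\<^sup>2"])
    (use assms norm_add_square_le in \<open>auto simp: sq_integrable_def\<close>)

lemma sq_integrable_linear:
  assumes "sq_integrable M X" "bounded_linear f" shows "sq_integrable M (\<lambda>\<omega>. f (X \<omega>))"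
proof -
  obtain K where K: "\<And>x. norm (f x) \<le> norm x * K" "0 \<le> K"
    using bounded_linear.nonneg_bounded[OF assms(2)] by blast
  have "(norm (f (X \<omega>)))\<^sup>2 \<le> K\<^sup>2 * (norm (X \<omega>))\<^sup>2" for \<omega>
    using power_mono[OF K(1), of "X \<omega>" 2] by (simp add: power_mult_distrib mult_ac)
  moreover have "f \<in> borel_measurable borel"
    by (intro borel_measurable_continuous_onI linear_continuous_on assms)
  ultimately show ?thesis
    using assms(1) by (intro sq_integrable_bound[of _ _ "\<lambda>\<omega>. K\<^sup>2 * (norm (X \<omega>))\<^sup>2"])
      (auto simp: sq_integrable_def)
qed

lemma (in prob_space) sq_integrable_const: "sq_integrable M (\<lambda>_. c)"
  by (simp add: sq_integrable_def)

lemma integral_vec_nth: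
  fixes X :: "'w \<Rightarrow> real^'n"
  assumes "integrable M X" shows "integrable M (\<lambda>\<omega>. X \<omega> $ i)" "(LINT \<omega>|M. X \<omega> $ i) = (LINT \<omega>|M. X \<omega>) $ i"
  using integrable_bounded_linear[OF bounded_linear_vec_nth assms]
    integral_bounded_linear[OF bounded_linear_vec_nth assms] by auto

lemma borel_measurable_nth: "(\<lambda>x :: real^'n. x $ i) \<in> borel_measurable borel"
  by (intro borel_measurable_continuous_onI continuous_intros)

lemma norm_vec_square: "(norm (x :: real^'n))\<^sup>2 = (\<Sum>i\<in>UNIV. (x $ i)\<^sup>2)"
  by (simp add: norm_vec_def L2_set_def sum_nonneg)

lemma integrable_mult_of_squares:
  fixes X Y :: "'w \<Rightarrow> real"
  assumes "X \<in> borel_measurable M" "Y \<in> borel_measurable M" "integrable M (\<lambda>\<omega>. (X \<omega>)\<^sup>2)" "integrable M (\<lambda>\<omega>. (Y \<omega>)\<^sup>2)"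
  shows "integrable M (\<lambda>\<omega>. X \<omega> * Y \<omega>)"
proof (rule Bochner_Integration.integrable_bound[of M "\<lambda>\<omega>. (X \<omega>)\<^sup>2 + (Y \<omega>)\<^sup>2"])
  have "\<bar>x * y\<bar> \<le> x\<^sup>2 + y\<^sup>2" for x y :: real
  proof -
    have "2 * (\<bar>x\<bar> * \<bar>y\<bar>) \<le> \<bar>x\<bar>\<^sup>2 + \<bar>y\<bar>\<^sup>2" using sum_squares_bound[of "\<bar>x\<bar>" "\<bar>y\<bar>"] by (simp add: mult_ac)
    moreover have "0 \<le> \<bar>x\<bar> * \<bar>y\<bar>" by simp
    ultimately show ?thesis unfolding abs_mult power2_abs by linarith
  qed
  then show "AE \<omega> in M. norm (X \<omega> * Y \<omega>) \<le> norm ((X \<omega>)\<^sup>2 + (Y \<omega>)\<^sup>2)" by simp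
qed (use assms in auto)

section \<open>Moments of Gaussian vectors\<close>

text \<open>\<open>gaussian_vector\<close> fixes only the characteristic function. That of
  \<open>v \<bullet> X\<close> is the one of an affine image of the standard normal law, Levy's
  uniqueness theorem identifies the two laws, and the moments are read off from the standard normal
  one.\<close>

lemma (in prob_space) gaussian_scalar_moments:
  fixes X :: "'a \<Rightarrow> real^'n"
  assumes g: "gaussian_vector M X \<mu> C" and nn: "0 \<le> v \<bullet> (C *v v)"
  shows "integrable M (\<lambda>\<omega>. (v \<bullet> X \<omega>)\<^sup>2)" "expectation (\<lambda>\<omega>. v \<bullet> X \<omega>) = v \<bullet> \<mu>"
    "expectation (\<lambda>\<omega>. (v \<bullet> X \<omega>)\<^sup>2) = (v \<bullet> \<mu>)\<^sup>2 + v \<bullet> (C *v v)"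
proof -
  have [measurable]: "X \<in> borel_measurable M" using g by (simp add: gaussian_vector_def)
  define m \<sigma> where "m = v \<bullet> \<mu>" and "\<sigma> = sqrt (v \<bullet> (C *v v))"
  define D where "D = distr M borel (\<lambda>\<omega>. v \<bullet> X \<omega>)"
  \<comment> \<open>An affine image instead of a normal density: the case
    \<open>\<sigma> = 0\<close> of a degenerate covariance is included.\<close>
  define N where "N = distr std_normal_distribution borel (\<lambda>x. m + \<sigma> * x)"
  interpret N0: real_distribution std_normal_distribution by (rule real_dist_normal_dist)
  have "real_distribution D" unfolding D_def by (intro real_distribution_distr) measurable
  moreover have "real_distribution N"
    unfolding N_def by (intro N0.real_distribution_distr) auto
  moreover have "char D = char N"
  proof
    fix s
    have "char D s = (CLINT \<omega>|M. iexp ((s *\<^sub>R v) \<bullet> X \<omega>))"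
      unfolding char_def D_def by (subst integral_distr) (auto simp: mult_ac)
    also have "\<dots> = exp (\<i> * complex_of_real ((s *\<^sub>R v) \<bullet> \<mu>) - complex_of_real ((s *\<^sub>R v) \<bullet> (C *v (s *\<^sub>R v)) / 2))"
      using g unfolding gaussian_vector_def by blast
    also have "(s *\<^sub>R v) \<bullet> (C *v (s *\<^sub>R v)) = (s * \<sigma>)\<^sup>2"
      using nn by (simp add: \<sigma>_def power_mult_distrib matrix_vector_mult_scaleR power2_eq_square)
    also have "exp (\<i> * complex_of_real ((s *\<^sub>R v) \<bullet> \<mu>) - complex_of_real ((s * \<sigma>)\<^sup>2 / 2))
        = iexp (s * m) * complex_of_real (exp (- ((s * \<sigma>)\<^sup>2) / 2))"
      unfolding m_def exp_of_real[symmetric] exp_add[symmetric] by (simp add: exp_add[symmetric])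
    also have "complex_of_real (exp (- ((s * \<sigma>)\<^sup>2) / 2)) = char std_normal_distribution (s * \<sigma>)"
      by (simp add: char_std_normal_distribution)
    also have "iexp (s * m) * char std_normal_distribution (s * \<sigma>)
        = (CLINT x|std_normal_distribution. iexp (s * m) * iexp ((s * \<sigma>) * x))"
      unfolding char_def by simp
    also have "\<dots> = (CLINT x|std_normal_distribution. iexp (s * (m + \<sigma> * x)))"
      by (intro Bochner_Integration.integral_cong) (auto simp: exp_add[symmetric] algebra_simps)
    also have "\<dots> = char N s"
      unfolding char_def N_def by (subst integral_distr) auto
    finally show "char D s = char N s" .
  qed
  ultimately have DN: "D = N" by (rule Levy_uniqueness)
  have h0: "has_bochner_integral std_normal_distribution (\<lambda>x. 1 :: real) 1"
    using N0.prob_space by (simp add: has_bochner_integral_iff)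
  have h1: "has_bochner_integral std_normal_distribution (\<lambda>x. x) 0"
    using integrable_std_normal_distribution_moment[of 1] integral_std_normal_distribution_moment_odd[of 1]
    by (simp only: has_bochner_integral_iff power_one_right odd_one simp_thms)
  have h2: "has_bochner_integral std_normal_distribution (\<lambda>x. x\<^sup>2) 1"
    using std_normal_distribution_even_moments[of 1] by (simp add: has_bochner_integral_iff)
  have H1: "has_bochner_integral std_normal_distribution (\<lambda>x. m + \<sigma> * x) m"
    using has_bochner_integral_add[OF has_bochner_integral_mult_right[OF h0, of m] has_bochner_integral_mult_right[OF h1, of \<sigma>]]
    by simp
  have H2: "has_bochner_integral std_normal_distribution (\<lambda>x. (m + \<sigma> * x)\<^sup>2) (m\<^sup>2 + \<sigma>\<^sup>2)"
    using has_bochner_integral_add[OF has_bochner_integral_add[OF has_bochner_integral_mult_right[OF h0, of "m\<^sup>2"]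
          has_bochner_integral_mult_right[OF h1, of "2 * m * \<sigma>"]] has_bochner_integral_mult_right[OF h2, of "\<sigma>\<^sup>2"]]
    by (simp add: power2_eq_square algebra_simps)
  have transfer: "has_bochner_integral M (\<lambda>\<omega>. f (v \<bullet> X \<omega>)) c"
    if f[measurable]: "f \<in> borel_measurable borel"
      and h: "has_bochner_integral std_normal_distribution (\<lambda>x. f (m + \<sigma> * x)) c" for f :: "real \<Rightarrow> real" and c
  proof -
    have "has_bochner_integral N f c"
      unfolding N_def by (rule has_bochner_integral_distr[OF f _ h]) simp
    then have "has_bochner_integral D f c" by (simp only: DN)
    moreover have vX: "(\<lambda>\<omega>. v \<bullet> X \<omega>) \<in> borel_measurable M" by measurable
    ultimately show ?thesis
      unfolding D_def has_bochner_integral_iff using integrable_distr_eq[OF vX f] integral_distr[OF vX f] by simp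
  qed
  show "integrable M (\<lambda>\<omega>. (v \<bullet> X \<omega>)\<^sup>2)" "expectation (\<lambda>\<omega>. v \<bullet> X \<omega>) = v \<bullet> \<mu>"
    "expectation (\<lambda>\<omega>. (v \<bullet> X \<omega>)\<^sup>2) = (v \<bullet> \<mu>)\<^sup>2 + v \<bullet> (C *v v)"
    using transfer[of "\<lambda>x. x", OF _ H1] transfer[of "\<lambda>x. x\<^sup>2", OF _ H2] nn
    by (simp_all add: has_bochner_integral_iff m_def \<sigma>_def)
qed

lemma (in prob_space) gaussian_vector_moments:
  fixes X :: "'a \<Rightarrow> real^'n"
  assumes g: "gaussian_vector M X \<mu> C" and nn: "\<And>v. 0 \<le> v \<bullet> (C *v v)"
  shows "sq_integrable M X" "expectation X = \<mu>"
    "expectation (\<lambda>\<omega>. (norm (X \<omega>))\<^sup>2) = (norm \<mu>)\<^sup>2 + (\<Sum>i\<in>UNIV. axis i 1 \<bullet> (C *v axis i 1))"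
proof -
  have X[measurable]: "X \<in> borel_measurable M" using g by (simp add: gaussian_vector_def)
  note m = gaussian_scalar_moments[OF g nn]
  have ax: "axis i 1 \<bullet> x = x $ i" for x :: "real^'n" and i by (simp add: inner_axis')
  note m' = m[of "axis _ 1", unfolded ax]
  show sq: "sq_integrable M X"
    unfolding sq_integrable_def norm_vec_square by (auto intro: m')
  from integral_vec_nth(2)[OF sq_integrable_imp_integrable[OF sq]]
  show "expectation X = \<mu>" by (simp add: vec_eq_iff m' flip: integral_vec_nth(2))
  show "expectation (\<lambda>\<omega>. (norm (X \<omega>))\<^sup>2) = (norm \<mu>)\<^sup>2 + (\<Sum>i\<in>UNIV. axis i 1 \<bullet> (C *v axis i 1))"
    unfolding norm_vec_square using m' by (simp add: sum.distrib ax)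
qed

lemma (in prob_space) brownian_increment:
  fixes W :: "real \<Rightarrow> 'a \<Rightarrow> real^'n" and s t :: real
  assumes W: "brownian_motion M W" and st: "0 \<le> s" "s \<le> t"
  shows "sq_integrable M (\<lambda>\<omega>. W t \<omega> - W s \<omega>)" "expectation (\<lambda>\<omega>. W t \<omega> - W s \<omega>) = 0"
    "expectation (\<lambda>\<omega>. (norm (W t \<omega> - W s \<omega>))\<^sup>2) = CARD('n) * (t - s)"
proof -
  have g: "gaussian_vector M (\<lambda>\<omega>. W t \<omega> - W s \<omega>) 0 ((t - s) *\<^sub>R mat 1)"
    using W st by (auto simp: brownian_motion_def)
  have eq: "v \<bullet> (((t - s) *\<^sub>R mat 1) *v v) = (t - s) * (v \<bullet> v)" for v :: "real^'n"
    by (simp flip: scaleR_matrix_vector_assoc)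
  have nn: "0 \<le> v \<bullet> (((t - s) *\<^sub>R mat 1) *v v)" for v :: "real^'n" unfolding eq using st by simp
  show "sq_integrable M (\<lambda>\<omega>. W t \<omega> - W s \<omega>)" "expectation (\<lambda>\<omega>. W t \<omega> - W s \<omega>) = 0"
    "expectation (\<lambda>\<omega>. (norm (W t \<omega> - W s \<omega>))\<^sup>2) = CARD('n) * (t - s)"
    using gaussian_vector_moments[OF g nn] by (simp_all add: eq inner_axis_axis)
qed

section \<open>Filtrations\<close>

lemma space_process_sigma [simp]: "space (process_sigma M I Z) = space M"
  unfolding process_sigma_def by (intro space_measure_of) auto

lemma sets_process_sigma:
  "sets (process_sigma M I Z) = sigma_sets (space M) (\<Union>s\<in>I. {Z s -` E \<inter> space M | E. E \<in> sets borel})"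
  unfolding process_sigma_def by (intro sets_measure_of) auto

lemma process_sigma_measurable: "s \<in> I \<Longrightarrow> Z s \<in> borel_measurable (process_sigma M I Z)"
  by (rule measurableI) (auto simp: sets_process_sigma)

lemma subalgebra_process_sigma:
  assumes "\<And>s. s \<in> I \<Longrightarrow> Z s \<in> borel_measurable M"
  shows "subalgebra M (process_sigma M I Z)"
  unfolding subalgebra_def sets_process_sigma
  by (auto intro!: sets.sigma_sets_subset measurable_sets[OF assms])

lemma process_sigma_mono: "I \<subseteq> J \<Longrightarrow> sets (process_sigma M I Z) \<subseteq> sets (process_sigma M J Z)"
  unfolding sets_process_sigma by (intro sigma_sets_mono') auto

lemma (in prob_space) expectation_mult_indep_set:
  fixes X Y :: "'a \<Rightarrow> real"
  assumes indep: "indep_set (sets F) (sets G)" and sp: "space F = space M" "space G = space M"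
    and X: "X \<in> borel_measurable F" "integrable M X" and Y: "Y \<in> borel_measurable G" "integrable M Y"
  shows "expectation (\<lambda>\<omega>. X \<omega> * Y \<omega>) = expectation X * expectation Y"
proof -
  have sub: "sigma_sets (space M) {X -` A \<inter> space M | A. A \<in> sets borel} \<subseteq> sets F"
    if "X \<in> borel_measurable F" "space F = space M" for X :: "'a \<Rightarrow> real" and F
    using sets.sigma_sets_subset[of "{X -` A \<inter> space M | A. A \<in> sets borel}" F] measurable_sets[OF that(1)] that(2)
    by auto
  have "indep_var borel X borel Y"
    unfolding indep_var_eq
  proof (intro conjI)
    show "indep_set (sigma_sets (space M) {X -` A \<inter> space M |A. A \<in> sets borel})
      (sigma_sets (space M) {Y -` A \<inter> space M |A. A \<in> sets borel})"
      using indep sub[OF X(1) sp(1)] sub[OF Y(1) sp(2)] unfolding indep_set_def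
      by (rule_tac indep_sets_mono_sets) (auto split: bool.split)
  qed (use X Y in auto)
  then show ?thesis by (rule indep_var_lebesgue_integral) (use X Y in auto)
qed

lemma mean_zero_linear:
  assumes "integrable M X" "integral\<^sup>L M X = 0" "bounded_linear f" shows "(LINT \<omega>|M. f (X \<omega>)) = 0"
  using integral_bounded_linear[OF assms(3,1)] assms(2,3) by (simp add: linear_simps)

text \<open>The Ito isometry for simple integrands, as an inequality: each new increment is centred
  and independent of the past, so the cross terms vanish and squared norms add up. Measurability
  with respect to the past belongs to the claim because the induction step draws the independence
  from it.\<close>

lemma (in prob_space) brownian_sum_moments:
  fixes W :: "real \<Rightarrow> 'a \<Rightarrow> real^'n" and g :: "nat \<Rightarrow> real^'n^'m" and t :: "nat \<Rightarrow> real"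
  assumes W: "brownian_motion M W" and t: "mono t" "0 \<le> t 0"
    and g: "\<And>k x. norm (g k *v x) \<le> C * norm x" and C: "0 \<le> C"
  defines "S \<equiv> \<lambda>m \<omega>. \<Sum>k<m. g k *v (W (t (Suc k)) \<omega> - W (t k) \<omega>)"
  shows "sq_integrable M (S m) \<and> expectation (S m) = 0 \<and>
    expectation (\<lambda>\<omega>. (norm (S m \<omega>))\<^sup>2) \<le> C\<^sup>2 * CARD('n) * (t m - t 0) \<and>
    S m \<in> borel_measurable (process_sigma M {0..t m} W)"
proof (induction m)
  case 0
  then show ?case by (simp add: S_def sq_integrable_def)
next
  case (Suc m)
  define D Y where "D = (\<lambda>\<omega>. W (t (Suc m)) \<omega> - W (t m) \<omega>)" and "Y = (\<lambda>\<omega>. g m *v D \<omega>)"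
  have tm: "0 \<le> t m" "t m \<le> t (Suc m)" using t by (auto intro: order_trans[OF _ monoD[OF t(1)]] monoD)
  have D: "sq_integrable M D" "expectation D = 0" "expectation (\<lambda>\<omega>. (norm (D \<omega>))\<^sup>2) = CARD('n) * (t (Suc m) - t m)"
    unfolding D_def by (intro brownian_increment[OF W tm])+
  have W_meas: "W s \<in> borel_measurable M" if "0 \<le> s" for s
    using W that by (auto simp: brownian_motion_def continuous_process_def)
  have bl: "bounded_linear ((*v) (g m))" by simp
  have Y: "sq_integrable M Y" unfolding Y_def by (rule sq_integrable_linear[OF D(1) bl])
  have EY: "expectation Y = 0"
    unfolding Y_def by (rule mean_zero_linear[OF sq_integrable_imp_integrable[OF D(1)] D(2) bl])
  have "expectation (\<lambda>\<omega>. (norm (Y \<omega>))\<^sup>2) \<le> expectation (\<lambda>\<omega>. C\<^sup>2 * (norm (D \<omega>))\<^sup>2)"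
  proof (rule integral_mono)
    show "(norm (Y \<omega>))\<^sup>2 \<le> C\<^sup>2 * (norm (D \<omega>))\<^sup>2" for \<omega>
      using power_mono[OF g[of m "D \<omega>"], of 2] by (simp add: Y_def power_mult_distrib)
  qed (use Y D in \<open>auto simp: sq_integrable_def\<close>)
  then have EY2: "expectation (\<lambda>\<omega>. (norm (Y \<omega>))\<^sup>2) \<le> C\<^sup>2 * CARD('n) * (t (Suc m) - t m)"
    using D by (simp add: sq_integrable_def)
  have S: "sq_integrable M (S m)" "expectation (S m) = 0"
    "S m \<in> borel_measurable (process_sigma M {0..t m} W)" using Suc by auto
  have Smeas: "(\<lambda>\<omega>. S m \<omega> $ i) \<in> borel_measurable (process_sigma M {0..t m} W)" for i
    using measurable_compose[OF S(3) borel_measurable_nth] by simp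
  have cross: "expectation (\<lambda>\<omega>. S m \<omega> $ i * Y \<omega> $ i) = 0" for i
  proof -
    have indep: "indep_set (sets (process_sigma M {0..t m} W)) (sets (vimage_algebra (space M) D borel))"
      using W tm by (simp add: brownian_motion_def D_def)
    have D_meas: "D \<in> borel_measurable (vimage_algebra (space M) D borel)"
      by (rule measurable_vimage_algebra1) auto
    have "(\<lambda>\<omega>. Y \<omega> $ i) \<in> borel_measurable (vimage_algebra (space M) D borel)"
      unfolding Y_def
      by (rule measurable_compose[OF D_meas])
        (auto intro!: borel_measurable_continuous_onI continuous_intros linear_continuous_on[OF bl])
    then have "expectation (\<lambda>\<omega>. S m \<omega> $ i * Y \<omega> $ i) = expectation (\<lambda>\<omega>. S m \<omega> $ i) * expectation (\<lambda>\<omega>. Y \<omega> $ i)"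
      using S Y by (intro expectation_mult_indep_set[OF indep _ _ Smeas])
        (auto intro: integral_vec_nth(1)[OF sq_integrable_imp_integrable])
    then show ?thesis
      using EY integral_vec_nth(2)[OF sq_integrable_imp_integrable[OF Y], of i] by simp
  qed
  have comp: "integrable M (\<lambda>\<omega>. (X \<omega> $ i)\<^sup>2)" "(\<lambda>\<omega>. X \<omega> $ i) \<in> borel_measurable M"
    if "sq_integrable M X" for X :: "'a \<Rightarrow> real^'m" and i
    using sq_integrable_linear[OF that bounded_linear_vec_nth, of i] by (auto simp: sq_integrable_def)
  have int_prod: "integrable M (\<lambda>\<omega>. S m \<omega> $ i * Y \<omega> $ i)" for i
    by (intro integrable_mult_of_squares comp S Y)
  have "(norm (S m \<omega> + Y \<omega>))\<^sup>2 = (norm (S m \<omega>))\<^sup>2 + (norm (Y \<omega>))\<^sup>2 + 2 * (\<Sum>i\<in>UNIV. S m \<omega> $ i * Y \<omega> $ i)" for \<omega>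
    unfolding power2_norm_eq_inner by (simp add: inner_simps inner_commute) (simp add: inner_vec_def mult.commute)
  then have "expectation (\<lambda>\<omega>. (norm (S m \<omega> + Y \<omega>))\<^sup>2)
      = expectation (\<lambda>\<omega>. (norm (S m \<omega>))\<^sup>2) + expectation (\<lambda>\<omega>. (norm (Y \<omega>))\<^sup>2)"
    using S Y int_prod by (simp add: sq_integrable_def cross)
  also have "\<dots> \<le> C\<^sup>2 * CARD('n) * (t m - t 0) + C\<^sup>2 * CARD('n) * (t (Suc m) - t m)"
    using Suc EY2 by (intro add_mono) auto
  also have "\<dots> = C\<^sup>2 * CARD('n) * (t (Suc m) - t 0)" by (simp add: algebra_simps)
  finally have second: "expectation (\<lambda>\<omega>. (norm (S m \<omega> + Y \<omega>))\<^sup>2) \<le> \<dots>" .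
  have S_Suc: "S (Suc m) = (\<lambda>\<omega>. S m \<omega> + Y \<omega>)" by (auto simp: S_def Y_def D_def)
  have "S m \<in> borel_measurable (process_sigma M {0..t (Suc m)} W)"
  proof (rule measurable_mono[THEN subsetD, OF _ _ _ _ S(3)])
    show "sets (process_sigma M {0..t m} W) \<subseteq> sets (process_sigma M {0..t (Suc m)} W)"
      using tm by (intro process_sigma_mono) auto
  qed auto
  moreover have "Y \<in> borel_measurable (process_sigma M {0..t (Suc m)} W)"
    unfolding Y_def D_def using tm
    by (intro measurable_compose[OF borel_measurable_diff[OF process_sigma_measurable process_sigma_measurable]
          borel_measurable_continuous_onI[OF linear_continuous_on[OF bl]]]) auto
  ultimately have meas: "S (Suc m) \<in> borel_measurable (process_sigma M {0..t (Suc m)} W)"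
    unfolding S_Suc by (rule borel_measurable_add)
  have "expectation (S (Suc m)) = 0"
    unfolding S_Suc using S Y EY by (simp add: sq_integrable_imp_integrable)
  then show ?case
    using second meas sq_integrable_add[OF S(1) Y] unfolding S_Suc by blast
qed

lemma grid_point:
  assumes "0 \<le> t" "k \<le> n" shows "t * real k / real n \<in> {0..t}"
proof (cases "n = 0")
  case False
  then have "t * (real k / real n) \<le> t * 1" using assms by (intro mult_left_mono) auto
  then show ?thesis using assms by simp
qed (use assms in auto)

lemma (in prob_space) stoch_sum_moments:
  fixes W :: "real \<Rightarrow> 'a \<Rightarrow> real^'n" and g :: "real \<Rightarrow> real^'n^'m"
  assumes W: "brownian_motion M W" and t: "0 \<le> t"
    and g: "\<And>s x. s \<in> {0..t} \<Longrightarrow> norm (g s *v x) \<le> C * norm x" and C: "0 \<le> C"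
  shows "sq_integrable M (stoch_sum g W t n)" "expectation (stoch_sum g W t n) = 0"
    "expectation (\<lambda>\<omega>. (norm (stoch_sum g W t n \<omega>))\<^sup>2) \<le> C\<^sup>2 * CARD('n) * t"
proof -
  \<comment> \<open>Beyond index \<open>n\<close> the grid leaves \<open>{0..t}\<close>, the
    interval on which \<open>g\<close> is bounded. Continuing by 0 gives a family bounded at every
    index.\<close>
  define g' where "g' k = (if k < n then g (t * real k / real n) else 0)" for k :: nat
  define S where "S \<omega> = (\<Sum>k<n. g' k *v (W (t * real (Suc k) / real n) \<omega> - W (t * real k / real n) \<omega>))" for \<omega>
  have eq: "stoch_sum g W t n = S" by (auto simp: stoch_sum_def g'_def S_def)
  have g': "norm (g' k *v x) \<le> C * norm x" for k x
  proof (cases "k < n")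
    case True
    then show ?thesis using g[OF grid_point[OF t]] by (simp add: g'_def)
  qed (use C in \<open>simp add: g'_def\<close>)
  have mono: "mono (\<lambda>k. t * real k / real n)"
    using t by (intro monoI) (auto intro!: divide_right_mono mult_left_mono)
  have "sq_integrable M S \<and> expectation S = 0 \<and>
    expectation (\<lambda>\<omega>. (norm (S \<omega>))\<^sup>2) \<le> C\<^sup>2 * CARD('n) * (t * real n / real n - t * real 0 / real n) \<and>
    S \<in> borel_measurable (process_sigma M {0..t * real n / real n} W)"
    unfolding S_def[abs_def]
    by (rule brownian_sum_moments[OF W mono, where g = g']) (simp, rule g', rule C)
  then have S: "sq_integrable M S" "expectation S = 0"
    "expectation (\<lambda>\<omega>. (norm (S \<omega>))\<^sup>2) \<le> C\<^sup>2 * CARD('n) * (t * real n / real n)"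
    by simp_all
  \<comment> \<open>For \<open>n = 0\<close> the quotient is 0 by convention, so this is an
    inequality rather than an equality.\<close>
  have "C\<^sup>2 * CARD('n) * (t * real n / real n) \<le> C\<^sup>2 * CARD('n) * t"
    using t by (intro mult_left_mono) auto
  with S show "sq_integrable M (stoch_sum g W t n)" "expectation (stoch_sum g W t n) = 0"
    "expectation (\<lambda>\<omega>. (norm (stoch_sum g W t n \<omega>))\<^sup>2) \<le> C\<^sup>2 * CARD('n) * t"
    unfolding eq by linarith+
qed

section \<open>Limits in probability\<close>

text \<open>Same form as in \<open>has_stoch_integral\<close>, with measurability of the whole
  sequence added, so that a stochastic integral is literally such a limit of its sums.\<close>

definition conv_prob :: "'w measure \<Rightarrow> (nat \<Rightarrow> 'w \<Rightarrow> 'b::euclidean_space) \<Rightarrow> ('w \<Rightarrow> 'b) \<Rightarrow> bool" where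
  "conv_prob M X L \<longleftrightarrow> L \<in> borel_measurable M \<and> (\<forall>n. X n \<in> borel_measurable M) \<and>
     (\<forall>\<epsilon>>0. (\<lambda>n. measure M {\<omega> \<in> space M. \<epsilon> < dist (X n \<omega>) (L \<omega>)}) \<longlonglongrightarrow> 0)"

lemma conv_prob_lim:
  "conv_prob M X L \<Longrightarrow> 0 < \<epsilon> \<Longrightarrow> (\<lambda>n. measure M {\<omega> \<in> space M. \<epsilon> < dist (X n \<omega>) (L \<omega>)}) \<longlonglongrightarrow> 0"
  by (simp add: conv_prob_def)

lemma (in prob_space) AE_tendsto_conv_prob:
  assumes X[measurable]: "\<And>n. X n \<in> borel_measurable M" "L \<in> borel_measurable M"
    and lim: "AE \<omega> in M. (\<lambda>n. X n \<omega>) \<longlonglongrightarrow> L \<omega>"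
  shows "conv_prob M X L"
  unfolding conv_prob_def
proof (intro conjI allI impI X)
  fix \<epsilon> :: real assume \<epsilon>: "0 < \<epsilon>"
  define A where "A n = {\<omega> \<in> space M. \<epsilon> < dist (X n \<omega>) (L \<omega>)}" for n
  have [measurable]: "A n \<in> sets M" for n unfolding A_def by measurable
  have "(\<lambda>n. expectation (indicator (A n) :: 'a \<Rightarrow> real)) \<longlonglongrightarrow> expectation (\<lambda>_. 0 :: real)"
  proof (rule integral_dominated_convergence[where w = "\<lambda>_. 1"])
    show "AE \<omega> in M. (\<lambda>n. indicator (A n) \<omega> :: real) \<longlonglongrightarrow> 0"
      using lim
    proof eventually_elim
      case (elim \<omega>)
      then have "\<forall>\<^sub>F n in sequentially. dist (X n \<omega>) (L \<omega>) < \<epsilon>" using \<epsilon> by (rule tendstoD)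
      then have "\<forall>\<^sub>F n in sequentially. indicator (A n) \<omega> = (0 :: real)"
        by eventually_elim (auto simp: A_def indicator_def)
      then show ?case by (rule tendsto_eventually)
    qed
  qed (auto simp: indicator_def)
  then show "(\<lambda>n. prob {\<omega> \<in> space M. \<epsilon> < dist (X n \<omega>) (L \<omega>)}) \<longlonglongrightarrow> 0"
    by (simp add: A_def[symmetric])
qed

lemma (in prob_space) conv_prob_diff:
  assumes X: "conv_prob M X L" and Y: "conv_prob M Y K"
  shows "conv_prob M (\<lambda>n \<omega>. X n \<omega> - Y n \<omega>) (\<lambda>\<omega>. L \<omega> - K \<omega>)"
proof -
  have [measurable]: "X n \<in> borel_measurable M" "Y n \<in> borel_measurable M" "L \<in> borel_measurable M"
    "K \<in> borel_measurable M" for n using X Y by (auto simp: conv_prob_def)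
  show ?thesis
    unfolding conv_prob_def
  proof (intro conjI allI impI)
    fix \<epsilon> :: real assume \<epsilon>: "0 < \<epsilon>"
    let ?p = "\<lambda>n. prob {\<omega> \<in> space M. \<epsilon> / 2 < dist (X n \<omega>) (L \<omega>)} + prob {\<omega> \<in> space M. \<epsilon> / 2 < dist (Y n \<omega>) (K \<omega>)}"
    have le: "prob {\<omega> \<in> space M. \<epsilon> < dist (X n \<omega> - Y n \<omega>) (L \<omega> - K \<omega>)} \<le> ?p n" for n
    proof -
      have tri: "dist (X n \<omega> - Y n \<omega>) (L \<omega> - K \<omega>) \<le> dist (X n \<omega>) (L \<omega>) + dist (Y n \<omega>) (K \<omega>)" for \<omega>
        unfolding dist_norm by norm
      have "prob {\<omega> \<in> space M. \<epsilon> < dist (X n \<omega> - Y n \<omega>) (L \<omega> - K \<omega>)}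
          \<le> prob ({\<omega> \<in> space M. \<epsilon> / 2 < dist (X n \<omega>) (L \<omega>)} \<union> {\<omega> \<in> space M. \<epsilon> / 2 < dist (Y n \<omega>) (K \<omega>)})"
      proof (rule finite_measure_mono)
        show "{\<omega> \<in> space M. \<epsilon> < dist (X n \<omega> - Y n \<omega>) (L \<omega> - K \<omega>)}
          \<subseteq> {\<omega> \<in> space M. \<epsilon> / 2 < dist (X n \<omega>) (L \<omega>)} \<union> {\<omega> \<in> space M. \<epsilon> / 2 < dist (Y n \<omega>) (K \<omega>)}"
          using tri by (auto simp: not_less) (smt (verit, best) field_sum_of_halves)
      qed measurable
      also have "\<dots> \<le> ?p n" by (rule measure_Un_le) measurable
      finally show ?thesis .
    qed
    have "?p \<longlonglongrightarrow> 0 + 0"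
      using \<epsilon> by (intro tendsto_add conv_prob_lim[OF X] conv_prob_lim[OF Y]) auto
    then have "?p \<longlonglongrightarrow> 0" by simp
    then show "(\<lambda>n. prob {\<omega> \<in> space M. \<epsilon> < dist (X n \<omega> - Y n \<omega>) (L \<omega> - K \<omega>)}) \<longlonglongrightarrow> 0"
      by (rule tendsto_sandwich[OF _ _ tendsto_const, rotated 2])
        (rule always_eventually, simp, rule always_eventually, rule allI, rule le)
  qed auto
qed

lemma (in prob_space) conv_prob_zero_unique:
  assumes "conv_prob M (\<lambda>n \<omega>. 0) L" shows "AE \<omega> in M. L \<omega> = 0"
proof -
  have [measurable]: "L \<in> borel_measurable M" using assms by (auto simp: conv_prob_def)
  have "prob {\<omega> \<in> space M. 1 / real (Suc k) < norm (L \<omega>)} = 0" for k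
  proof -
    have "(\<lambda>n. prob {\<omega> \<in> space M. 1 / real (Suc k) < dist 0 (L \<omega>)}) \<longlonglongrightarrow> 0"
      using assms unfolding conv_prob_def by (auto dest!: spec[of _ "1 / real (Suc k)"])
    then show ?thesis by (simp add: LIMSEQ_const_iff)
  qed
  then have "AE \<omega> in M. \<not> 1 / real (Suc k) < norm (L \<omega>)" for k
    by (subst AE_iff_measurable[of "{\<omega> \<in> space M. 1 / real (Suc k) < norm (L \<omega>)}"])
      (auto simp: emeasure_eq_measure)
  then have "AE \<omega> in M. \<forall>k. \<not> 1 / real (Suc k) < norm (L \<omega>)" by (simp add: AE_all_countable)
  then show ?thesis
  proof eventually_elim
    case (elim \<omega>)
    show ?case
    proof (rule ccontr)
      assume "L \<omega> \<noteq> 0"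
      then obtain k where "inverse (real (Suc k)) < norm (L \<omega>)" using reals_Archimedean[of "norm (L \<omega>)"] by auto
      then show False using elim by (auto simp: inverse_eq_divide)
    qed
  qed
qed

lemma (in prob_space) conv_prob_unique:
  assumes "conv_prob M X L" "conv_prob M X K" shows "AE \<omega> in M. L \<omega> = K \<omega>"
  using conv_prob_zero_unique[of "\<lambda>\<omega>. L \<omega> - K \<omega>"] conv_prob_diff[OF assms] by simp

text \<open>The variables \<open>min 1 (dist ...)\<close> are bounded, so convergence in probability
  makes their expectations tend to 0, and convergence in L1 provides the subsequence.\<close>

lemma (in prob_space) conv_prob_AE_subseq:
  assumes X: "conv_prob M X L"
  shows "\<exists>r. strict_mono r \<and> (AE \<omega> in M. (\<lambda>n. X (r n) \<omega>) \<longlonglongrightarrow> L \<omega>)"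
proof -
  have [measurable]: "X n \<in> borel_measurable M" "L \<in> borel_measurable M" for n using X by (auto simp: conv_prob_def)
  define u where "u n \<omega> = min 1 (dist (X n \<omega>) (L \<omega>))" for n \<omega>
  have [measurable]: "u n \<in> borel_measurable M" for n unfolding u_def by measurable
  have u01: "0 \<le> u n \<omega>" "u n \<omega> \<le> 1" for n \<omega> by (auto simp: u_def)
  have int: "integrable M (u n)" for n
    by (rule integrable_const_bound[of _ 1]) (auto simp: u_def)
  have "(\<lambda>n. expectation (u n)) \<longlonglongrightarrow> 0"
  proof (rule LIMSEQ_I)
    fix e :: real assume e: "0 < e"
    define A where "A n = {\<omega> \<in> space M. e / 2 < dist (X n \<omega>) (L \<omega>)}" for n
    have A_meas[measurable]: "A n \<in> sets M" for n unfolding A_def by measurable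
    have A_int: "integrable M (indicator (A n) :: 'a \<Rightarrow> real)" for n
      by (rule integrable_real_indicator[OF A_meas]) (simp add: less_top[symmetric])
    have "(\<lambda>n. prob (A n)) \<longlonglongrightarrow> 0" using e unfolding A_def by (intro conv_prob_lim[OF X]) auto
    then have "\<forall>\<^sub>F n in sequentially. prob (A n) < e / 2" using e by (intro order_tendstoD) auto
    then obtain N where N: "\<And>n. N \<le> n \<Longrightarrow> prob (A n) < e / 2" by (auto simp: eventually_sequentially)
    have "norm (expectation (u n) - 0) < e" if "N \<le> n" for n
    proof -
      have "expectation (u n) \<le> expectation (\<lambda>\<omega>. e / 2 + indicator (A n) \<omega>)"
      proof (rule integral_mono[OF int])
        show "u n \<omega> \<le> e / 2 + indicator (A n) \<omega>" if "\<omega> \<in> space M" for \<omega>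
          using u01(2)[of n \<omega>] e that by (auto simp: u_def A_def indicator_def)
      qed (intro Bochner_Integration.integrable_add integrable_const A_int)
      also have "\<dots> = e / 2 + prob (A n)" by (subst Bochner_Integration.integral_add) (auto simp: prob_space A_int)
      also have "\<dots> < e" using N[OF that] by simp
      finally show ?thesis using u01 by (simp add: integral_nonneg_AE)
    qed
    then show "\<exists>N. \<forall>n\<ge>N. norm (expectation (u n) - 0) < e" by blast
  qed
  then have "(\<lambda>n. \<integral>\<omega>. norm (u n \<omega>) \<partial>M) \<longlonglongrightarrow> 0" using u01 by (simp add: abs_of_nonneg)
  from tendsto_L1_AE_subseq[OF int this] obtain r where r: "strict_mono r"
    and lim: "AE \<omega> in M. (\<lambda>n. u (r n) \<omega>) \<longlonglongrightarrow> 0" by blast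
  have "AE \<omega> in M. (\<lambda>n. X (r n) \<omega>) \<longlonglongrightarrow> L \<omega>"
    using lim
  proof eventually_elim
    case (elim \<omega>)
    show ?case
    proof (rule tendstoI)
      fix e :: real assume "0 < e"
      then have "\<forall>\<^sub>F n in sequentially. u (r n) \<omega> < min e 1" using elim by (intro order_tendstoD) auto
      then show "\<forall>\<^sub>F n in sequentially. dist (X (r n) \<omega>) (L \<omega>) < e"
        by eventually_elim (auto simp: u_def min_def split: if_splits)
    qed
  qed
  with r show ?thesis by blast
qed

text \<open>Fatou's lemma along an almost everywhere convergent subsequence.\<close>

lemma (in prob_space) conv_prob_second_moment:
  fixes L :: "'a \<Rightarrow> 'b::euclidean_space"
  assumes X: "conv_prob M X L" and sq: "\<And>n. sq_integrable M (X n)"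
    and B: "\<And>n. expectation (\<lambda>\<omega>. (norm (X n \<omega>))\<^sup>2) \<le> B"
  shows "sq_integrable M L" "expectation (\<lambda>\<omega>. (norm (L \<omega>))\<^sup>2) \<le> B"
proof -
  have [measurable]: "X n \<in> borel_measurable M" "L \<in> borel_measurable M" for n using X by (auto simp: conv_prob_def)
  have B0: "0 \<le> B" by (rule order_trans[OF _ B[of 0]]) simp
  obtain r where lim: "AE \<omega> in M. (\<lambda>n. X (r n) \<omega>) \<longlonglongrightarrow> L \<omega>" using conv_prob_AE_subseq[OF X] by blast
  have "(\<integral>\<^sup>+\<omega>. ennreal ((norm (L \<omega>))\<^sup>2) \<partial>M) = (\<integral>\<^sup>+\<omega>. liminf (\<lambda>n. ennreal ((norm (X (r n) \<omega>))\<^sup>2)) \<partial>M)"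
  proof (rule nn_integral_cong_AE)
    show "AE \<omega> in M. ennreal ((norm (L \<omega>))\<^sup>2) = liminf (\<lambda>n. ennreal ((norm (X (r n) \<omega>))\<^sup>2))"
      using lim
    proof eventually_elim
      case (elim \<omega>)
      then have "(\<lambda>n. ennreal ((norm (X (r n) \<omega>))\<^sup>2)) \<longlonglongrightarrow> ennreal ((norm (L \<omega>))\<^sup>2)"
        by (intro tendsto_ennrealI tendsto_intros)
      then show ?case by (rule lim_imp_Liminf[OF sequentially_bot, symmetric])
    qed
  qed
  also have "\<dots> \<le> liminf (\<lambda>n. \<integral>\<^sup>+\<omega>. ennreal ((norm (X (r n) \<omega>))\<^sup>2) \<partial>M)"
    by (rule nn_integral_liminf) auto
  also have "\<dots> \<le> liminf (\<lambda>n. ennreal B)"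
  proof (rule Liminf_mono, rule always_eventually, rule allI)
    fix n
    have "(\<integral>\<^sup>+\<omega>. ennreal ((norm (X (r n) \<omega>))\<^sup>2) \<partial>M) = ennreal (expectation (\<lambda>\<omega>. (norm (X (r n) \<omega>))\<^sup>2))"
      using sq by (intro nn_integral_eq_integral) (auto simp: sq_integrable_def)
    also have "\<dots> \<le> ennreal B" by (intro ennreal_leI B)
    finally show "(\<integral>\<^sup>+\<omega>. ennreal ((norm (X (r n) \<omega>))\<^sup>2) \<partial>M) \<le> ennreal B" .
  qed
  also have "\<dots> = ennreal B" by (simp add: Liminf_const)
  finally have le: "(\<integral>\<^sup>+\<omega>. ennreal ((norm (L \<omega>))\<^sup>2) \<partial>M) \<le> ennreal B" .
  have int: "integrable M (\<lambda>\<omega>. (norm (L \<omega>))\<^sup>2)"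
    by (rule integrableI_bounded) (use le in \<open>auto simp: le_less_trans\<close>)
  then show "sq_integrable M L" by (simp add: sq_integrable_def)
  have "ennreal (expectation (\<lambda>\<omega>. (norm (L \<omega>))\<^sup>2)) \<le> ennreal B"
    using le int by (subst nn_integral_eq_integral[symmetric]) auto
  then show "expectation (\<lambda>\<omega>. (norm (L \<omega>))\<^sup>2) \<le> B" using B0 by simp
qed

text \<open>Bounded second moments make the sequence uniformly integrable.\<close>

lemma (in prob_space) conv_prob_expectation_zero:
  fixes L :: "'a \<Rightarrow> 'b::euclidean_space"
  assumes X: "conv_prob M X L" and sq: "\<And>n. sq_integrable M (X n)"
    and B: "\<And>n. expectation (\<lambda>\<omega>. (norm (X n \<omega>))\<^sup>2) \<le> B" and zero: "\<And>n. expectation (X n) = 0"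
  shows "expectation L = 0"
proof -
  note L = conv_prob_second_moment[OF X sq B]
  have [measurable]: "X n \<in> borel_measurable M" "L \<in> borel_measurable M" for n using X by (auto simp: conv_prob_def)
  have B0: "0 \<le> B" by (rule order_trans[OF _ B[of 0]]) simp
  have "norm (expectation L) \<le> e" if e: "0 < e" for e
  proof -
    \<comment> \<open>The final estimate has three summands: \<open>e / 4\<close> off the
      exceptional set, \<open>4 * B * d\<close> from the second moments, and
      \<open>(1 / d) * prob (A n)\<close>. This \<open>d\<close> makes the second at most
      \<open>e / 4\<close>; \<open>n\<close> is then chosen so that the third is too.\<close>
    define d where "d = e / (4 * (4 * B + 1))"
    have d: "0 < d" "4 * B * d \<le> e / 4"
      using e B0 by (auto simp: d_def field_simps)
    define A where "A n = {\<omega> \<in> space M. e / 4 < dist (X n \<omega>) (L \<omega>)}" for n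
    have A_meas[measurable]: "A n \<in> sets M" for n unfolding A_def by measurable
    have A_int: "integrable M (indicator (A n) :: 'a \<Rightarrow> real)" for n
      by (rule integrable_real_indicator[OF A_meas]) (simp add: less_top[symmetric])
    have "(\<lambda>n. prob (A n)) \<longlonglongrightarrow> 0" using e unfolding A_def by (intro conv_prob_lim[OF X]) auto
    then have "\<forall>\<^sub>F n in sequentially. prob (A n) < d * e / 4" using e d by (intro order_tendstoD) auto
    then obtain n where n: "prob (A n) < d * e / 4" using eventually_happens' sequentially_bot by blast
    define Y where "Y \<omega> = L \<omega> - X n \<omega>" for \<omega>
    have Yint: "integrable M Y" unfolding Y_def
      using L(1) sq by (intro Bochner_Integration.integrable_diff sq_integrable_imp_integrable)
    have Y2: "(norm (Y \<omega>))\<^sup>2 \<le> 2 * (norm (L \<omega>))\<^sup>2 + 2 * (norm (X n \<omega>))\<^sup>2" for \<omega>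
      using norm_add_square_le[of "L \<omega>" "- X n \<omega>"] by (simp add: Y_def)
    have "norm (expectation L) = norm (expectation Y)"
      unfolding Y_def using L(1) sq zero by (simp add: sq_integrable_imp_integrable)
    also have "\<dots> \<le> expectation (\<lambda>\<omega>. norm (Y \<omega>))" by (rule integral_norm_bound)
    also have "\<dots> \<le> expectation (\<lambda>\<omega>. e / 4 + d * (2 * (norm (L \<omega>))\<^sup>2 + 2 * (norm (X n \<omega>))\<^sup>2) + (1 / d) * indicator (A n) \<omega>)"
    proof (rule integral_mono)
      show "integrable M (\<lambda>\<omega>. e / 4 + d * (2 * (norm (L \<omega>))\<^sup>2 + 2 * (norm (X n \<omega>))\<^sup>2) + (1 / d) * indicator (A n) \<omega>)"
        using L(1) sq unfolding sq_integrable_def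
        by (intro Bochner_Integration.integrable_add integrable_mult_right integrable_const A_int) auto
      fix \<omega> assume \<omega>: "\<omega> \<in> space M"
      show "norm (Y \<omega>) \<le> e / 4 + d * (2 * (norm (L \<omega>))\<^sup>2 + 2 * (norm (X n \<omega>))\<^sup>2) + (1 / d) * indicator (A n) \<omega>"
      proof (cases "\<omega> \<in> A n")
        case True
        \<comment> \<open>Young's inequality with weight \<open>d\<close>: on the exceptional set
          \<open>norm (Y \<omega>)\<close> is traded for a small multiple of its square plus a
          constant that meets the small probability.\<close>
        have "0 \<le> d * (norm (Y \<omega>) - 1 / d)\<^sup>2" using d by simp
        then have "2 * norm (Y \<omega>) \<le> d * (norm (Y \<omega>))\<^sup>2 + 1 / d"
        proof -
          have "d * (norm (Y \<omega>) - 1 / d)\<^sup>2 = d * (norm (Y \<omega>))\<^sup>2 - 2 * norm (Y \<omega>) + 1 / d"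
            using d by (simp add: power2_eq_square field_simps)
          then show ?thesis using \<open>0 \<le> d * (norm (Y \<omega>) - 1 / d)\<^sup>2\<close> by linarith
        qed
        also have "\<dots> \<le> d * (2 * (norm (L \<omega>))\<^sup>2 + 2 * (norm (X n \<omega>))\<^sup>2) + 1 / d"
          using Y2 d by (intro add_right_mono mult_left_mono) auto
        finally have "2 * norm (Y \<omega>) \<le> d * (2 * (norm (L \<omega>))\<^sup>2 + 2 * (norm (X n \<omega>))\<^sup>2) + 1 / d" .
        moreover have "(1 / d) * indicator (A n) \<omega> = 1 / d" using True by (simp add: indicator_def)
        ultimately show ?thesis using norm_ge_zero[of "Y \<omega>"] e by linarith
      next
        case False
        then have "norm (Y \<omega>) \<le> e / 4" using \<omega> by (simp add: A_def Y_def dist_norm norm_minus_commute)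
        moreover have "0 \<le> d * (2 * (norm (L \<omega>))\<^sup>2 + 2 * (norm (X n \<omega>))\<^sup>2)" using d by simp
        ultimately show ?thesis using False by (simp add: indicator_def)
      qed
    qed (use Yint in auto)
    also have "\<dots> = e / 4 + d * (2 * expectation (\<lambda>\<omega>. (norm (L \<omega>))\<^sup>2) + 2 * expectation (\<lambda>\<omega>. (norm (X n \<omega>))\<^sup>2))
        + (1 / d) * prob (A n)"
      using L(1) sq unfolding sq_integrable_def by (simp add: prob_space A_int)
    also have "\<dots> \<le> e / 4 + d * (2 * B + 2 * B) + (1 / d) * (d * e / 4)"
      using n d L(2) B by (intro add_mono mult_left_mono) auto
    also have "\<dots> \<le> e" using d e by (simp add: algebra_simps)
    finally show ?thesis .
  qed
  then have "norm (expectation L) \<le> 0"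
    using field_le_epsilon[of "norm (expectation L)" 0] by simp
  then show ?thesis by simp
qed

section \<open>Matrices as bounded linear maps\<close>

lemma bounded_bilinear_matrix_vector: "bounded_bilinear ((*v) :: real^'n^'m \<Rightarrow> real^'n \<Rightarrow> real^'m)"
  unfolding bilinear_conv_bounded_bilinear[symmetric] bilinear_def
  by (intro conjI allI linearI)
    (simp_all add: matrix_vector_right_distrib matrix_vector_mult_add_rdistrib matrix_vector_mult_scaleR
      scaleR_matrix_vector_assoc)

lemma bounded_bilinear_matrix_mult: "bounded_bilinear ((**) :: real^'n^'m \<Rightarrow> real^'k^'n \<Rightarrow> real^'k^'m)"
  unfolding bilinear_conv_bounded_bilinear[symmetric] bilinear_def
  by (intro conjI allI linearI)
    (simp_all add: vec_eq_iff matrix_matrix_mult_def algebra_simps sum.distrib sum_distrib_left)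

lemma bounded_linear_transpose: "bounded_linear (transpose :: real^'n^'m \<Rightarrow> real^'m^'n)"
  unfolding linear_conv_bounded_linear[symmetric]
  by (rule linearI) (simp_all add: transpose_def vec_eq_iff)

lemmas continuous_on_matrix_vector = bounded_bilinear.continuous_on[OF bounded_bilinear_matrix_vector]
lemmas continuous_on_matrix_mult = bounded_bilinear.continuous_on[OF bounded_bilinear_matrix_mult]
lemmas continuous_on_transpose = bounded_linear.continuous_on[OF bounded_linear_transpose]

text \<open>On the operator side \<open>norm\<close> is the matrix 2-norm of the horizon bound,
  whereas on the matrix type it is the Frobenius norm.\<close>

definition mv :: "real^'n^'m \<Rightarrow> (real^'n) \<Rightarrow>\<^sub>L (real^'m)" where
  "mv A = Blinfun ((*v) A)"

lemma mv_apply [simp]: "blinfun_apply (mv A) x = A *v x"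
  by (simp add: mv_def bounded_linear_Blinfun_apply)

lemma bounded_linear_mv: "bounded_linear (mv :: real^'n^'m \<Rightarrow> _)"
  unfolding linear_conv_bounded_linear[symmetric]
  by (rule linearI) (auto intro!: blinfun_eqI simp: blinfun.bilinear_simps
      matrix_vector_mult_add_rdistrib scaleR_matrix_vector_assoc)

lemmas continuous_on_mv = bounded_linear.continuous_on[OF bounded_linear_mv]

lemma norm_mv: "norm (mv A) = onorm ((*v) A)"
  by (simp add: norm_blinfun.rep_eq mv_apply[abs_def, symmetric])

section \<open>Riemann sums against absolutely continuous paths\<close>

lemma integral_sum_partition:
  fixes F :: "real \<Rightarrow> 'b::euclidean_space"
  assumes p: "mono (p :: nat \<Rightarrow> real)" and F: "continuous_on {p 0..p n} F"
  shows "integral {p 0..p n} F = (\<Sum>k<n. integral {p k..p (Suc k)} F)"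
proof -
  have "integral {p 0..p m} F = (\<Sum>k<m. integral {p k..p (Suc k)} F)" if "m \<le> n" for m
    using that
  proof (induction m)
    case (Suc m)
    have "integral {p 0..p m} F + integral {p m..p (Suc m)} F = integral {p 0..p (Suc m)} F"
      using Suc.prems by (intro Henstock_Kurzweil_Integration.integral_combine integrable_continuous_real
          continuous_on_subset[OF F]) (auto intro: monoD[OF p] order_trans[OF _ monoD[OF p]])
    with Suc show ?case by simp
  qed simp
  then show ?thesis by simp
qed

text \<open>Each summand is the integral of \<open>f (p k) *v g s\<close> over its subinterval.
  Uniform continuity of \<open>f\<close> in operator norm bounds the total error by
  \<open>e'\<close> times the integral of \<open>norm (g s)\<close>.\<close>

lemma stoch_sum_absolutely_continuous:
  fixes f :: "real \<Rightarrow> real^'n^'m" and g :: "real \<Rightarrow> real^'n"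
  assumes f: "continuous_on {0..t} f" and g: "continuous_on {0..t} g" and t: "0 \<le> t"
    and Z: "\<And>s. s \<in> {0..t} \<Longrightarrow> Z s \<omega> = c + integral {0..s} g"
  shows "(\<lambda>n. stoch_sum f Z t n \<omega>) \<longlonglongrightarrow> integral {0..t} (\<lambda>s. f s *v g s)"
proof (rule LIMSEQ_I)
  fix e :: real assume e: "0 < e"
  define G where "G = integral {0..t} (\<lambda>s. norm (g s))"
  have G: "0 \<le> G" unfolding G_def
    by (intro Henstock_Kurzweil_Integration.integral_nonneg integrable_continuous_real continuous_intros g) auto
  \<comment> \<open>\<open>G + 1\<close> in place of \<open>G\<close>, as \<open>G\<close> may
    vanish.\<close>
  define e' where "e' = e / (G + 1)"
  have e': "0 < e'" "e' * G < e" using e G by (auto simp: e'_def field_simps)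
  have F: "continuous_on {0..t} (\<lambda>s. f s *v g s)" by (rule continuous_on_matrix_vector[OF f g])
  have "uniformly_continuous_on {0..t} (\<lambda>s. mv (f s))"
    by (intro compact_uniformly_continuous continuous_on_mv f) auto
  then obtain d where d: "0 < d" "\<And>s s'. s \<in> {0..t} \<Longrightarrow> s' \<in> {0..t} \<Longrightarrow> dist s s' < d \<Longrightarrow> dist (mv (f s)) (mv (f s')) < e'"
    using e' unfolding uniformly_continuous_on_def by metis
  obtain N where N: "t / d < real N" using reals_Archimedean2 by blast
  have "norm (stoch_sum f Z t n \<omega> - integral {0..t} (\<lambda>s. f s *v g s)) < e" if n: "Suc N \<le> n" for n
  proof -
    define p where "p k = t * real k / real n" for k
    have p: "mono p" using t by (auto simp: p_def intro!: monoI divide_right_mono mult_left_mono)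
    have p0: "p 0 = 0" "p n = t" using n by (auto simp: p_def)
    have pk: "p k \<in> {0..t}" "p (Suc k) \<in> {0..t}" "p k \<le> p (Suc k)" if "k < n" for k
      using monoD[OF p, of 0 k] monoD[OF p, of 0 "Suc k"] monoD[OF p, of k n] monoD[OF p, of "Suc k" n]
        monoD[OF p, of k "Suc k"] that p0 by auto
    have step: "p (Suc k) - p k < d" for k
    proof -
      have "p (Suc k) - p k = t / real n" by (simp add: p_def diff_divide_distrib[symmetric] algebra_simps)
      also have "\<dots> < d" using N n d(1) by (simp add: divide_less_eq mult.commute) (smt (verit) mult_strict_left_mono of_nat_Suc of_nat_le_iff)
      finally show ?thesis .
    qed
    have sub: "continuous_on {p k..p (Suc k)} h" if "continuous_on {0..t} h" "k < n" for h :: "real \<Rightarrow> 'c::real_normed_vector" and k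
      using pk[OF that(2)] by (intro continuous_on_subset[OF that(1)]) auto
    have incr: "norm (f (p k) *v (Z (p (Suc k)) \<omega> - Z (p k) \<omega>) - integral {p k..p (Suc k)} (\<lambda>s. f s *v g s))
        \<le> integral {p k..p (Suc k)} (\<lambda>s. e' * norm (g s))" if k: "k < n" for k
    proof -
      have "integral {0..p k} g + integral {p k..p (Suc k)} g = integral {0..p (Suc k)} g"
        using pk[OF k] by (intro Henstock_Kurzweil_Integration.integral_combine integrable_continuous_real continuous_on_subset[OF g]) auto
      then have "Z (p (Suc k)) \<omega> - Z (p k) \<omega> = integral {p k..p (Suc k)} g"
        using Z pk[OF k] by (simp add: algebra_simps)
      then have "f (p k) *v (Z (p (Suc k)) \<omega> - Z (p k) \<omega>) = integral {p k..p (Suc k)} (\<lambda>s. f (p k) *v g s)"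
        using integral_linear[OF integrable_continuous_real[OF sub[OF g k]], of "(*v) (f (p k))"] by (simp add: o_def)
      then have "f (p k) *v (Z (p (Suc k)) \<omega> - Z (p k) \<omega>) - integral {p k..p (Suc k)} (\<lambda>s. f s *v g s)
          = integral {p k..p (Suc k)} (\<lambda>s. f (p k) *v g s - f s *v g s)"
        by (simp add: Henstock_Kurzweil_Integration.integral_diff integrable_continuous_real sub[OF F k]
            continuous_on_matrix_vector[OF continuous_on_const sub[OF g k]])
      also have "norm \<dots> \<le> integral {p k..p (Suc k)} (\<lambda>s. e' * norm (g s))"
      proof (rule integral_norm_bound_integral)
        show "(\<lambda>s. f (p k) *v g s - f s *v g s) integrable_on {p k..p (Suc k)}"
          by (intro integrable_continuous_real continuous_on_diff sub[OF F k]
              continuous_on_matrix_vector[OF continuous_on_const sub[OF g k]])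
        show "(\<lambda>s. e' * norm (g s)) integrable_on {p k..p (Suc k)}"
          by (intro integrable_continuous_real continuous_intros sub[OF g k])
        fix s assume s: "s \<in> {p k..p (Suc k)}"
        then have "s \<in> {0..t}" "dist (p k) s < d" using pk[OF k] step[of k] by (auto simp: dist_real_def)
        then have "norm (mv (f (p k)) - mv (f s)) \<le> e'" using d(2)[of "p k" s] pk[OF k] by (simp add: dist_norm)
        then have "norm (blinfun_apply (mv (f (p k)) - mv (f s)) (g s)) \<le> e' * norm (g s)"
          by (intro order_trans[OF norm_blinfun] mult_right_mono) auto
        then show "norm (f (p k) *v g s - f s *v g s) \<le> e' * norm (g s)" by (simp add: blinfun.diff_left)
      qed
      finally show ?thesis .
    qed
    have "stoch_sum f Z t n \<omega> - integral {0..t} (\<lambda>s. f s *v g s)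
        = (\<Sum>k<n. f (p k) *v (Z (p (Suc k)) \<omega> - Z (p k) \<omega>) - integral {p k..p (Suc k)} (\<lambda>s. f s *v g s))"
      using integral_sum_partition[OF p, of n "\<lambda>s. f s *v g s"] F p0
      by (simp add: stoch_sum_def p_def[symmetric] sum_subtractf del: of_nat_Suc)
    also have "norm \<dots> \<le> (\<Sum>k<n. integral {p k..p (Suc k)} (\<lambda>s. e' * norm (g s)))"
      by (intro order_trans[OF norm_sum] sum_mono incr) auto
    also have "\<dots> = integral {p 0..p n} (\<lambda>s. e' * norm (g s))"
      using p0 g by (intro integral_sum_partition[OF p, symmetric] continuous_intros) auto
    also have "\<dots> = e' * G" by (simp add: p0 G_def)
    finally show ?thesis using e' by simp
  qed
  then show "\<exists>N. \<forall>n\<ge>N. norm (stoch_sum f Z t n \<omega> - integral {0..t} (\<lambda>s. f s *v g s)) < e" by blast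
qed

section \<open>Processes with bounded second moments\<close>

text \<open>The bound on the second moments is uniform in time; Fubini on \<open>{0..T}\<close>
  relies on it.\<close>

definition l2_process :: "'w measure \<Rightarrow> real \<Rightarrow> (real \<Rightarrow> 'w \<Rightarrow> 'b::euclidean_space) \<Rightarrow> bool" where
  "l2_process M T Z \<longleftrightarrow> continuous_process M {0..T} Z \<and>
     (\<exists>B. \<forall>t\<in>{0..T}. sq_integrable M (Z t) \<and> (LINT \<omega>|M. (norm (Z t \<omega>))\<^sup>2) \<le> B)"

lemma continuous_process_measurable: "continuous_process M I Z \<Longrightarrow> t \<in> I \<Longrightarrow> Z t \<in> borel_measurable M"
  and continuous_process_path: "continuous_process M I Z \<Longrightarrow> \<omega> \<in> space M \<Longrightarrow> continuous_on I (\<lambda>t. Z t \<omega>)"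
  by (auto simp: continuous_process_def)

lemma l2_processE:
  assumes "l2_process M T Z"
  obtains B where "continuous_process M {0..T} Z" "\<And>t. t \<in> {0..T} \<Longrightarrow> sq_integrable M (Z t)"
    "\<And>t. t \<in> {0..T} \<Longrightarrow> (LINT \<omega>|M. (norm (Z t \<omega>))\<^sup>2) \<le> B" "0 \<le> B"
proof -
  obtain B where B: "continuous_process M {0..T} Z" "\<And>t. t \<in> {0..T} \<Longrightarrow> sq_integrable M (Z t)"
    "\<And>t. t \<in> {0..T} \<Longrightarrow> (LINT \<omega>|M. (norm (Z t \<omega>))\<^sup>2) \<le> B" using assms unfolding l2_process_def by blast
  show thesis
    by (rule that[of "\<bar>B\<bar>"]) (use B in \<open>auto intro: order_trans[OF _ abs_ge_self]\<close>)
qed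

lemma (in prob_space) l2_process_integrable:
  assumes "l2_process M T Z" "t \<in> {0..T}" shows "integrable M (Z t)"
  using assms by (auto simp: l2_process_def intro!: sq_integrable_imp_integrable)

text \<open>By path continuity the process is the limit of its values at the grid times below
  \<open>t\<close>. Each discretisation uses countably many times and is therefore jointly
  measurable. The clamp keeps the grid times inside \<open>{0..T}\<close>.\<close>

lemma process_jointly_measurable:
  fixes Z :: "real \<Rightarrow> 'w \<Rightarrow> 'b::euclidean_space"
  assumes Z: "continuous_process M {0..T} Z" and T: "0 \<le> T"
  shows "(\<lambda>(t, \<omega>). Z (min T (max 0 t)) \<omega>) \<in> borel_measurable (lborel \<Otimes>\<^sub>M M)"
proof -
  define c where "c t = min T (max 0 t)" for t :: real
  have c: "c t \<in> {0..T}" for t using T by (auto simp: c_def)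
  have c_cont: "isCont c t" for t unfolding c_def by (intro continuous_intros)
  define g where "g n t = of_int \<lfloor>t * real (Suc n)\<rfloor> / real (Suc n)" for n and t :: real
  have meas: "(\<lambda>x. Z (c (g n (fst x))) (snd x)) \<in> borel_measurable (lborel \<Otimes>\<^sub>M M)" for n
  proof -
    have "(\<lambda>x. Z (c (of_int i / real (Suc n))) (snd x)) \<in> borel_measurable (lborel \<Otimes>\<^sub>M M)" for i :: int
      by (rule measurable_compose[OF measurable_snd continuous_process_measurable[OF Z c]])
    moreover have "(\<lambda>x. \<lfloor>fst x * real (Suc n)\<rfloor>) \<in> measurable (lborel \<Otimes>\<^sub>M M) (count_space UNIV)"
      by measurable
    ultimately have "(\<lambda>x. Z (c (of_int \<lfloor>fst x * real (Suc n)\<rfloor> / real (Suc n))) (snd x)) \<in> borel_measurable (lborel \<Otimes>\<^sub>M M)"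
      by (rule measurable_compose_countable)
    then show ?thesis by (simp add: g_def)
  qed
  have "(\<lambda>n. Z (c (g n (fst x))) (snd x)) \<longlonglongrightarrow> Z (c (fst x)) (snd x)" if "x \<in> space (lborel \<Otimes>\<^sub>M M)" for x
  proof -
    obtain t \<omega> where x: "x = (t, \<omega>)" by (cases x)
    have \<omega>: "\<omega> \<in> space M" using that x by (auto simp: space_pair_measure)
    have "(\<lambda>n. g n t) \<longlonglongrightarrow> t"
    proof (rule tendsto_sandwich)
      show "(\<lambda>n. t - 1 / real (Suc n)) \<longlonglongrightarrow> t"
        using tendsto_diff[OF tendsto_const LIMSEQ_inverse_real_of_nat, of t] by (simp add: inverse_eq_divide)
      show "(\<lambda>n. t) \<longlonglongrightarrow> t" by simp
      have "t - 1 / real (Suc n) \<le> g n t" for n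
      proof -
        have "t - 1 / real (Suc n) = (t * real (Suc n) - 1) / real (Suc n)"
          by (simp add: diff_divide_distrib del: of_nat_Suc)
        also have "\<dots> \<le> g n t"
          unfolding g_def using floor_correct[of "t * real (Suc n)"] by (intro divide_right_mono) linarith+
        finally show ?thesis .
      qed
      then show "\<forall>\<^sub>F n in sequentially. t - 1 / real (Suc n) \<le> g n t" by simp
      have "g n t \<le> t" for n
        using floor_correct[of "t * real (Suc n)"] unfolding g_def by (simp add: pos_divide_le_eq)
      then show "\<forall>\<^sub>F n in sequentially. g n t \<le> t" by simp
    qed
    then have lim: "(\<lambda>n. c (g n t)) \<longlonglongrightarrow> c t" by (rule isCont_tendsto_compose[OF c_cont])
    have "(\<lambda>n. Z (c (g n t)) \<omega>) \<longlonglongrightarrow> Z (c t) \<omega>"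
      by (rule continuous_on_tendsto_compose[OF continuous_process_path[OF Z \<omega>] lim]) (use c in auto)
    then show ?thesis by (simp add: x)
  qed
  from borel_measurable_LIMSEQ_metric[OF meas this] show ?thesis
    by (simp add: c_def case_prod_beta')
qed

text \<open>Bridge between the Henstock-Kurzweil integral, in which dynamics and costs are written,
  and the Lebesgue integral to which Fubini applies.\<close>

lemma lborel_integral_path:
  fixes Z :: "real \<Rightarrow> 'w \<Rightarrow> 'b::euclidean_space"
  assumes Z: "continuous_process M {0..T} Z" and t: "t \<in> {0..T}" and \<omega>: "\<omega> \<in> space M"
  shows "(LINT s|lborel. indicator {0..t} s *\<^sub>R Z (min T (max 0 s)) \<omega>) = integral {0..t} (\<lambda>s. Z s \<omega>)"
proof -
  have "set_integrable lborel {0..t} (\<lambda>s. Z s \<omega>)"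
    using t by (intro borel_integrable_atLeastAtMost' continuous_on_subset[OF continuous_process_path[OF Z \<omega>]]) auto
  from set_borel_integral_eq_integral(2)[OF this]
  have "(LINT s|lborel. indicator {0..t} s *\<^sub>R Z s \<omega>) = integral {0..t} (\<lambda>s. Z s \<omega>)"
    by (simp add: set_lebesgue_integral_def)
  moreover have "min T (max 0 s) = s" if "s \<in> {0..t}" for s using that t by auto
  then have "(\<lambda>s. indicator {0..t} s *\<^sub>R Z (min T (max 0 s)) \<omega>) = (\<lambda>s. indicator {0..t} s *\<^sub>R Z s \<omega>)"
    by (intro ext) (metis indicator_simps(2) scaleR_zero_left)
  ultimately show ?thesis by simp
qed

lemma (in prob_space) fubini_process:
  fixes Z :: "real \<Rightarrow> 'a \<Rightarrow> 'b::euclidean_space"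
  assumes Z: "continuous_process M {0..T} Z" and t: "t \<in> {0..T}"
    and int: "\<And>s. s \<in> {0..T} \<Longrightarrow> integrable M (Z s)"
    and B: "\<And>s. s \<in> {0..T} \<Longrightarrow> expectation (\<lambda>\<omega>. norm (Z s \<omega>)) \<le> B"
  shows "integrable M (\<lambda>\<omega>. integral {0..t} (\<lambda>s. Z s \<omega>))"
    "(\<lambda>s. expectation (Z s)) integrable_on {0..t}"
    "expectation (\<lambda>\<omega>. integral {0..t} (\<lambda>s. Z s \<omega>)) = integral {0..t} (\<lambda>s. expectation (Z s))"
proof -
  have T: "0 \<le> T" using t by auto
  define c where "c t = min T (max 0 t)" for t
  have c: "c s \<in> {0..T}" for s using T by (auto simp: c_def)
  have c_id: "c s = s" if "s \<in> {0..t}" for s using that t by (auto simp: c_def)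
  define h where "h s \<omega> = indicator {0..t} s *\<^sub>R Z (c s) \<omega>" for s \<omega>
  interpret P: pair_sigma_finite lborel M ..
  have jm[measurable]: "(\<lambda>(s, \<omega>). Z (c s) \<omega>) \<in> borel_measurable (lborel \<Otimes>\<^sub>M M)"
    unfolding c_def by (rule process_jointly_measurable[OF Z T])
  have [measurable]: "case_prod h \<in> borel_measurable (lborel \<Otimes>\<^sub>M M)"
    unfolding h_def using jm by (simp add: case_prod_beta)
  have hint: "integrable M (h s)" for s unfolding h_def using int[OF c] by simp
  have "integrable (lborel \<Otimes>\<^sub>M M) (case_prod h)"
  proof (rule P.Fubini_integrable)
    show "integrable lborel (\<lambda>s. expectation (\<lambda>\<omega>. norm (case_prod h (s, \<omega>))))"
    proof (rule Bochner_Integration.integrable_bound)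
      show "integrable lborel (\<lambda>s. indicator {0..t} s * B)"
        by (intro integrable_mult_left integrable_real_indicator) (auto simp: emeasure_lborel_Icc_eq)
      show "(\<lambda>s. expectation (\<lambda>\<omega>. norm (case_prod h (s, \<omega>)))) \<in> borel_measurable lborel" by measurable
      have "expectation (\<lambda>\<omega>. norm (h s \<omega>)) \<le> indicator {0..t} s * B" for s
        using B[OF c[of s]] by (auto simp: h_def indicator_def)
      then show "AE s in lborel. norm (expectation (\<lambda>\<omega>. norm (case_prod h (s, \<omega>)))) \<le> norm (indicator {0..t} s * B)"
        by (auto intro: order_trans[OF _ abs_ge_self])
    qed
  qed (use hint in auto)
  note h = this
  have path: "(LINT s|lborel. h s \<omega>) = integral {0..t} (\<lambda>s. Z s \<omega>)" if "\<omega> \<in> space M" for \<omega>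
    unfolding h_def c_def by (rule lborel_integral_path[OF Z t that])
  have "integrable M (\<lambda>\<omega>. LINT s|lborel. h s \<omega>)" by (rule P.integrable_snd[OF h])
  then show "integrable M (\<lambda>\<omega>. integral {0..t} (\<lambda>s. Z s \<omega>))"
    using path by (simp cong: Bochner_Integration.integrable_cong)
  have Eh: "expectation (h s) = indicator {0..t} s *\<^sub>R expectation (Z s)" for s
    by (cases "s \<in> {0..t}") (simp_all add: h_def[abs_def] c_id)
  have "integrable lborel (\<lambda>s. expectation (h s))" using P.integrable_fst[OF h] by simp
  then have si: "set_integrable lborel {0..t} (\<lambda>s. expectation (Z s))"
    by (simp add: set_integrable_def Eh)
  show "(\<lambda>s. expectation (Z s)) integrable_on {0..t}" by (rule set_borel_integral_eq_integral(1)[OF si])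
  have "expectation (\<lambda>\<omega>. integral {0..t} (\<lambda>s. Z s \<omega>)) = expectation (\<lambda>\<omega>. LINT s|lborel. h s \<omega>)"
    using path by (intro Bochner_Integration.integral_cong) auto
  also have "\<dots> = (LINT s|lborel. expectation (h s))" by (rule P.Fubini_integral[OF h])
  also have "\<dots> = integral {0..t} (\<lambda>s. expectation (Z s))"
    using set_borel_integral_eq_integral(2)[OF si] by (simp add: set_lebesgue_integral_def Eh)
  finally show "expectation (\<lambda>\<omega>. integral {0..t} (\<lambda>s. Z s \<omega>)) = integral {0..t} (\<lambda>s. expectation (Z s))" .
qed

lemma (in prob_space) sq_integrable_norm_bound:
  assumes "sq_integrable M X" "expectation (\<lambda>\<omega>. (norm (X \<omega>))\<^sup>2) \<le> B"
  shows "expectation (\<lambda>\<omega>. norm (X \<omega>)) \<le> 1 + B"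
proof -
  have "expectation (\<lambda>\<omega>. norm (X \<omega>)) \<le> expectation (\<lambda>\<omega>. 1 + (norm (X \<omega>))\<^sup>2)"
    using assms by (intro integral_mono norm_le_one_plus_square)
      (auto simp: sq_integrable_def intro!: integrable_norm sq_integrable_imp_integrable)
  also have "\<dots> \<le> 1 + B" using assms by (simp add: sq_integrable_def prob_space)
  finally show ?thesis .
qed

lemma (in prob_space) fubini_l2_process:
  fixes Z :: "real \<Rightarrow> 'a \<Rightarrow> 'b::euclidean_space"
  assumes Z: "l2_process M T Z" and t: "t \<in> {0..T}"
  shows "integrable M (\<lambda>\<omega>. integral {0..t} (\<lambda>s. Z s \<omega>))"
    "(\<lambda>s. expectation (Z s)) integrable_on {0..t}"
    "expectation (\<lambda>\<omega>. integral {0..t} (\<lambda>s. Z s \<omega>)) = integral {0..t} (\<lambda>s. expectation (Z s))"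
proof -
  obtain B where B: "continuous_process M {0..T} Z" "\<And>t. t \<in> {0..T} \<Longrightarrow> sq_integrable M (Z t)"
    "\<And>t. t \<in> {0..T} \<Longrightarrow> expectation (\<lambda>\<omega>. (norm (Z t \<omega>))\<^sup>2) \<le> B" "0 \<le> B" using l2_processE[OF Z] by blast
  have "integrable M (Z s)" "expectation (\<lambda>\<omega>. norm (Z s \<omega>)) \<le> 1 + B" if "s \<in> {0..T}" for s
    using sq_integrable_imp_integrable[OF B(2)[OF that]] sq_integrable_norm_bound[OF B(2,3)[OF that]] by auto
  from fubini_process[OF B(1) t this] show "integrable M (\<lambda>\<omega>. integral {0..t} (\<lambda>s. Z s \<omega>))"
    "(\<lambda>s. expectation (Z s)) integrable_on {0..t}"
    "expectation (\<lambda>\<omega>. integral {0..t} (\<lambda>s. Z s \<omega>)) = integral {0..t} (\<lambda>s. expectation (Z s))" by auto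
qed

section \<open>Closure properties of processes with bounded second moments\<close>

lemma l2_process_linear:
  fixes Z :: "real \<Rightarrow> 'w \<Rightarrow> 'b::euclidean_space" and L :: "real \<Rightarrow> 'b \<Rightarrow>\<^sub>L 'c::euclidean_space"
  assumes Z: "l2_process M T Z" and L: "continuous_on {0..T} L"
  shows "l2_process M T (\<lambda>t \<omega>. L t (Z t \<omega>))"
proof -
  obtain B where B: "continuous_process M {0..T} Z" "\<And>t. t \<in> {0..T} \<Longrightarrow> sq_integrable M (Z t)"
    "\<And>t. t \<in> {0..T} \<Longrightarrow> (LINT \<omega>|M. (norm (Z t \<omega>))\<^sup>2) \<le> B" "0 \<le> B" using l2_processE[OF Z] by blast
  obtain C where C: "0 \<le> C" "\<And>t. t \<in> {0..T} \<Longrightarrow> norm (L t) \<le> C" using continuous_on_bounded_norm[OF L] by blast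
  have sq: "sq_integrable M (\<lambda>\<omega>. L t (Z t \<omega>))" if "t \<in> {0..T}" for t
    by (rule sq_integrable_linear[OF B(2)[OF that] blinfun.bounded_linear_right])
  have "(LINT \<omega>|M. (norm (L t (Z t \<omega>)))\<^sup>2) \<le> C\<^sup>2 * B" if t: "t \<in> {0..T}" for t
  proof -
    have "(LINT \<omega>|M. (norm (L t (Z t \<omega>)))\<^sup>2) \<le> (LINT \<omega>|M. C\<^sup>2 * (norm (Z t \<omega>))\<^sup>2)"
    proof (rule integral_mono)
      fix \<omega>
      have "norm (L t (Z t \<omega>)) \<le> C * norm (Z t \<omega>)"
        by (rule order_trans[OF norm_blinfun]) (intro mult_right_mono C t norm_ge_zero)
      then show "(norm (L t (Z t \<omega>)))\<^sup>2 \<le> C\<^sup>2 * (norm (Z t \<omega>))\<^sup>2"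
        using power_mono[of _ "C * norm (Z t \<omega>)" 2] by (simp add: power_mult_distrib)
    qed (use sq[OF t] B(2)[OF t] in \<open>auto simp: sq_integrable_def\<close>)
    also have "\<dots> \<le> C\<^sup>2 * B" using B(3)[OF t] by (simp add: mult_left_mono)
    finally show ?thesis .
  qed
  moreover have "continuous_process M {0..T} (\<lambda>t \<omega>. L t (Z t \<omega>))"
    unfolding continuous_process_def
  proof (intro conjI ballI)
    show "(\<lambda>\<omega>. L t (Z t \<omega>)) \<in> borel_measurable M" if "t \<in> {0..T}" for t
      using sq[OF that] by (simp add: sq_integrable_def)
    show "continuous_on {0..T} (\<lambda>t. L t (Z t \<omega>))" if "\<omega> \<in> space M" for \<omega>
      by (intro continuous_intros L continuous_process_path[OF B(1) that])
  qed
  ultimately show ?thesis using sq unfolding l2_process_def by blast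
qed

lemma l2_process_add:
  fixes X Y :: "real \<Rightarrow> 'w \<Rightarrow> 'b::euclidean_space"
  assumes X: "l2_process M T X" and Y: "l2_process M T Y" shows "l2_process M T (\<lambda>t \<omega>. X t \<omega> + Y t \<omega>)"
proof -
  obtain B where B: "continuous_process M {0..T} X" "\<And>t. t \<in> {0..T} \<Longrightarrow> sq_integrable M (X t)"
    "\<And>t. t \<in> {0..T} \<Longrightarrow> (LINT \<omega>|M. (norm (X t \<omega>))\<^sup>2) \<le> B" "0 \<le> B" using l2_processE[OF X] by blast
  obtain C where C: "continuous_process M {0..T} Y" "\<And>t. t \<in> {0..T} \<Longrightarrow> sq_integrable M (Y t)"
    "\<And>t. t \<in> {0..T} \<Longrightarrow> (LINT \<omega>|M. (norm (Y t \<omega>))\<^sup>2) \<le> C" "0 \<le> C" using l2_processE[OF Y] by blast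
  have "(LINT \<omega>|M. (norm (X t \<omega> + Y t \<omega>))\<^sup>2) \<le> 2 * B + 2 * C" if t: "t \<in> {0..T}" for t
  proof -
    have "(LINT \<omega>|M. (norm (X t \<omega> + Y t \<omega>))\<^sup>2) \<le> (LINT \<omega>|M. 2 * (norm (X t \<omega>))\<^sup>2 + 2 * (norm (Y t \<omega>))\<^sup>2)"
      using sq_integrable_add[OF B(2)[OF t] C(2)[OF t]] B(2)[OF t] C(2)[OF t]
      by (intro integral_mono norm_add_square_le) (auto simp: sq_integrable_def)
    also have "\<dots> \<le> 2 * B + 2 * C"
      using B(2,3)[OF t] C(2,3)[OF t] by (simp add: sq_integrable_def)
    finally show ?thesis .
  qed
  moreover have "continuous_process M {0..T} (\<lambda>t \<omega>. X t \<omega> + Y t \<omega>)"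
    using B(1) C(1) by (auto simp: continuous_process_def intro!: borel_measurable_add continuous_on_add)
  ultimately show ?thesis
    using sq_integrable_add[OF B(2) C(2)] unfolding l2_process_def by blast
qed

lemma l2_process_const: "sq_integrable M X \<Longrightarrow> l2_process M T (\<lambda>_. X)"
  by (auto simp: l2_process_def continuous_process_def sq_integrable_def)

lemma l2_process_Pair:
  fixes X :: "real \<Rightarrow> 'w \<Rightarrow> 'b::euclidean_space" and Y :: "real \<Rightarrow> 'w \<Rightarrow> 'c::euclidean_space"
  assumes X: "l2_process M T X" and Y: "l2_process M T Y" shows "l2_process M T (\<lambda>t \<omega>. (X t \<omega>, Y t \<omega>))"
proof -
  have "l2_process M T (\<lambda>t \<omega>. Blinfun (\<lambda>x. (x, 0)) (X t \<omega>) + Blinfun (\<lambda>y. (0, y)) (Y t \<omega>))"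
    by (intro l2_process_add l2_process_linear X Y continuous_on_const)
  moreover have "bounded_linear (\<lambda>x :: 'b. (x, 0 :: 'c))" "bounded_linear (\<lambda>y :: 'c. (0 :: 'b, y))"
    by (intro bounded_linear_Pair bounded_linear_ident bounded_linear_zero)+
  ultimately show ?thesis by (simp add: bounded_linear_Blinfun_apply)
qed

lemma (in prob_space) process_integral_measurable:
  fixes Z :: "real \<Rightarrow> 'a \<Rightarrow> 'b::euclidean_space"
  assumes Z: "continuous_process M {0..T} Z" and t: "t \<in> {0..T}"
  shows "(\<lambda>\<omega>. integral {0..t} (\<lambda>s. Z s \<omega>)) \<in> borel_measurable M"
proof -
  have T: "0 \<le> T" using t by auto
  have "(\<lambda>(s, \<omega>). indicator {0..t} s *\<^sub>R Z (min T (max 0 s)) \<omega>) \<in> borel_measurable (lborel \<Otimes>\<^sub>M M)"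
    using process_jointly_measurable[OF Z T] by (simp add: case_prod_beta')
  then have "(\<lambda>(\<omega>, s). indicator {0..t} s *\<^sub>R Z (min T (max 0 s)) \<omega>) \<in> borel_measurable (M \<Otimes>\<^sub>M lborel)"
    by (subst (asm) measurable_pair_swap_iff) (simp add: case_prod_beta')
  then have "(\<lambda>\<omega>. LINT s|lborel. indicator {0..t} s *\<^sub>R Z (min T (max 0 s)) \<omega>) \<in> borel_measurable M"
    by (rule lborel.borel_measurable_lebesgue_integral)
  then show ?thesis using lborel_integral_path[OF Z t] by (simp cong: measurable_cong)
qed

section \<open>Linear integral equations with random forcing\<close>

lemma integral_square_le:
  fixes g :: "real \<Rightarrow> real"
  assumes g: "continuous_on {0..T} g" and T: "0 < T"
  shows "(integral {0..T} g)\<^sup>2 \<le> T * integral {0..T} (\<lambda>s. (g s)\<^sup>2)"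
proof -
  \<comment> \<open>\<open>m\<close> is the mean value of \<open>g\<close>. Nonnegativity of the
    variance around it is Cauchy-Schwarz against a constant function.\<close>
  define m where "m = integral {0..T} g / T"
  have "0 \<le> integral {0..T} (\<lambda>s. (g s - m)\<^sup>2)"
    by (intro Henstock_Kurzweil_Integration.integral_nonneg integrable_continuous_real continuous_intros g) auto
  also have "(\<lambda>s. (g s - m)\<^sup>2) = (\<lambda>s. (g s)\<^sup>2 - (2 * m) * g s + m\<^sup>2)"
    by (auto simp: power2_eq_square algebra_simps)
  also have "integral {0..T} \<dots> = integral {0..T} (\<lambda>s. (g s)\<^sup>2) - (2 * m) * integral {0..T} g + T * m\<^sup>2"
    using T by (subst Henstock_Kurzweil_Integration.integral_add Henstock_Kurzweil_Integration.integral_diff;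
        (intro integrable_continuous_real continuous_intros g)?)+ simp
  also have "\<dots> = integral {0..T} (\<lambda>s. (g s)\<^sup>2) - (integral {0..T} g)\<^sup>2 / T"
    using T by (simp add: m_def power2_eq_square field_simps)
  finally show ?thesis using T by (simp add: field_simps)
qed

text \<open>Gronwall is applied to \<open>z - g\<close>, so that the forcing enters through the
  integral of its norm, whose second moment is controlled by \<open>integral_square_le\<close>. With
  \<open>g = 0\<close> the bound says that a homogeneous equation has only the zero
  solution.\<close>

lemma linear_integral_equation_bound:
  fixes z g :: "real \<Rightarrow> 'b::euclidean_space" and L :: "real \<Rightarrow> 'b \<Rightarrow>\<^sub>L 'b"
  assumes z: "continuous_on {0..T} z" and g: "continuous_on {0..T} g" and L: "continuous_on {0..T} L"
    and C: "0 \<le> C" "\<And>t. t \<in> {0..T} \<Longrightarrow> norm (L t) \<le> C"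
    and eq: "\<And>t. t \<in> {0..T} \<Longrightarrow> z t = g t + integral {0..t} (\<lambda>s. L s (z s))" and t: "t \<in> {0..T}"
  shows "norm (z t - g t) \<le> C * integral {0..T} (\<lambda>s. norm (g s)) * exp (C * t)"
proof (rule gronwall[OF _ C(1) _ t])
  show "continuous_on {0..T} (\<lambda>t. norm (z t - g t))" by (intro continuous_intros z g)
  fix t assume t: "t \<in> {0..T}"
  have cont: "continuous_on {0..t} h" if "continuous_on {0..T} h" for h :: "real \<Rightarrow> 'c::real_normed_vector"
    using t by (intro continuous_on_subset[OF that]) auto
  have "norm (z t - g t) = norm (integral {0..t} (\<lambda>s. L s (z s)))" using eq[OF t] by simp
  also have "\<dots> \<le> integral {0..t} (\<lambda>s. C * norm (g s) + C * norm (z s - g s))"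
  proof (rule integral_norm_bound_integral)
    show "(\<lambda>s. L s (z s)) integrable_on {0..t}"
      by (intro integrable_continuous_real cont continuous_intros L z)
    show "(\<lambda>s. C * norm (g s) + C * norm (z s - g s)) integrable_on {0..t}"
      by (intro integrable_continuous_real cont continuous_intros g z)
    fix s assume "s \<in> {0..t}"
    then have "norm (L s) \<le> C" using C t by auto
    then have "norm (L s (z s)) \<le> C * norm (z s)" by (intro order_trans[OF norm_blinfun] mult_right_mono) auto
    also have "\<dots> \<le> C * (norm (g s) + norm (z s - g s))"
      using norm_triangle_ineq[of "g s" "z s - g s"] by (intro mult_left_mono C) simp
    finally show "norm (L s (z s)) \<le> C * norm (g s) + C * norm (z s - g s)" by (simp add: distrib_left)
  qed
  also have "\<dots> = C * integral {0..t} (\<lambda>s. norm (g s)) + C * integral {0..t} (\<lambda>s. norm (z s - g s))"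
    by (subst Henstock_Kurzweil_Integration.integral_add)
      (auto intro!: integrable_continuous_real cont continuous_intros g z)
  also have "integral {0..t} (\<lambda>s. norm (g s)) \<le> integral {0..T} (\<lambda>s. norm (g s))"
    using t by (intro integral_subset_le integrable_continuous_real cont continuous_intros g) auto
  finally show "norm (z t - g t) \<le> C * integral {0..T} (\<lambda>s. norm (g s)) + C * integral {0..t} (\<lambda>s. norm (z s - g s))"
    using C by (simp add: mult_left_mono)
qed

text \<open>A pathwise Gronwall estimate bounds \<open>norm (Z t)\<close> by the forcing and its
  time integral, which transfers the second moments from \<open>G\<close> to \<open>Z\<close>. Once
  moments exist, Fubini shows that the mean of \<open>Z\<close> solves the homogeneous
  equation.\<close>

lemma (in prob_space) linear_process_moments:
  fixes Z G :: "real \<Rightarrow> 'a \<Rightarrow> 'b::euclidean_space" and L :: "real \<Rightarrow> 'b \<Rightarrow>\<^sub>L 'b"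
  assumes T: "0 < T" and L: "continuous_on {0..T} L" and G: "l2_process M T G"
    and EG: "\<And>t. t \<in> {0..T} \<Longrightarrow> expectation (G t) = 0"
    and Z: "continuous_process M {0..T} Z"
    and eq: "AE \<omega> in M. \<forall>t\<in>{0..T}. Z t \<omega> = G t \<omega> + integral {0..t} (\<lambda>s. L s (Z s \<omega>))"
  shows "l2_process M T Z" "\<And>t. t \<in> {0..T} \<Longrightarrow> expectation (Z t) = 0"
proof -
  obtain B where B: "continuous_process M {0..T} G" "\<And>t. t \<in> {0..T} \<Longrightarrow> sq_integrable M (G t)"
    "\<And>t. t \<in> {0..T} \<Longrightarrow> expectation (\<lambda>\<omega>. (norm (G t \<omega>))\<^sup>2) \<le> B" "0 \<le> B" using l2_processE[OF G] by blast
  obtain C where C: "0 \<le> C" "\<And>t. t \<in> {0..T} \<Longrightarrow> norm (L t) \<le> C" using continuous_on_bounded_norm[OF L] by blast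
  define D where "D = C * exp (C * T)"
  define I where "I \<omega> = integral {0..T} (\<lambda>s. (norm (G s \<omega>))\<^sup>2)" for \<omega>
  have I: "integrable M I" "expectation I \<le> T * B"
  proof -
    have cp: "continuous_process M {0..T} (\<lambda>s \<omega>. (norm (G s \<omega>))\<^sup>2)"
      using B(1) unfolding continuous_process_def by (auto intro!: continuous_intros)
    note F = fubini_process[OF cp, of T B]
    show "integrable M I" unfolding I_def using T B by (intro F(1)) (auto simp: sq_integrable_def)
    have "expectation I = integral {0..T} (\<lambda>s. expectation (\<lambda>\<omega>. (norm (G s \<omega>))\<^sup>2))"
      unfolding I_def using T B by (intro F(3)) (auto simp: sq_integrable_def)
    also have "\<dots> \<le> integral {0..T} (\<lambda>s. B)"
      using T B by (intro integral_le F(2)) (auto simp: sq_integrable_def)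
    finally show "expectation I \<le> T * B" using T by simp
  qed
  have bound: "AE \<omega> in M. (norm (Z t \<omega>))\<^sup>2 \<le> 2 * (norm (G t \<omega>))\<^sup>2 + 2 * (D\<^sup>2 * (T * I \<omega>))" if t: "t \<in> {0..T}" for t
    using eq AE_space
  proof eventually_elim
    case (elim \<omega>)
    note Gc = continuous_process_path[OF B(1) elim(2)] and Zc = continuous_process_path[OF Z elim(2)]
    let ?J = "integral {0..T} (\<lambda>s. norm (G s \<omega>))"
    have J: "0 \<le> ?J" by (intro Henstock_Kurzweil_Integration.integral_nonneg integrable_continuous_real continuous_intros Gc) auto
    have "norm (Z t \<omega> - G t \<omega>) \<le> C * ?J * exp (C * t)"
      by (rule linear_integral_equation_bound[OF Zc Gc L C _ t]) (use elim in auto)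
    also have "\<dots> \<le> C * ?J * exp (C * T)" using t C J by (intro mult_left_mono) (auto intro!: mult_left_mono)
    finally have "norm (Z t \<omega> - G t \<omega>) \<le> D * ?J" by (simp add: D_def mult_ac)
    then have "(norm (Z t \<omega> - G t \<omega>))\<^sup>2 \<le> D\<^sup>2 * ?J\<^sup>2"
      using power_mono[of _ "D * ?J" 2] by (simp add: power_mult_distrib)
    also have "\<dots> \<le> D\<^sup>2 * (T * I \<omega>)"
      unfolding I_def by (intro mult_left_mono integral_square_le T continuous_intros Gc) auto
    finally show ?case using norm_add_square_le[of "G t \<omega>" "Z t \<omega> - G t \<omega>"] by simp
  qed
  have sq: "sq_integrable M (Z t)" if t: "t \<in> {0..T}" for t
    unfolding sq_integrable_def
  proof
    show Zm: "Z t \<in> borel_measurable M" by (rule continuous_process_measurable[OF Z t])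
    show "integrable M (\<lambda>\<omega>. (norm (Z t \<omega>))\<^sup>2)"
    proof (rule Bochner_Integration.integrable_bound)
      show "integrable M (\<lambda>\<omega>. 2 * (norm (G t \<omega>))\<^sup>2 + 2 * (D\<^sup>2 * (T * I \<omega>)))"
        using B(2)[OF t] I by (auto simp: sq_integrable_def)
      show "AE \<omega> in M. norm ((norm (Z t \<omega>))\<^sup>2) \<le> norm (2 * (norm (G t \<omega>))\<^sup>2 + 2 * (D\<^sup>2 * (T * I \<omega>)))"
        using bound[OF t] by eventually_elim (auto intro: order_trans[OF _ abs_ge_self])
    qed (use Zm in auto)
  qed
  have sqB: "expectation (\<lambda>\<omega>. (norm (Z t \<omega>))\<^sup>2) \<le> 2 * B + 2 * (D\<^sup>2 * (T * (T * B)))" if t: "t \<in> {0..T}" for t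
  proof -
    have "expectation (\<lambda>\<omega>. (norm (Z t \<omega>))\<^sup>2) \<le> expectation (\<lambda>\<omega>. 2 * (norm (G t \<omega>))\<^sup>2 + 2 * (D\<^sup>2 * (T * I \<omega>)))"
      using sq[OF t] B(2)[OF t] I bound[OF t] by (intro integral_mono_AE) (auto simp: sq_integrable_def)
    also have "\<dots> = 2 * expectation (\<lambda>\<omega>. (norm (G t \<omega>))\<^sup>2) + 2 * (D\<^sup>2 * (T * expectation I))"
      using B(2)[OF t] I by (simp add: sq_integrable_def)
    also have "\<dots> \<le> 2 * B + 2 * (D\<^sup>2 * (T * (T * B)))"
      using B(3)[OF t] I T by (intro add_mono mult_left_mono) auto
    finally show ?thesis .
  qed
  show Zl2: "l2_process M T Z" unfolding l2_process_def using Z sq sqB by blast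
  \<comment> \<open>The mean path. Its continuity is not assumed but read off from its own integral
    equation, after which the homogeneous bound forces it to be 0.\<close>
  define y where "y t = expectation (Z t)" for t
  note LZ = fubini_l2_process[OF l2_process_linear[OF Zl2 L]]
  have yint: "y integrable_on {0..T}" unfolding y_def using T by (intro fubini_l2_process[OF Zl2]) auto
  have ELZ: "expectation (\<lambda>\<omega>. L s (Z s \<omega>)) = L s (y s)" if "s \<in> {0..T}" for s
    unfolding y_def
    by (rule integral_bounded_linear[OF blinfun.bounded_linear_right sq_integrable_imp_integrable[OF sq[OF that]]])
  have Lint: "(\<lambda>s. L s (y s)) integrable_on {0..T}"
    using LZ(2)[of T] T by (subst integrable_cong[of _ _ "\<lambda>s. expectation (\<lambda>\<omega>. L s (Z s \<omega>))"]) (auto simp: ELZ)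
  have y: "y t = integral {0..t} (\<lambda>s. L s (y s))" if t: "t \<in> {0..T}" for t
  proof -
    have "y t = expectation (\<lambda>\<omega>. G t \<omega> + integral {0..t} (\<lambda>s. L s (Z s \<omega>)))"
      unfolding y_def
    proof (rule integral_cong_AE)
      show "AE \<omega> in M. Z t \<omega> = G t \<omega> + integral {0..t} (\<lambda>s. L s (Z s \<omega>))" using eq t by auto
    qed (use sq[OF t] B(2)[OF t] LZ(1)[OF t] in \<open>auto simp: sq_integrable_def\<close>)
    also have "\<dots> = integral {0..t} (\<lambda>s. expectation (\<lambda>\<omega>. L s (Z s \<omega>)))"
      using LZ(1,3)[OF t] sq_integrable_imp_integrable[OF B(2)[OF t]] EG[OF t] by simp
    also have "\<dots> = integral {0..t} (\<lambda>s. L s (y s))"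
      using t by (intro integral_cong) (auto simp: ELZ)
    finally show ?thesis .
  qed
  have ycont: "continuous_on {0..T} y"
    by (rule continuous_on_eq[OF indefinite_integral_continuous_1[OF Lint]]) (use y in auto)
  have "y t = 0" if t: "t \<in> {0..T}" for t
    using linear_integral_equation_bound[OF ycont continuous_on_const L C _ t, of 0] y by simp
  then show "\<And>t. t \<in> {0..T} \<Longrightarrow> expectation (Z t) = 0" by (simp add: y_def)
qed

text \<open>The cross term vanishes because the random part is centred.\<close>

lemma (in prob_space) quadratic_cost_split:
  fixes Z :: "real \<Rightarrow> 'a \<Rightarrow> real^'n" and q :: "real \<Rightarrow> real^'n^'n"
  assumes T: "0 < T" and Z: "l2_process M T Z" and EZ: "\<And>t. t \<in> {0..T} \<Longrightarrow> expectation (Z t) = 0"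
    and y: "continuous_on {0..T} y" and q: "continuous_on {0..T} q" and sym: "\<And>t. t \<in> {0..T} \<Longrightarrow> transpose (q t) = q t"
  shows "integrable M (\<lambda>\<omega>. integral {0..T} (\<lambda>t. (y t + Z t \<omega>) \<bullet> (q t *v (y t + Z t \<omega>))))"
    "expectation (\<lambda>\<omega>. integral {0..T} (\<lambda>t. (y t + Z t \<omega>) \<bullet> (q t *v (y t + Z t \<omega>))))
      = integral {0..T} (\<lambda>t. y t \<bullet> (q t *v y t)) + expectation (\<lambda>\<omega>. integral {0..T} (\<lambda>t. Z t \<omega> \<bullet> (q t *v Z t \<omega>)))"
proof -
  obtain B where B: "continuous_process M {0..T} Z" "\<And>t. t \<in> {0..T} \<Longrightarrow> sq_integrable M (Z t)"
    "\<And>t. t \<in> {0..T} \<Longrightarrow> expectation (\<lambda>\<omega>. (norm (Z t \<omega>))\<^sup>2) \<le> B" "0 \<le> B" using l2_processE[OF Z] by blast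
  obtain C where C: "0 \<le> C" "\<And>t. t \<in> {0..T} \<Longrightarrow> norm (mv (q t)) \<le> C"
    using continuous_on_bounded_norm[OF continuous_on_mv[OF q]] by blast
  have qy: "continuous_on {0..T} (\<lambda>t. q t *v y t)" by (rule continuous_on_matrix_vector[OF q y])
  \<comment> \<open>Symmetry of \<open>q\<close> merges both mixed terms into twice one of them. As
    a bounded linear functional of \<open>Z\<close> it is again a process of the class to which
    Fubini applies.\<close>
  define a where "a = (\<lambda>t. blinfun_inner_left (2 *\<^sub>R (q t *v y t)))"
  have a: "continuous_on {0..T} a"
    unfolding a_def by (intro bounded_linear.continuous_on[OF bounded_linear_blinfun_inner_left] continuous_intros qy)
  have a_apply: "blinfun_apply (a t) x = 2 * ((q t *v y t) \<bullet> x)" for t x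
    by (simp add: a_def inner_commute)
  have lin: "integrable M (\<lambda>\<omega>. integral {0..T} (\<lambda>t. a t (Z t \<omega>)))"
    "expectation (\<lambda>\<omega>. integral {0..T} (\<lambda>t. a t (Z t \<omega>))) = 0"
  proof -
    note f = fubini_l2_process[OF l2_process_linear[OF Z a], of T]
    show "integrable M (\<lambda>\<omega>. integral {0..T} (\<lambda>t. a t (Z t \<omega>)))" using f T by auto
    have "expectation (\<lambda>\<omega>. a t (Z t \<omega>)) = 0" if "t \<in> {0..T}" for t
      by (rule mean_zero_linear[OF sq_integrable_imp_integrable[OF B(2)[OF that]] EZ[OF that] blinfun.bounded_linear_right])
    then have "integral {0..T} (\<lambda>t. expectation (\<lambda>\<omega>. a t (Z t \<omega>))) = integral {0..T} (\<lambda>t. 0)"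
      by (intro integral_cong) auto
    then show "expectation (\<lambda>\<omega>. integral {0..T} (\<lambda>t. a t (Z t \<omega>))) = 0" using f T by auto
  qed
  have qZ: "continuous_on {0..T} (\<lambda>t. q t *v Z t \<omega>)" if "\<omega> \<in> space M" for \<omega>
    by (rule continuous_on_matrix_vector[OF q continuous_process_path[OF B(1) that]])
  have quad: "integrable M (\<lambda>\<omega>. integral {0..T} (\<lambda>t. Z t \<omega> \<bullet> (q t *v Z t \<omega>)))"
  proof (rule fubini_process)
    have meas: "(\<lambda>\<omega>. Z t \<omega> \<bullet> (q t *v Z t \<omega>)) \<in> borel_measurable M" if t: "t \<in> {0..T}" for t
    proof -
      have "(\<lambda>x. x \<bullet> (q t *v x)) \<in> borel_measurable borel"
        by (intro borel_measurable_continuous_onI continuous_intros linear_continuous_on) simp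
      then show ?thesis by (rule measurable_compose[OF continuous_process_measurable[OF B(1) t]])
    qed
    show "continuous_process M {0..T} (\<lambda>t \<omega>. Z t \<omega> \<bullet> (q t *v Z t \<omega>))"
      unfolding continuous_process_def
      by (intro conjI ballI meas continuous_intros qZ continuous_process_path[OF B(1)])
    show "T \<in> {0..T}" using T by simp
    fix t assume t: "t \<in> {0..T}"
    have le: "norm (Z t \<omega> \<bullet> (q t *v Z t \<omega>)) \<le> C * (norm (Z t \<omega>))\<^sup>2" for \<omega>
    proof -
      have "norm (Z t \<omega> \<bullet> (q t *v Z t \<omega>)) \<le> norm (Z t \<omega>) * norm (mv (q t) (Z t \<omega>))"
        using Cauchy_Schwarz_ineq2[of "Z t \<omega>" "q t *v Z t \<omega>"] by simp
      also have "\<dots> \<le> norm (Z t \<omega>) * (C * norm (Z t \<omega>))"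
        by (intro mult_left_mono order_trans[OF norm_blinfun] mult_right_mono C t norm_ge_zero)
      finally show ?thesis by (simp add: power2_eq_square mult_ac)
    qed
    have int2: "integrable M (\<lambda>\<omega>. C * (norm (Z t \<omega>))\<^sup>2)" using B(2)[OF t] by (simp add: sq_integrable_def)
    show int: "integrable M (\<lambda>\<omega>. Z t \<omega> \<bullet> (q t *v Z t \<omega>))"
      by (rule Bochner_Integration.integrable_bound[OF int2 meas[OF t]])
        (use le in \<open>auto intro: order_trans[OF _ abs_ge_self]\<close>)
    have "expectation (\<lambda>\<omega>. norm (Z t \<omega> \<bullet> (q t *v Z t \<omega>))) \<le> expectation (\<lambda>\<omega>. C * (norm (Z t \<omega>))\<^sup>2)"
      by (intro integral_mono integrable_norm int int2 le)
    also have "\<dots> \<le> C * B" using B(3)[OF t] C by (simp add: mult_left_mono)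
    finally show "expectation (\<lambda>\<omega>. norm (Z t \<omega> \<bullet> (q t *v Z t \<omega>))) \<le> C * B" .
  qed
  have split: "integral {0..T} (\<lambda>t. (y t + Z t \<omega>) \<bullet> (q t *v (y t + Z t \<omega>)))
      = integral {0..T} (\<lambda>t. y t \<bullet> (q t *v y t)) + integral {0..T} (\<lambda>t. a t (Z t \<omega>))
        + integral {0..T} (\<lambda>t. Z t \<omega> \<bullet> (q t *v Z t \<omega>))" if \<omega>: "\<omega> \<in> space M" for \<omega>
  proof -
    note Zc = continuous_process_path[OF B(1) \<omega>]
    have "(y t + Z t \<omega>) \<bullet> (q t *v (y t + Z t \<omega>)) = (y t \<bullet> (q t *v y t) + a t (Z t \<omega>)) + Z t \<omega> \<bullet> (q t *v Z t \<omega>)"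
      if "t \<in> {0..T}" for t
    proof -
      have "y t \<bullet> (q t *v Z t \<omega>) = (q t *v y t) \<bullet> Z t \<omega>"
        using dot_lmul_matrix[of "y t" "q t" "Z t \<omega>"] sym[OF that] by (metis transpose_matrix_vector)
      then show ?thesis by (simp add: a_apply inner_simps matrix_vector_right_distrib inner_commute)
    qed
    then have "integral {0..T} (\<lambda>t. (y t + Z t \<omega>) \<bullet> (q t *v (y t + Z t \<omega>)))
        = integral {0..T} (\<lambda>t. (y t \<bullet> (q t *v y t) + a t (Z t \<omega>)) + Z t \<omega> \<bullet> (q t *v Z t \<omega>))"
      by (intro integral_cong) auto
    also have "\<dots> = integral {0..T} (\<lambda>t. y t \<bullet> (q t *v y t)) + integral {0..T} (\<lambda>t. a t (Z t \<omega>))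
        + integral {0..T} (\<lambda>t. Z t \<omega> \<bullet> (q t *v Z t \<omega>))"
      by (subst Henstock_Kurzweil_Integration.integral_add;
          (intro integrable_continuous_real continuous_intros y qy a Zc qZ \<omega>)?)+ simp
    finally show ?thesis .
  qed
  have "integrable M (\<lambda>\<omega>. integral {0..T} (\<lambda>t. y t \<bullet> (q t *v y t)) + integral {0..T} (\<lambda>t. a t (Z t \<omega>))
        + integral {0..T} (\<lambda>t. Z t \<omega> \<bullet> (q t *v Z t \<omega>)))"
    using lin quad by auto
  then show "integrable M (\<lambda>\<omega>. integral {0..T} (\<lambda>t. (y t + Z t \<omega>) \<bullet> (q t *v (y t + Z t \<omega>))))"
    using split by (simp cong: Bochner_Integration.integrable_cong)
  have "expectation (\<lambda>\<omega>. integral {0..T} (\<lambda>t. (y t + Z t \<omega>) \<bullet> (q t *v (y t + Z t \<omega>))))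
      = expectation (\<lambda>\<omega>. integral {0..T} (\<lambda>t. y t \<bullet> (q t *v y t)) + integral {0..T} (\<lambda>t. a t (Z t \<omega>))
        + integral {0..T} (\<lambda>t. Z t \<omega> \<bullet> (q t *v Z t \<omega>)))"
    using split by (intro Bochner_Integration.integral_cong) auto
  also have "\<dots> = integral {0..T} (\<lambda>t. y t \<bullet> (q t *v y t)) + expectation (\<lambda>\<omega>. integral {0..T} (\<lambda>t. Z t \<omega> \<bullet> (q t *v Z t \<omega>)))"
    using lin quad by (simp add: prob_space)
  finally show "expectation (\<lambda>\<omega>. integral {0..T} (\<lambda>t. (y t + Z t \<omega>) \<bullet> (q t *v (y t + Z t \<omega>))))
      = integral {0..T} (\<lambda>t. y t \<bullet> (q t *v y t)) + expectation (\<lambda>\<omega>. integral {0..T} (\<lambda>t. Z t \<omega> \<bullet> (q t *v Z t \<omega>)))" .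
qed

text \<open>The null set in the hypothesis depends on the time. Countably many times, dense in
  \<open>{0..T}\<close>, share one null set, and continuity of the paths reaches the others.\<close>

lemma AE_paths_eq:
  fixes X Y :: "real \<Rightarrow> 'w \<Rightarrow> 'b::euclidean_space"
  assumes X: "\<And>\<omega>. \<omega> \<in> space M \<Longrightarrow> continuous_on {0..T} (\<lambda>t. X t \<omega>)"
    and Y: "\<And>\<omega>. \<omega> \<in> space M \<Longrightarrow> continuous_on {0..T} (\<lambda>t. Y t \<omega>)"
    and eq: "\<And>t. t \<in> {0..T} \<Longrightarrow> AE \<omega> in M. X t \<omega> = Y t \<omega>"
  shows "AE \<omega> in M. \<forall>t\<in>{0..T}. X t \<omega> = Y t \<omega>"
proof -
  obtain D where D: "countable D" "D \<subseteq> {0..T}" "{0..T} \<subseteq> closure D" using separable by metis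
  have "AE \<omega> in M. \<forall>t\<in>D. X t \<omega> = Y t \<omega>" using D eq by (subst AE_ball_countable) auto
  then show ?thesis
    using AE_space
  proof eventually_elim
    case (elim \<omega>)
    have "X t \<omega> - Y t \<omega> = 0" if "t \<in> {0..T}" for t
    proof (rule continuous_constant_on_closure[where S = D and f = "\<lambda>t. X t \<omega> - Y t \<omega>"])
      show "continuous_on (closure D) (\<lambda>t. X t \<omega> - Y t \<omega>)"
        by (intro continuous_on_subset[OF continuous_on_diff[OF X Y]] closure_minimal D elim) auto
    qed (use that D elim in auto)
    then show ?case by simp
  qed
qed

section \<open>Conditional expectations and null sets\<close>

text \<open>The completion of \<open>F\<close> inside \<open>M\<close> by almost everywhere
  equality. Observation processes that agree only off a null set may generate different
  sigma-algebras, but their hulls coincide.\<close>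

definition ae_hull :: "'w measure \<Rightarrow> 'w measure \<Rightarrow> 'w measure" where
  "ae_hull M F = sigma (space M) {A \<in> sets M. \<exists>A'\<in>sets F. AE \<omega> in M. \<omega> \<in> A \<longleftrightarrow> \<omega> \<in> A'}"

lemma sets_ae_hull:
  assumes F: "subalgebra M F"
  shows "sets (ae_hull M F) = {A \<in> sets M. \<exists>A'\<in>sets F. AE \<omega> in M. \<omega> \<in> A \<longleftrightarrow> \<omega> \<in> A'}" (is "_ = ?S")
proof -
  have sp: "space F = space M" "sets F \<subseteq> sets M" using F by (auto simp: subalgebra_def)
  have "sigma_algebra (space M) ?S"
    unfolding sigma_algebra_iff2
  proof (intro conjI ballI allI impI)
    show "?S \<subseteq> Pow (space M)" using sets.sets_into_space by auto
    show "{} \<in> ?S" by auto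
    fix A assume "A \<in> ?S"
    then obtain A' where A: "A \<in> sets M" "A' \<in> sets F" "AE \<omega> in M. \<omega> \<in> A \<longleftrightarrow> \<omega> \<in> A'" by auto
    have "space M - A' \<in> sets F" using A sp sets.compl_sets by metis
    moreover have "AE \<omega> in M. \<omega> \<in> space M - A \<longleftrightarrow> \<omega> \<in> space M - A'" using A(3) by eventually_elim auto
    ultimately show "space M - A \<in> ?S" using sets.compl_sets[OF A(1)] by blast
  next
    fix A :: "nat \<Rightarrow> _" assume "range A \<subseteq> ?S"
    then have "\<forall>i. \<exists>A'. A' \<in> sets F \<and> (AE \<omega> in M. \<omega> \<in> A i \<longleftrightarrow> \<omega> \<in> A')" and As: "range A \<subseteq> sets M" by blast+
    then obtain A' where A': "\<And>i. A' i \<in> sets F" "\<And>i. AE \<omega> in M. \<omega> \<in> A i \<longleftrightarrow> \<omega> \<in> A' i" by metis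
    have "AE \<omega> in M. \<forall>i. \<omega> \<in> A i \<longleftrightarrow> \<omega> \<in> A' i" using A'(2) by (simp add: AE_all_countable)
    then have "AE \<omega> in M. \<omega> \<in> (\<Union>i. A i) \<longleftrightarrow> \<omega> \<in> (\<Union>i. A' i)" by eventually_elim auto
    moreover have "(\<Union>i. A' i) \<in> sets F" using A'(1) by auto
    ultimately show "(\<Union>i. A i) \<in> ?S"
      using As by (intro CollectI conjI bexI[of _ "\<Union>i. A' i"]) auto
  qed
  then show ?thesis unfolding ae_hull_def by (simp add: sigma_algebra.sets_measure_of_eq)
qed

lemma space_ae_hull [simp]: "space (ae_hull M F) = space M"
  by (simp add: ae_hull_def space_measure_of_conv)

lemma subalgebra_ae_hull: assumes "subalgebra M F" shows "subalgebra M (ae_hull M F)"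
  using sets_ae_hull[OF assms] by (auto simp: subalgebra_def)

lemma (in prob_space) sigma_finite_subalgebraI: "subalgebra M F \<Longrightarrow> sigma_finite_subalgebra M F"
  by (rule finite_measure_subalgebra_is_sigma_finite)
    (simp add: finite_measure_subalgebra_def finite_measure_subalgebra_axioms_def finite_measure_axioms)

text \<open>A set of the hull and its partner in \<open>F\<close> give the same integrals, so the
  conditional expectation given \<open>F\<close> already satisfies the defining property for the
  hull.\<close>

lemma (in prob_space) real_cond_exp_ae_hull:
  assumes F: "subalgebra M F" and X: "integrable M X"
  shows "AE \<omega> in M. real_cond_exp M (ae_hull M F) X \<omega> = real_cond_exp M F X \<omega>"
proof -
  interpret F: sigma_finite_subalgebra M F by (rule sigma_finite_subalgebraI[OF F])
  interpret H: sigma_finite_subalgebra M "ae_hull M F" by (rule sigma_finite_subalgebraI[OF subalgebra_ae_hull[OF F]])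
  have sp: "space F = space M" "sets F \<subseteq> sets M" using F by (auto simp: subalgebra_def)
  have int: "integrable M (real_cond_exp M F X)" by (rule F.real_cond_exp_int[OF X])
  show ?thesis
  proof (rule H.real_cond_exp_charact[OF _ X int])
    fix A assume "A \<in> sets (ae_hull M F)"
    then obtain A' where A: "A \<in> sets M" "A' \<in> sets F" "AE \<omega> in M. \<omega> \<in> A \<longleftrightarrow> \<omega> \<in> A'"
      by (auto simp: sets_ae_hull[OF F])
    have [measurable]: "A \<in> sets M" "A' \<in> sets M" using A sp by auto
    have eq: "(\<integral>\<omega>\<in>A. f \<omega> \<partial>M) = (\<integral>\<omega>\<in>A'. f \<omega> \<partial>M)" if [measurable]: "f \<in> borel_measurable M" for f :: "'a \<Rightarrow> real"
      unfolding set_lebesgue_integral_def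
      by (rule integral_cong_AE) (use A(3) in \<open>auto simp: indicator_def elim!: eventually_mono\<close>)
    show "(\<integral>\<omega>\<in>A. X \<omega> \<partial>M) = (\<integral>\<omega>\<in>A. real_cond_exp M F X \<omega> \<partial>M)"
      using X int by (simp add: eq F.real_cond_exp_intA[OF X A(2)])
  next
    have "sets F \<subseteq> sets (ae_hull M F)" using sp by (auto simp: sets_ae_hull[OF F])
    then show "real_cond_exp M F X \<in> borel_measurable (ae_hull M F)"
      using sp by (intro measurable_from_subalg[OF _ borel_measurable_cond_exp]) (simp add: subalgebra_def)
  qed
qed

text \<open>Translates of Borel sets are Borel, so each generating event of \<open>Z\<close> agrees
  almost everywhere with one of \<open>Z'\<close>. The reverse inclusion is the same statement with
  \<open>- c\<close>.\<close>

lemma (in prob_space) ae_hull_process_subset: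
  fixes Z Z' :: "real \<Rightarrow> 'a \<Rightarrow> 'b::euclidean_space"
  assumes Z: "\<And>s. s \<in> I \<Longrightarrow> Z s \<in> borel_measurable M" and Z': "\<And>s. s \<in> I \<Longrightarrow> Z' s \<in> borel_measurable M"
    and eq: "AE \<omega> in M. \<forall>s\<in>I. Z s \<omega> = Z' s \<omega> + c s"
  shows "sets (ae_hull M (process_sigma M I Z)) \<subseteq> sets (ae_hull M (process_sigma M I Z'))"
proof -
  have sub: "subalgebra M (process_sigma M I Z)" by (rule subalgebra_process_sigma[OF Z])
  have sub': "subalgebra M (process_sigma M I Z')" by (rule subalgebra_process_sigma[OF Z'])
  have "sigma_sets (space (ae_hull M (process_sigma M I Z'))) (\<Union>s\<in>I. {Z s -` E \<inter> space M |E. E \<in> sets borel})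
      \<subseteq> sets (ae_hull M (process_sigma M I Z'))"
  proof (rule sets.sigma_sets_subset)
    show "(\<Union>s\<in>I. {Z s -` E \<inter> space M |E. E \<in> sets borel}) \<subseteq> sets (ae_hull M (process_sigma M I Z'))"
    proof clarify
      fix s and E :: "'b set" assume s: "s \<in> I" and E: "E \<in> sets borel"
      have E': "(\<lambda>x. x + c s) -` E \<in> sets borel"
        by (rule measurable_sets_borel[OF _ E]) simp
      have "Z' s -` ((\<lambda>x. x + c s) -` E) \<inter> space M \<in> sets (process_sigma M I Z')"
        using measurable_sets[OF process_sigma_measurable[OF s] E'] by simp
      moreover have "AE \<omega> in M. \<omega> \<in> Z s -` E \<inter> space M \<longleftrightarrow> \<omega> \<in> Z' s -` ((\<lambda>x. x + c s) -` E) \<inter> space M"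
        using eq by eventually_elim (use s in auto)
      ultimately show "Z s -` E \<inter> space M \<in> sets (ae_hull M (process_sigma M I Z'))"
        unfolding sets_ae_hull[OF sub'] using measurable_sets[OF Z[OF s] E]
        by (intro CollectI conjI bexI[of _ "Z' s -` ((\<lambda>x. x + c s) -` E) \<inter> space M"])
    qed
  qed
  then have "sets (process_sigma M I Z) \<subseteq> sets (ae_hull M (process_sigma M I Z'))"
    by (simp add: sets_process_sigma)
  then show ?thesis
    unfolding sets_ae_hull[OF sub] sets_ae_hull[OF sub'] by (fastforce elim: eventually_elim2)
qed

text \<open>Each process is a deterministic translate of the other, so both generate the same hull,
  and conditioning on either amounts to conditioning on that hull.\<close>

lemma (in prob_space) real_cond_exp_process_shift:
  fixes Z Z' :: "real \<Rightarrow> 'a \<Rightarrow> 'b::euclidean_space"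
  assumes Z: "\<And>s. s \<in> I \<Longrightarrow> Z s \<in> borel_measurable M" and Z': "\<And>s. s \<in> I \<Longrightarrow> Z' s \<in> borel_measurable M"
    and eq: "AE \<omega> in M. \<forall>s\<in>I. Z s \<omega> = Z' s \<omega> + c s" and X: "integrable M X"
  shows "AE \<omega> in M. real_cond_exp M (process_sigma M I Z) X \<omega> = real_cond_exp M (process_sigma M I Z') X \<omega>"
proof -
  have sub: "subalgebra M (process_sigma M I Z)" by (rule subalgebra_process_sigma[OF Z])
  have sub': "subalgebra M (process_sigma M I Z')" by (rule subalgebra_process_sigma[OF Z'])
  have eq': "AE \<omega> in M. \<forall>s\<in>I. Z' s \<omega> = Z s \<omega> + - c s" using eq by eventually_elim auto
  have "sets (ae_hull M (process_sigma M I Z)) = sets (ae_hull M (process_sigma M I Z'))"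
    using ae_hull_process_subset[OF Z Z' eq] ae_hull_process_subset[OF Z' Z eq'] by blast
  then have "{A \<in> sets M. \<exists>A'\<in>sets (process_sigma M I Z). AE \<omega> in M. \<omega> \<in> A \<longleftrightarrow> \<omega> \<in> A'}
      = {A \<in> sets M. \<exists>A'\<in>sets (process_sigma M I Z'). AE \<omega> in M. \<omega> \<in> A \<longleftrightarrow> \<omega> \<in> A'}"
    by (simp only: sets_ae_hull[OF sub] sets_ae_hull[OF sub'])
  then have hull: "ae_hull M (process_sigma M I Z) = ae_hull M (process_sigma M I Z')"
    by (simp only: ae_hull_def)
  show ?thesis
    using real_cond_exp_ae_hull[OF sub X] real_cond_exp_ae_hull[OF sub' X] unfolding hull
    by eventually_elim simp
qed

section \<open>Block operators\<close>

lemmas matrix_mult_linear =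
  bounded_bilinear.add_left[OF bounded_bilinear_matrix_mult] bounded_bilinear.add_right[OF bounded_bilinear_matrix_mult]
  bounded_bilinear.diff_left[OF bounded_bilinear_matrix_mult] bounded_bilinear.diff_right[OF bounded_bilinear_matrix_mult]
  bounded_bilinear.minus_left[OF bounded_bilinear_matrix_mult] bounded_bilinear.minus_right[OF bounded_bilinear_matrix_mult]
  bounded_bilinear.zero_left[OF bounded_bilinear_matrix_mult] bounded_bilinear.zero_right[OF bounded_bilinear_matrix_mult]
  bounded_bilinear.scaleR_left[OF bounded_bilinear_matrix_mult] bounded_bilinear.scaleR_right[OF bounded_bilinear_matrix_mult]

lemmas matrix_vector_linear =
  bounded_bilinear.add_left[OF bounded_bilinear_matrix_vector] bounded_bilinear.add_right[OF bounded_bilinear_matrix_vector]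
  bounded_bilinear.diff_left[OF bounded_bilinear_matrix_vector] bounded_bilinear.diff_right[OF bounded_bilinear_matrix_vector]
  bounded_bilinear.minus_left[OF bounded_bilinear_matrix_vector] bounded_bilinear.minus_right[OF bounded_bilinear_matrix_vector]
  bounded_bilinear.zero_left[OF bounded_bilinear_matrix_vector] bounded_bilinear.zero_right[OF bounded_bilinear_matrix_vector]
  bounded_bilinear.scaleR_left[OF bounded_bilinear_matrix_vector] bounded_bilinear.scaleR_right[OF bounded_bilinear_matrix_vector]

lemmas transpose_linear =
  linear_add[OF bounded_linear.linear[OF bounded_linear_transpose]] linear_diff[OF bounded_linear.linear[OF bounded_linear_transpose]]
  linear_neg[OF bounded_linear.linear[OF bounded_linear_transpose]] linear_0[OF bounded_linear.linear[OF bounded_linear_transpose]]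
  linear_scale[OF bounded_linear.linear[OF bounded_linear_transpose]]

type_synonym 'n state_pair = "(real^'n) \<times> (real^'n)"

text \<open>A \<open>2d x 2d\<close> matrix as an operator on pairs: \<open>norm\<close> is then the
  operator norm for the Euclidean norm of the pair, and the abstract Riccati results apply
  directly.\<close>

definition blk :: "real^'n^'n \<Rightarrow> real^'n^'n \<Rightarrow> real^'n^'n \<Rightarrow> real^'n^'n \<Rightarrow> 'n state_pair \<Rightarrow>\<^sub>L 'n state_pair" where
  "blk A B C D = Blinfun (\<lambda>z. (A *v fst z + B *v snd z, C *v fst z + D *v snd z))"

lemma blk_apply: "blinfun_apply (blk A B C D) z = (A *v fst z + B *v snd z, C *v fst z + D *v snd z)"
  unfolding blk_def
  by (subst bounded_linear_Blinfun_apply)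
    (auto intro!: bounded_linear_Pair bounded_linear_add bounded_linear_compose[OF matrix_vector_mul_bounded_linear]
      bounded_linear_fst bounded_linear_snd)

lemma blk_linear:
  "blk A B C D + blk A' B' C' D' = blk (A + A') (B + B') (C + C') (D + D')"
  "blk A B C D - blk A' B' C' D' = blk (A - A') (B - B') (C - C') (D - D')"
  "- blk A B C D = blk (- A) (- B) (- C) (- D)"
  "c *\<^sub>R blk A B C D = blk (c *\<^sub>R A) (c *\<^sub>R B) (c *\<^sub>R C) (c *\<^sub>R D)"
  "blk 0 0 0 0 = 0"
  by (rule blinfun_eqI; simp add: blinfun.bilinear_simps blk_apply matrix_vector_linear zero_prod_def algebra_simps)+

lemma blk_compose:
  "blk A B C D o\<^sub>L blk A' B' C' D' = blk (A ** A' + B ** C') (A ** B' + B ** D') (C ** A' + D ** C') (C ** B' + D ** D')"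
  by (rule blinfun_eqI) (simp add: blk_apply matrix_vector_linear matrix_vector_mul_assoc algebra_simps)

lemma bounded_linear_blk: "bounded_linear (\<lambda>(A, B, C, D). blk A B C D)"
  unfolding linear_conv_bounded_linear[symmetric]
  by (rule linearI) (auto simp: blk_linear)

lemma blk_has_vector_derivative:
  assumes "(A has_vector_derivative A') (at t within S)" "(B has_vector_derivative B') (at t within S)"
    "(C has_vector_derivative C') (at t within S)" "(D has_vector_derivative D') (at t within S)"
  shows "((\<lambda>t. blk (A t) (B t) (C t) (D t)) has_vector_derivative blk A' B' C' D') (at t within S)"
  using bounded_linear.has_vector_derivative[OF bounded_linear_blk has_vector_derivative_Pair[OF assms(1)
        has_vector_derivative_Pair[OF assms(2) has_vector_derivative_Pair[OF assms(3,4)]]]] by simp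

lemma continuous_on_blk:
  assumes "continuous_on S A" "continuous_on S B" "continuous_on S C" "continuous_on S D"
  shows "continuous_on S (\<lambda>t. blk (A t) (B t) (C t) (D t))"
  using bounded_linear.continuous_on[OF bounded_linear_blk continuous_on_Pair[OF assms(1)
        continuous_on_Pair[OF assms(2) continuous_on_Pair[OF assms(3,4)]]]] by simp

lemma bounded_linear_vec_lambda:
  fixes f :: "'n::finite \<Rightarrow> 'a::real_normed_vector \<Rightarrow> 'b::real_normed_vector"
  assumes "\<And>i. bounded_linear (f i)" shows "bounded_linear (\<lambda>x. \<chi> i. f i x)"
proof -
  have "\<forall>i. \<exists>K. \<forall>x. norm (f i x) \<le> norm x * K" using bounded_linear.bounded[OF assms] by blast
  then obtain K where K: "\<And>i x. norm (f i x) \<le> norm x * K i" by metis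
  show ?thesis
  proof (rule bounded_linear_intro)
    fix x
    have "norm (\<chi> i. f i x) \<le> (\<Sum>i\<in>UNIV. norm (f i x))"
      unfolding norm_vec_def by (rule order_trans[OF L2_set_le_sum]) auto
    also have "\<dots> \<le> norm x * (\<Sum>i\<in>UNIV. K i)" unfolding sum_distrib_left by (intro sum_mono K)
    finally show "norm (\<chi> i. f i x) \<le> norm x * (\<Sum>i\<in>UNIV. K i)" .
  qed (simp_all add: vec_eq_iff linear_simps[OF assms])
qed

definition blk11 :: "('n state_pair \<Rightarrow>\<^sub>L 'n state_pair) \<Rightarrow> real^'n^'n" where
  "blk11 X = (\<chi> i j. fst (blinfun_apply X (axis j 1, 0)) $ i)"
definition blk12 :: "('n state_pair \<Rightarrow>\<^sub>L 'n state_pair) \<Rightarrow> real^'n^'n" where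
  "blk12 X = (\<chi> i j. fst (blinfun_apply X (0, axis j 1)) $ i)"
definition blk21 :: "('n state_pair \<Rightarrow>\<^sub>L 'n state_pair) \<Rightarrow> real^'n^'n" where
  "blk21 X = (\<chi> i j. snd (blinfun_apply X (axis j 1, 0)) $ i)"
definition blk22 :: "('n state_pair \<Rightarrow>\<^sub>L 'n state_pair) \<Rightarrow> real^'n^'n" where
  "blk22 X = (\<chi> i j. snd (blinfun_apply X (0, axis j 1)) $ i)"

lemma bounded_linear_blocks:
  "bounded_linear blk11" "bounded_linear blk12" "bounded_linear blk21" "bounded_linear blk22"
  unfolding blk11_def[abs_def] blk12_def[abs_def] blk21_def[abs_def] blk22_def[abs_def]
  by (intro bounded_linear_vec_lambda bounded_linear_compose[OF bounded_linear_vec_nth]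
      bounded_linear_compose[OF bounded_linear_fst] bounded_linear_compose[OF bounded_linear_snd]
      blinfun.bounded_linear_left)+

lemma matrix_vector_axis: "(A *v axis j 1) $ i = (A :: real^'n^'m) $ i $ j"
  by (simp add: matrix_vector_mult_def axis_def if_distrib cong: if_cong)

lemma blocks_blk [simp]:
  "blk11 (blk A B C D) = A" "blk12 (blk A B C D) = B" "blk21 (blk A B C D) = C" "blk22 (blk A B C D) = D"
  by (simp_all add: blk11_def blk12_def blk21_def blk22_def blk_apply matrix_vector_linear matrix_vector_axis vec_eq_iff)

text \<open>In finite dimension every bounded operator has block form. This turns the operator
  solution of the abstract Riccati equation back into four matrix functions.\<close>

lemma blk_blocks: "blk (blk11 X) (blk12 X) (blk21 X) (blk22 X) = X"
proof (rule blinfun_eqI)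
  fix z :: "(real^'a) \<times> (real^'a)"
  obtain x y where z: "z = (x, y)" by (cases z)
  have mat: "(\<chi> i j. (f (axis j 1)) $ i) *v x = f x" if "linear f" for f :: "real^'a \<Rightarrow> real^'a" and x
    using fun_cong[OF matrix_vector_mul(2)[OF that], of x] by (simp add: matrix_def)
  have lin1: "linear (\<lambda>x. g (blinfun_apply X (x, 0)))" and lin2: "linear (\<lambda>x. g (blinfun_apply X (0, x)))"
    if "bounded_linear g" for g :: "(real^'a) \<times> (real^'a) \<Rightarrow> real^'a"
    by (intro bounded_linear.linear bounded_linear_compose[OF that] bounded_linear_compose[OF blinfun.bounded_linear_right]
        bounded_linear_Pair bounded_linear_ident bounded_linear_zero)+
  have "blinfun_apply X (x, y) = blinfun_apply X (x, 0) + blinfun_apply X (0, y)"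
    unfolding blinfun.add_right[symmetric] by simp
  then show "blinfun_apply (blk (blk11 X) (blk12 X) (blk21 X) (blk22 X)) z = blinfun_apply X z"
    using mat[OF lin1[OF bounded_linear_fst], of x] mat[OF lin1[OF bounded_linear_snd], of x]
      mat[OF lin2[OF bounded_linear_fst], of y] mat[OF lin2[OF bounded_linear_snd], of y]
    by (simp add: z blk_apply blk11_def blk12_def blk21_def blk22_def prod_eq_iff)
qed

lemma blk_inject: "blk A B C D = blk A' B' C' D' \<longleftrightarrow> A = A' \<and> B = B' \<and> C = C' \<and> D = D'"
  by (metis blocks_blk)

lemma blk_eq_zero: "blk A B C D = 0 \<longleftrightarrow> A = 0 \<and> B = 0 \<and> C = 0 \<and> D = 0"
  unfolding blk_linear(5)[symmetric] by (rule blk_inject)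

lemma blk_has_vector_derivative_iff:
  "((\<lambda>t. blk (A t) (B t) (C t) (D t)) has_vector_derivative blk A' B' C' D') (at s within S) \<longleftrightarrow>
   (A has_vector_derivative A') (at s within S) \<and> (B has_vector_derivative B') (at s within S) \<and>
   (C has_vector_derivative C') (at s within S) \<and> (D has_vector_derivative D') (at s within S)" (is "?L \<longleftrightarrow> ?R")
proof
  assume L: ?L
  show ?R
    using bounded_linear.has_vector_derivative[OF bounded_linear_blocks(1) L]
      bounded_linear.has_vector_derivative[OF bounded_linear_blocks(2) L]
      bounded_linear.has_vector_derivative[OF bounded_linear_blocks(3) L]
      bounded_linear.has_vector_derivative[OF bounded_linear_blocks(4) L] by simp
qed (auto intro: blk_has_vector_derivative)

lemma Pair_has_vector_derivative_iff:
  "((\<lambda>t. (x t, y t)) has_vector_derivative (x', y')) (at s within S) \<longleftrightarrow> (x has_vector_derivative x') (at s within S) \<and> (y has_vector_derivative y') (at s within S)"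
proof
  assume L: "((\<lambda>t. (x t, y t)) has_vector_derivative (x', y')) (at s within S)"
  show "(x has_vector_derivative x') (at s within S) \<and> (y has_vector_derivative y') (at s within S)"
    using bounded_linear.has_vector_derivative[OF bounded_linear_fst L]
      bounded_linear.has_vector_derivative[OF bounded_linear_snd L] by simp
qed (rule has_vector_derivative_Pair; blast)

section \<open>Adjoints and operator norms of block operators\<close>

lemma inner_transpose: "(A *v x) \<bullet> y = x \<bullet> (transpose A *v y)" for A :: "real^'n^'m"
  by (metis dot_lmul_matrix inner_commute transpose_matrix_vector)

lemma blk_adjoint: "blk A B C D z \<bullet> w = z \<bullet> blk (transpose A) (transpose C) (transpose B) (transpose D) w"
  by (simp add: blk_apply inner_prod_def inner_simps inner_transpose)

text \<open>The squared norm of the transpose at \<open>x\<close> is the inner product of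
  \<open>x\<close> with \<open>A\<close> applied to that image. Cauchy-Schwarz gives one inequality,
  which is then used for \<open>A\<close> and for its transpose.\<close>

lemma norm_mv_transpose: "norm (mv (transpose A)) = norm (mv (A :: real^'n^'m))"
proof -
  have le: "norm (mv (transpose A)) \<le> norm (mv A)" for A :: "real^'k^'l"
  proof (rule norm_blinfun_bound)
    fix x
    have "(norm (transpose A *v x))\<^sup>2 = x \<bullet> (A *v (transpose A *v x))"
      using inner_transpose[of "transpose A" x "transpose A *v x"]
      by (simp add: power2_norm_eq_inner del: transpose_matrix_vector)
    also have "\<dots> \<le> norm x * norm (mv A (transpose A *v x))" by (simp add: norm_cauchy_schwarz)
    also have "\<dots> \<le> norm x * (norm (mv A) * norm (transpose A *v x))" by (intro mult_left_mono norm_blinfun) auto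
    finally have "norm (transpose A *v x) * norm (transpose A *v x) \<le> (norm (mv A) * norm x) * norm (transpose A *v x)"
      by (simp add: power2_eq_square mult_ac)
    then show "norm (mv (transpose A) x) \<le> norm (mv A) * norm x"
      by (cases "norm (transpose A *v x) = 0") (auto simp: mult_le_cancel_right)
  qed auto
  from le[of A] le[of "transpose A"] show ?thesis by simp
qed

text \<open>Pythagoras on the two components; the source of the maxima in the horizon bound.\<close>

lemma norm_blk_diagonal: "norm (blk A 0 0 D) \<le> max (norm (mv A)) (norm (mv D))"
proof (rule norm_blinfun_bound)
  fix z :: "(real^'a) \<times> (real^'a)"
  let ?m = "max (norm (mv A)) (norm (mv D))"
  have "norm (A *v fst z) \<le> ?m * norm (fst z)" "norm (D *v snd z) \<le> ?m * norm (snd z)"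
    using order_trans[OF norm_blinfun[of "mv A" "fst z"] mult_right_mono[of "norm (mv A)" ?m]]
      order_trans[OF norm_blinfun[of "mv D" "snd z"] mult_right_mono[of "norm (mv D)" ?m]] by auto
  then have "(norm (A *v fst z))\<^sup>2 + (norm (D *v snd z))\<^sup>2 \<le> (?m * norm (fst z))\<^sup>2 + (?m * norm (snd z))\<^sup>2"
    by (intro add_mono power_mono) auto
  also have "\<dots> = ?m\<^sup>2 * ((norm (fst z))\<^sup>2 + (norm (snd z))\<^sup>2)" by (simp add: power_mult_distrib distrib_left)
  finally have "sqrt ((norm (A *v fst z))\<^sup>2 + (norm (D *v snd z))\<^sup>2) \<le> sqrt (?m\<^sup>2 * ((norm (fst z))\<^sup>2 + (norm (snd z))\<^sup>2))"
    by (rule real_sqrt_le_mono)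
  moreover have "0 \<le> ?m" by (simp add: le_max_iff_disj)
  ultimately show "norm (blk A 0 0 D z) \<le> ?m * norm z"
    by (simp add: blk_apply matrix_vector_linear norm_prod_def real_sqrt_mult)
qed (simp add: le_max_iff_disj)

lemma norm_blk_off_diagonal:
  fixes B C :: "real^'n^'n"
  shows "norm (blk 0 B 0 0) \<le> norm (mv B)" "norm (blk 0 0 C 0) \<le> norm (mv C)"
proof -
  have *: "norm (B *v x) \<le> norm (mv B) * norm y" if "norm x \<le> norm y" for B :: "real^'n^'n" and x and y :: "'n state_pair"
    using order_trans[OF norm_blinfun[of "mv B" x] mult_left_mono[OF that]] by simp
  have fst_snd: "norm (fst z) \<le> norm z" "norm (snd z) \<le> norm z" for z :: "'n state_pair"
    using norm_fst_le[of "fst z" "snd z"] norm_snd_le[of "snd z" "fst z"] by simp_all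
  show "norm (blk 0 B 0 0) \<le> norm (mv B)"
    by (rule norm_blinfun_bound) (simp_all add: blk_apply matrix_vector_linear norm_Pair * fst_snd)
  show "norm (blk 0 0 C 0) \<le> norm (mv C)"
    by (rule norm_blinfun_bound) (simp_all add: blk_apply matrix_vector_linear norm_Pair * fst_snd)
qed

lemma sup_norm2_ge:
  assumes "continuous_on {0..T} M" "t \<in> {0..T}" shows "norm (mv (M t)) \<le> sup_norm2 T M"
proof -
  obtain B where "\<And>t. t \<in> {0..T} \<Longrightarrow> norm (mv (M t)) \<le> B"
    using continuous_on_bounded_norm[OF continuous_on_mv[OF assms(1)]] by blast
  then have "bdd_above ((\<lambda>t. onorm ((*v) (M t))) ` {0..T})" by (intro bdd_aboveI2[of _ _ B]) (simp add: norm_mv)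
  then show ?thesis unfolding sup_norm2_def norm_mv using assms(2) by (intro cSUP_upper)
qed

section \<open>The attacker's ODE system in block form\<close>

text \<open>In this section \<open>P\<close> and \<open>L\<close> stand for the paper's \<open>P\<^sup>-\<^sup>1\<close> and \<open>\<Lambda>\<close>. The unknown \<open>X\<close> has the blocks
  \<open>F\<^sup>c, F\<^sup>a, G\<^sup>c, G\<^sup>a\<close> and \<open>p = (f\<^sup>\<rho>, g\<^sup>\<tau>)\<close>, so that \<open>X z + p\<close> is the costate of the attacker's problem.\<close>

context
  fixes A K F Q P L :: "real \<Rightarrow> real^'n^'n" and a r f :: "real \<Rightarrow> real^'n" and lam :: real
begin

text \<open>Drift of the pair of means in the controls \<open>\<rho>\<close> and \<open>w\<close>.
  Substituting \<open>\<tau> = w - H (m^c - m^a)\<close> cancels \<open>\<Theta>\<close> in the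
  agent's mean, which leaves a block triangular operator.\<close>

definition drift_blk :: "real \<Rightarrow> 'n state_pair \<Rightarrow>\<^sub>L 'n state_pair" where
  "drift_blk t = blk (A t) (- (K t ** F t)) 0 (A t - K t ** F t)"

text \<open>The transpose of \<open>drift_blk\<close> when \<open>F t\<close> and \<open>K t\<close>
  are symmetric, spelled out so as to match the attacker's system term by term.\<close>

definition adjoint_blk :: "real \<Rightarrow> 'n state_pair \<Rightarrow>\<^sub>L 'n state_pair" where
  "adjoint_blk t = blk (transpose (A t)) 0 (- (F t ** K t)) (transpose (A t) - F t ** K t)"

text \<open>The inputs \<open>\<rho>\<close> and \<open>\<T> w\<close> are penalised by
  \<open>P\<close> and by the inverse of \<open>\<Sigma> = \<sigma>W ** transpose \<sigma>W\<close>.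
  The Riccati gain is therefore diagonal with blocks the inverse of \<open>P\<close> and
  \<open>\<T> \<Sigma>\<close> times the transpose of \<open>\<T>\<close>; the latter is
  \<open>\<Lambda>\<close> for symmetric \<open>R\<close>.\<close>

definition gain_blk :: "real \<Rightarrow> 'n state_pair \<Rightarrow>\<^sub>L 'n state_pair" where
  "gain_blk t = blk (P t) 0 0 (L t)"

text \<open>Second-order part of \<open>lam\<close> times the deviation cost in the means; the
  control cost contributes \<open>F K F\<close>. The attacker subtracts this cost, so the state
  weight of the control problem is \<open>- cost_blk\<close>, which is negative semidefinite for
  \<open>lam \<ge> 0\<close>.\<close>

definition cost_blk :: "real \<Rightarrow> 'n state_pair \<Rightarrow>\<^sub>L 'n state_pair" where
  "cost_blk t = blk ((2 * lam) *\<^sub>R Q t) 0 0 ((2 * lam) *\<^sub>R (F t ** K t ** F t))"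

definition offset :: "real \<Rightarrow> real^'n" where
  "offset t = a t - (1/2) *\<^sub>R (K t *v f t)"

text \<open>First-order coefficients of minus \<open>lam\<close> times the deviation cost: the
  target \<open>r\<close> acts on the first mean, the affine part of the agent's feedback on the
  second.\<close>

definition lin_cost :: "real \<Rightarrow> 'n state_pair" where
  "lin_cost t = ((2 * lam) *\<^sub>R (Q t *v r t), - (lam *\<^sub>R ((F t ** K t) *v f t)))"

definition attack_riccati :: "real \<Rightarrow> (real \<Rightarrow> 'n state_pair \<Rightarrow>\<^sub>L 'n state_pair) \<Rightarrow> bool" where
  "attack_riccati T X \<longleftrightarrow> (\<forall>t\<in>{0..T}. (X has_vector_derivative
     - riccati_map (drift_blk t) (adjoint_blk t) (gain_blk t) (cost_blk t) (X t)) (at t within {0..T})) \<and> X T = 0"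

definition attack_costate :: "real \<Rightarrow> (real \<Rightarrow> 'n state_pair \<Rightarrow>\<^sub>L 'n state_pair) \<Rightarrow> (real \<Rightarrow> 'n state_pair) \<Rightarrow> bool" where
  "attack_costate T X p \<longleftrightarrow> (\<forall>t\<in>{0..T}. (p has_vector_derivative
     - (adjoint_blk t (p t) - X t (gain_blk t (p t)) + X t (offset t, offset t) + lin_cost t)) (at t within {0..T})) \<and> p T = 0"

lemma riccati_map_blk:
  "riccati_map (drift_blk t) (adjoint_blk t) (gain_blk t) (cost_blk t) (blk Fc Fa Gc Ga) = blk
     (Fc ** A t + transpose (A t) ** Fc - Fc ** P t ** Fc - Fa ** L t ** Gc - (2 * lam) *\<^sub>R Q t)
     (Fa ** (A t - K t ** F t) + transpose (A t) ** Fa - Fc ** K t ** F t - Fc ** P t ** Fa - Fa ** L t ** Ga)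
     (Gc ** A t + (transpose (A t) - F t ** K t) ** Gc - F t ** K t ** Fc - Ga ** L t ** Gc - Gc ** P t ** Fc)
     (Ga ** (A t - K t ** F t) + (transpose (A t) - F t ** K t) ** Ga - F t ** K t ** Fa - Gc ** K t ** F t
        - Gc ** P t ** Fa - Ga ** L t ** Ga - (2 * lam) *\<^sub>R (F t ** K t ** F t))"
  by (simp add: riccati_map_def drift_blk_def adjoint_blk_def gain_blk_def cost_blk_def blk_compose blk_linear
      blk_inject matrix_mult_linear matrix_mul_assoc algebra_simps)

lemma attack_ode_iff:
  "attack_ode T lam A K F Q P L a r f Fc Fa Gc Ga f\<rho> g\<tau> \<longleftrightarrow>
     attack_riccati T (\<lambda>t. blk (Fc t) (Fa t) (Gc t) (Ga t)) \<and>
     attack_costate T (\<lambda>t. blk (Fc t) (Fa t) (Gc t) (Ga t)) (\<lambda>t. (f\<rho> t, g\<tau> t))"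
proof -
  have costate: "- (adjoint_blk t (f\<rho> t, g\<tau> t) - blk (Fc t) (Fa t) (Gc t) (Ga t) (gain_blk t (f\<rho> t, g\<tau> t))
        + blk (Fc t) (Fa t) (Gc t) (Ga t) (offset t, offset t) + lin_cost t)
    = (- ((transpose (A t) - Fc t ** P t) *v f\<rho> t + Fc t *v (a t - (1/2) *\<^sub>R (K t *v f t)) - (Fa t ** L t) *v g\<tau> t
         + Fa t *v (a t - (1/2) *\<^sub>R (K t *v f t)) + (2 * lam) *\<^sub>R (Q t *v r t)),
       - ((transpose (A t) - F t ** K t) *v g\<tau> t - (Gc t ** P t) *v f\<rho> t
         - (Ga t ** L t) *v g\<tau> t - (F t ** K t) *v f\<rho> t
         + Gc t *v (a t - (1/2) *\<^sub>R (K t *v f t)) + Ga t *v (a t - (1/2) *\<^sub>R (K t *v f t))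
         - lam *\<^sub>R ((F t ** K t) *v f t)))" for t
    by (simp add: adjoint_blk_def gain_blk_def lin_cost_def offset_def blk_apply matrix_vector_linear
        matrix_vector_mul_assoc algebra_simps)
  show ?thesis
    unfolding attack_ode_def attack_riccati_def attack_costate_def costate riccati_map_blk blk_linear(3)
      blk_has_vector_derivative_iff Pair_has_vector_derivative_iff blk_eq_zero zero_prod_def prod.inject ball_conj_distrib
    by blast
qed

context
  fixes T :: real
  assumes cont: "continuous_on {0..T} A" "continuous_on {0..T} K" "continuous_on {0..T} F" "continuous_on {0..T} Q"
    "continuous_on {0..T} P" "continuous_on {0..T} L"
    and cont_vec: "continuous_on {0..T} a" "continuous_on {0..T} r" "continuous_on {0..T} f"
begin

section \<open>Existence and uniqueness for the block system\<close>

lemma continuous_on_coefficient_blk: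
  "continuous_on {0..T} drift_blk" "continuous_on {0..T} adjoint_blk" "continuous_on {0..T} gain_blk"
  "continuous_on {0..T} cost_blk" "continuous_on {0..T} (\<lambda>t. (offset t, offset t))" "continuous_on {0..T} lin_cost"
  unfolding drift_blk_def[abs_def] adjoint_blk_def[abs_def] gain_blk_def[abs_def] cost_blk_def[abs_def]
    offset_def lin_cost_def[abs_def]
  by (intro continuous_on_blk continuous_on_matrix_mult continuous_on_matrix_vector continuous_on_transpose
      continuous_intros cont cont_vec)+

lemma attack_riccati_unique:
  assumes "attack_riccati T X" "attack_riccati T Y" "t \<in> {0..T}" shows "X t = Y t"
  by (rule riccati_unique_terminal[OF continuous_on_coefficient_blk(1-3), where C = cost_blk])
    (use assms in \<open>auto simp: attack_riccati_def\<close>)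

lemma attack_costate_unique:
  assumes X: "attack_riccati T X" and p: "attack_costate T X p" "attack_costate T X p'" and t: "t \<in> {0..T}"
  shows "p t = p' t"
proof -
  have Xc: "continuous_on {0..T} X"
    using X by (intro derivative_imp_continuous) (auto simp: attack_riccati_def)
  define N where "N t = adjoint_blk t - (X t o\<^sub>L gain_blk t)" for t
  have "continuous_on {0..T} N" unfolding N_def by (intro continuous_intros Xc continuous_on_coefficient_blk)
  then obtain B where B: "\<And>t. t \<in> {0..T} \<Longrightarrow> norm (N t) \<le> B" using continuous_on_bounded_norm by blast
  show ?thesis
  proof (rule ode_unique_terminal[where T = T and L = B, OF _ _ _ _ t])
    show "t \<in> {0..T} \<Longrightarrow> (p has_vector_derivative - (adjoint_blk t (p t) - X t (gain_blk t (p t)) + X t (offset t, offset t) + lin_cost t)) (at t within {0..T})"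
      "t \<in> {0..T} \<Longrightarrow> (p' has_vector_derivative - (adjoint_blk t (p' t) - X t (gain_blk t (p' t)) + X t (offset t, offset t) + lin_cost t)) (at t within {0..T})"
      for t using p by (auto simp: attack_costate_def)
    fix t assume t: "t \<in> {0..T}"
    have "norm (- (adjoint_blk t (p t) - X t (gain_blk t (p t)) + X t (offset t, offset t) + lin_cost t)
        - - (adjoint_blk t (p' t) - X t (gain_blk t (p' t)) + X t (offset t, offset t) + lin_cost t)) = norm (N t (p' t - p t))"
      by (simp add: N_def blinfun.bilinear_simps algebra_simps)
    also have "\<dots> \<le> B * norm (p' t - p t)" using B[OF t] by (intro order_trans[OF norm_blinfun] mult_right_mono) auto
    finally show "norm (- (adjoint_blk t (p t) - X t (gain_blk t (p t)) + X t (offset t, offset t) + lin_cost t)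
        - - (adjoint_blk t (p' t) - X t (gain_blk t (p' t)) + X t (offset t, offset t) + lin_cost t)) \<le> B * norm (p t - p' t)"
      by (simp add: norm_minus_commute)
  qed (use p in \<open>auto simp: attack_costate_def\<close>)
qed

lemma attack_costate_exists:
  assumes X: "attack_riccati T X" and T: "0 \<le> T" shows "\<exists>p. attack_costate T X p"
proof -
  have Xc: "continuous_on {0..T} X"
    using X by (intro derivative_imp_continuous) (auto simp: attack_riccati_def)
  have "continuous_on {0..T} (\<lambda>t. - (adjoint_blk t - (X t o\<^sub>L gain_blk t)))"
    "continuous_on {0..T} (\<lambda>t. - (X t (offset t, offset t) + lin_cost t))"
    by (intro continuous_intros Xc continuous_on_coefficient_blk)+
  from linear_ode_exists_terminal[OF T this, of 0] show ?thesis
    unfolding attack_costate_def by (auto simp: blinfun.bilinear_simps algebra_simps)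
qed

text \<open>The system is triangular: the matrices solve a closed Riccati equation, and given them
  the vectors solve a linear equation, which has a global solution. Only a Riccati solution has to
  be supplied.\<close>

lemma attack_ode_uniquely_solvableI:
  assumes X: "attack_riccati T X" and T: "0 \<le> T"
  shows "attack_ode_uniquely_solvable T lam A K F Q P L a r f"
proof -
  obtain p where p: "attack_costate T X p" using attack_costate_exists[OF X T] by blast
  have uniq: "Fc' t = blk11 (X t) \<and> Fa' t = blk12 (X t) \<and> Gc' t = blk21 (X t) \<and> Ga' t = blk22 (X t) \<and>
      f\<rho>' t = fst (p t) \<and> g\<tau>' t = snd (p t)"
    if "attack_ode T lam A K F Q P L a r f Fc' Fa' Gc' Ga' f\<rho>' g\<tau>'" and t: "t \<in> {0..T}" for Fc' Fa' Gc' Ga' f\<rho>' g\<tau>' t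
  proof -
    let ?Y = "\<lambda>t. blk (Fc' t) (Fa' t) (Gc' t) (Ga' t)" and ?q = "\<lambda>t. (f\<rho>' t, g\<tau>' t)"
    have Y: "attack_riccati T ?Y" "attack_costate T ?Y ?q" using that by (auto simp: attack_ode_iff)
    have YX: "?Y t = X t" if "t \<in> {0..T}" for t using attack_riccati_unique[OF Y(1) X that] .
    then have "attack_costate T X ?q" using Y(2) by (simp add: attack_costate_def)
    then have "?q t = p t" using attack_costate_unique[OF X _ p t] by blast
    then show ?thesis using YX[OF t] by (metis blocks_blk fst_conv snd_conv)
  qed
  have "attack_ode T lam A K F Q P L a r f (\<lambda>t. blk11 (X t)) (\<lambda>t. blk12 (X t)) (\<lambda>t. blk21 (X t)) (\<lambda>t. blk22 (X t))
      (\<lambda>t. fst (p t)) (\<lambda>t. snd (p t))"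
    using X p by (simp add: attack_ode_iff blk_blocks)
  then show ?thesis
    unfolding attack_ode_uniquely_solvable_def using uniq by meson
qed

text \<open>Without the deviation cost the constant term of the Riccati equation vanishes, and zero
  is its solution on every interval.\<close>

lemma attack_ode_solvable_zero:
  assumes "lam = 0" "0 \<le> T" shows "attack_ode_uniquely_solvable T lam A K F Q P L a r f"
proof (rule attack_ode_uniquely_solvableI)
  show "attack_riccati T (\<lambda>_. 0)"
    unfolding attack_riccati_def riccati_map_def cost_blk_def using assms by (simp add: blk_linear(5))
qed (rule assms)

lemma attack_ode_solvable_horizon:
  assumes T: "0 \<le> T" and lam: "0 \<le> lam" and sym: "\<And>t. t \<in> {0..T} \<Longrightarrow> transpose (F t) = F t" "\<And>t. t \<in> {0..T} \<Longrightarrow> transpose (K t) = K t"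
    and horizon: "horizon_bound T lam A K F Q P L"
  shows "attack_ode_uniquely_solvable T lam A K F Q P L a r f"
proof -
  define b where "b = max (sup_norm2 T A) (sup_norm2 T (\<lambda>t. A t - K t ** F t)) + sup_norm2 T (\<lambda>t. K t ** F t)"
  define c where "c = 2 * lam * max (sup_norm2 T Q) (sup_norm2 T (\<lambda>t. F t ** K t ** F t))"
  define s where "s = max (sup_norm2 T P) (sup_norm2 T L)"
  have cKF: "continuous_on {0..T} (\<lambda>t. K t ** F t)" by (intro continuous_on_matrix_mult cont)
  have cAKF: "continuous_on {0..T} (\<lambda>t. A t - K t ** F t)" by (intro continuous_intros cKF cont)
  have cFKF: "continuous_on {0..T} (\<lambda>t. F t ** K t ** F t)" by (intro continuous_on_matrix_mult cont)
  have small: "T * sqrt ((c + b) * (s + b)) < pi / 2"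
    using horizon by (simp add: horizon_bound_def Let_def b_def c_def s_def)
  have mv_uminus: "norm (mv (- M)) = norm (mv M)" for M :: "real^'n^'n"
    using linear_neg[OF bounded_linear.linear[OF bounded_linear_mv], of M] by simp
  have drift: "norm (drift_blk t) \<le> b" if t: "t \<in> {0..T}" for t
  proof -
    \<comment> \<open>The diagonal part contributes the maximum and the off-diagonal part the
      additional norm of \<open>K F\<close>; together they form the constant \<open>b\<close> of the
      horizon bound.\<close>
    have "drift_blk t = blk (A t) 0 0 (A t - K t ** F t) + blk 0 (- (K t ** F t)) 0 0"
      by (simp add: drift_blk_def blk_linear)
    then have "norm (drift_blk t) \<le> norm (blk (A t) 0 0 (A t - K t ** F t)) + norm (blk 0 (- (K t ** F t)) 0 0)"
      by (simp add: norm_triangle_ineq)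
    also have "\<dots> \<le> max (norm (mv (A t))) (norm (mv (A t - K t ** F t))) + norm (mv (K t ** F t))"
      using norm_blk_off_diagonal(1)[of "- (K t ** F t)"] by (intro add_mono norm_blk_diagonal) (simp add: mv_uminus)
    also have "\<dots> \<le> b"
      unfolding b_def using sup_norm2_ge[OF cont(1) t] sup_norm2_ge[OF cAKF t] sup_norm2_ge[OF cKF t]
      by (intro add_mono max.mono) auto
    finally show ?thesis .
  qed
  have adjoint: "norm (adjoint_blk t) \<le> b" if t: "t \<in> {0..T}" for t
  proof -
    \<comment> \<open>Symmetry of \<open>F\<close> and \<open>K\<close> identifies the adjoint block
      as the transposed drift, so the same constant \<open>b\<close> bounds it.\<close>
    have FK: "F t ** K t = transpose (K t ** F t)" using sym t by (simp add: matrix_transpose_mul)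
    have "adjoint_blk t = blk (transpose (A t)) 0 0 (transpose (A t - K t ** F t)) + blk 0 0 (- transpose (K t ** F t)) 0"
      by (simp add: adjoint_blk_def blk_linear FK transpose_linear)
    then have "norm (adjoint_blk t) \<le> norm (blk (transpose (A t)) 0 0 (transpose (A t - K t ** F t))) + norm (blk 0 0 (- transpose (K t ** F t)) 0)"
      by (simp add: norm_triangle_ineq)
    also have "\<dots> \<le> max (norm (mv (transpose (A t)))) (norm (mv (transpose (A t - K t ** F t)))) + norm (mv (transpose (K t ** F t)))"
      using norm_blk_off_diagonal(2)[of "- transpose (K t ** F t)"] by (intro add_mono norm_blk_diagonal) (simp add: mv_uminus)
    also have "\<dots> \<le> b"
      unfolding b_def norm_mv_transpose using sup_norm2_ge[OF cont(1) t] sup_norm2_ge[OF cAKF t] sup_norm2_ge[OF cKF t]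
      by (intro add_mono max.mono) auto
    finally show ?thesis .
  qed
  have gain: "norm (gain_blk t) \<le> s" if t: "t \<in> {0..T}" for t
    unfolding gain_blk_def s_def
    by (intro order_trans[OF norm_blk_diagonal] max.mono sup_norm2_ge[OF cont(5) t] sup_norm2_ge[OF cont(6) t])
  have cost: "norm (cost_blk t) \<le> c" if t: "t \<in> {0..T}" for t
  proof -
    have "cost_blk t = (2 * lam) *\<^sub>R blk (Q t) 0 0 (F t ** K t ** F t)" by (simp add: cost_blk_def blk_linear)
    then have "norm (cost_blk t) = (2 * lam) * norm (blk (Q t) 0 0 (F t ** K t ** F t))" using lam by simp
    also have "\<dots> \<le> c"
      unfolding c_def using lam
      by (intro mult_left_mono order_trans[OF norm_blk_diagonal] max.mono sup_norm2_ge[OF cont(4) t] sup_norm2_ge[OF cFKF t]) auto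
    finally show ?thesis .
  qed
  obtain X where "X T = 0" "\<And>t. t \<in> {0..T} \<Longrightarrow> (X has_vector_derivative
      - riccati_map (drift_blk t) (adjoint_blk t) (gain_blk t) (cost_blk t) (X t)) (at t within {0..T})"
    using riccati_exists_terminal[OF T continuous_on_coefficient_blk(1-4) drift adjoint gain cost small] by blast
  then show ?thesis by (intro attack_ode_uniquely_solvableI[OF _ T, of X]) (simp add: attack_riccati_def)
qed

text \<open>The transposed blocks solve the same system.\<close>

lemma attack_riccati_symmetric:
  assumes X: "attack_riccati T (\<lambda>t. blk (Fc t) (Fa t) (Gc t) (Ga t))" and t: "t \<in> {0..T}"
    and sym: "\<And>t. t \<in> {0..T} \<Longrightarrow> transpose (F t) = F t" "\<And>t. t \<in> {0..T} \<Longrightarrow> transpose (K t) = K t"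
      "\<And>t. t \<in> {0..T} \<Longrightarrow> transpose (Q t) = Q t" "\<And>t. t \<in> {0..T} \<Longrightarrow> transpose (P t) = P t"
      "\<And>t. t \<in> {0..T} \<Longrightarrow> transpose (L t) = L t"
  shows "transpose (Fc t) = Fc t" "transpose (Fa t) = Gc t" "transpose (Gc t) = Fa t" "transpose (Ga t) = Ga t"
proof -
  have "attack_riccati T (\<lambda>t. blk (transpose (Fc t)) (transpose (Gc t)) (transpose (Fa t)) (transpose (Ga t)))"
    unfolding attack_riccati_def
  proof (intro conjI ballI)
    fix t assume t: "t \<in> {0..T}"
    note d = X[unfolded attack_riccati_def, THEN conjunct1, rule_format, OF t,
        unfolded riccati_map_blk blk_linear(3) blk_has_vector_derivative_iff]
    note tr = bounded_linear.has_vector_derivative[OF bounded_linear_transpose]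
    show "((\<lambda>t. blk (transpose (Fc t)) (transpose (Gc t)) (transpose (Fa t)) (transpose (Ga t))) has_vector_derivative
      - riccati_map (drift_blk t) (adjoint_blk t) (gain_blk t) (cost_blk t)
        (blk (transpose (Fc t)) (transpose (Gc t)) (transpose (Fa t)) (transpose (Ga t)))) (at t within {0..T})"
      unfolding riccati_map_blk blk_linear(3) blk_has_vector_derivative_iff
      using tr[OF d[THEN conjunct1]] tr[OF d[THEN conjunct2, THEN conjunct1]]
        tr[OF d[THEN conjunct2, THEN conjunct2, THEN conjunct1]] tr[OF d[THEN conjunct2, THEN conjunct2, THEN conjunct2]]
      by (simp add: transpose_linear matrix_transpose_mul sym[OF t] matrix_mul_assoc matrix_mult_linear algebra_simps)
  qed (use X in \<open>auto simp: attack_riccati_def blk_eq_zero transpose_linear\<close>)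
  from attack_riccati_unique[OF this X t]
  show "transpose (Fc t) = Fc t" "transpose (Fa t) = Gc t" "transpose (Gc t) = Fa t" "transpose (Ga t) = Ga t"
    by (auto simp: blk_inject)
qed

end

end

section \<open>Positive definite matrices\<close>

lemma matrix_inv_inverse:
  fixes A :: "real^'n^'n"
  assumes "invertible A" shows "A ** matrix_inv A = mat 1" "matrix_inv A ** A = mat 1"
  using someI_ex[OF assms[unfolded invertible_def]] by (auto simp: matrix_inv_def)

lemma pd_mat_invertible: assumes "pd_mat A" shows "invertible A"
proof -
  have "x = 0" if "A *v x = 0" for x using assms that by (force simp: pd_mat_def)
  then have "\<exists>B. B ** A = mat 1" by (simp add: matrix_left_invertible_ker)
  then show ?thesis by (simp add: invertible_left_inverse)
qed

lemma pd_mat_inverse: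
  assumes "pd_mat A" shows "A ** matrix_inv A = mat 1" "matrix_inv A ** A = mat 1"
  using matrix_inv_inverse[OF pd_mat_invertible[OF assms]] by auto

lemma transpose_matrix_inv:
  assumes "pd_mat A" shows "transpose (matrix_inv A) = matrix_inv A"
proof -
  have "transpose A = A" using assms by (simp add: pd_mat_def sym_mat_def)
  then have "transpose (matrix_inv A) ** A = mat 1"
    using pd_mat_inverse(1)[OF assms] by (metis matrix_transpose_mul transpose_mat)
  then show ?thesis using pd_mat_inverse(1)[OF assms] by (metis matrix_mul_assoc matrix_mul_lid matrix_mul_rid)
qed

lemma pd_mat_matrix_inv: assumes A: "pd_mat A" shows "pd_mat (matrix_inv A)"
proof -
  have "0 < x \<bullet> (matrix_inv A *v x)" if "x \<noteq> 0" for x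
  proof -
    define y where "y = matrix_inv A *v x"
    have x: "x = A *v y" by (simp add: y_def matrix_vector_mul_assoc pd_mat_inverse[OF A])
    then have "y \<noteq> 0" using that by (auto simp: matrix_vector_linear)
    then show ?thesis using A by (simp add: y_def[symmetric]) (simp add: x inner_commute pd_mat_def)
  qed
  then show ?thesis by (simp add: pd_mat_def sym_mat_def transpose_matrix_inv[OF A])
qed

text \<open>The quadratic form at \<open>x\<close> is the squared norm of the transpose applied to
  \<open>x\<close>, and full row rank makes the transpose injective.\<close>

lemma pd_mat_gram:
  fixes \<sigma> :: "real^'q^'m"
  assumes "rank \<sigma> = CARD('m)" shows "pd_mat (\<sigma> ** transpose \<sigma>)"
proof -
  have "inj ((*v) (transpose \<sigma>))" using assms by (simp add: rank_transpose flip: full_rank_injective)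
  then have ker: "transpose \<sigma> *v x = 0 \<longleftrightarrow> x = 0" for x
    by (metis inj_eq matrix_vector_mult_0_right)
  have "x \<bullet> ((\<sigma> ** transpose \<sigma>) *v x) = (norm (transpose \<sigma> *v x))\<^sup>2" for x
    using inner_transpose[of "transpose \<sigma>" x "transpose \<sigma> *v x"]
    by (simp add: power2_norm_eq_inner matrix_vector_mul_assoc del: transpose_matrix_vector)
  then have "0 < x \<bullet> ((\<sigma> ** transpose \<sigma>) *v x)" if "x \<noteq> 0" for x
    using ker that by (simp del: transpose_matrix_vector)
  then show ?thesis by (simp add: pd_mat_def sym_mat_def matrix_transpose_mul)
qed

lemma continuous_on_det:
  fixes A :: "real \<Rightarrow> real^'n^'n"
  assumes "continuous_on S A" shows "continuous_on S (\<lambda>t. det (A t))"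
  unfolding det_def by (intro continuous_intros assms)

text \<open>Cramer's rule writes each entry of the inverse as a quotient of determinants, which are
  polynomials in the entries.\<close>

lemma continuous_on_matrix_inv:
  fixes A :: "real \<Rightarrow> real^'n^'n"
  assumes A: "continuous_on S A" and inv: "\<And>t. t \<in> S \<Longrightarrow> pd_mat (A t)"
  shows "continuous_on S (\<lambda>t. matrix_inv (A t))"
proof -
  define N where "N t = (\<chi> i j. det (\<chi> k l. if l = i then axis j 1 $ k else A t $ k $ l) / det (A t))" for t
  have "continuous_on S N"
  proof -
    have "continuous_on S (\<lambda>t. if l = i then axis j 1 $ k else A t $ k $ l)" for i j k l
      by (cases "l = i") (auto intro!: continuous_intros A)
    moreover have "det (A t) \<noteq> 0" if "t \<in> S" for t using pd_mat_invertible[OF inv[OF that]] by (simp add: invertible_det_nz)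
    ultimately show ?thesis
      unfolding N_def by (intro continuous_on_vec_lambda continuous_on_divide continuous_on_det A) auto
  qed
  moreover have "matrix_inv (A t) = N t" if t: "t \<in> S" for t
  proof -
    have "det (A t) \<noteq> 0" using pd_mat_invertible[OF inv[OF t]] by (simp add: invertible_det_nz)
    then have "matrix_inv (A t) *v axis j 1 = (\<chi> i. det (\<chi> k l. if l = i then axis j 1 $ k else A t $ k $ l) / det (A t))" for j
      using cramer[of "A t" "matrix_inv (A t) *v axis j 1" "axis j 1"] pd_mat_inverse(1)[OF inv[OF t]]
      by (simp add: matrix_vector_mul_assoc)
    then show ?thesis unfolding N_def vec_eq_iff by (simp flip: matrix_vector_axis)
  qed
  ultimately show ?thesis by (metis (no_types, lifting) continuous_on_cong)
qed

text \<open>The transpose of \<open>R\<close> solves the same initial value problem. Symmetry of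
  \<open>R\<close> is used for symmetry of \<open>\<Lambda>\<close> and for the form of the optimal
  \<open>\<tau>\<close>.\<close>

lemma filter_riccati_symmetric:
  fixes A R :: "real \<Rightarrow> real^'d^'d" and H :: "real \<Rightarrow> real^'d^'m" and \<sigma>V :: "real^'p^'d" and \<sigma>W :: "real^'q^'m"
  assumes R: "filter_riccati T A H \<sigma>V \<sigma>W R0 R" and R0: "transpose R0 = R0" and W: "pd_mat (\<sigma>W ** transpose \<sigma>W)"
    and A: "continuous_on {0..T} A" and H: "continuous_on {0..T} H" and t: "t \<in> {0..T}"
  shows "transpose (R t) = R t"
proof -
  define G where "G t = transpose (H t) ** matrix_inv (\<sigma>W ** transpose \<sigma>W) ** H t" for t
  define C where "C = \<sigma>V ** transpose \<sigma>V"
  have symG: "transpose (G t) = G t" for t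
    unfolding G_def matrix_transpose_mul transpose_matrix_inv[OF W] transpose_transpose by (simp add: matrix_mul_assoc)
  have symC: "transpose C = C" by (simp add: C_def matrix_transpose_mul)
  define D where "D t X = X ** transpose (A t) + A t ** X - X ** G t ** X + C" for t X
  have R': "(R has_vector_derivative D t (R t)) (at t within {0..T})" if "t \<in> {0..T}" for t
    using R that unfolding filter_riccati_def D_def G_def C_def by (auto simp: matrix_mul_assoc algebra_simps)
  have Rt': "((\<lambda>t. transpose (R t)) has_vector_derivative D t (transpose (R t))) (at t within {0..T})" if "t \<in> {0..T}" for t
    using bounded_linear.has_vector_derivative[OF bounded_linear_transpose R'[OF that]]
    by (simp add: D_def transpose_linear matrix_transpose_mul symG symC matrix_mul_assoc algebra_simps)
  \<comment> \<open>Read as operators this is a forward Riccati equation with \<open>- mv C\<close>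
    as constant term, so \<open>riccati_lipschitz\<close> supplies the estimate along the two
    solutions.\<close>
  have mvD: "mv (D t X) = riccati_map (mv (transpose (A t))) (mv (A t)) (mv (G t)) (- mv C) (mv X)" for t X
    by (rule blinfun_eqI)
      (simp add: D_def riccati_map_def blinfun.bilinear_simps matrix_vector_linear matrix_vector_mul_assoc matrix_mul_assoc del: transpose_matrix_vector)
  have cG: "continuous_on {0..T} G"
    unfolding G_def by (intro continuous_on_matrix_mult continuous_on_transpose continuous_on_const H)
  obtain b where b: "\<And>t. t \<in> {0..T} \<Longrightarrow> norm (mv (A t)) \<le> b" using continuous_on_bounded_norm[OF continuous_on_mv[OF A]] by blast
  obtain g where g: "\<And>t. t \<in> {0..T} \<Longrightarrow> norm (mv (G t)) \<le> g" using continuous_on_bounded_norm[OF continuous_on_mv[OF cG]] by blast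
  obtain \<rho> where \<rho>: "\<And>t. t \<in> {0..T} \<Longrightarrow> norm (mv (R t)) \<le> \<rho>"
    using continuous_on_bounded_norm[OF continuous_on_mv[OF derivative_imp_continuous[OF R']]] by blast
  have "mv (R t) = mv (transpose (R t))"
  proof (rule ode_unique[where T = T and L = "2 * b + 2 * g * \<rho>", OF _ _ _ _ t])
    show "((\<lambda>t. mv (R t)) has_vector_derivative mv (D t (R t))) (at t within {0..T})"
      "((\<lambda>t. mv (transpose (R t))) has_vector_derivative mv (D t (transpose (R t)))) (at t within {0..T})"
      if "t \<in> {0..T}" for t
      using bounded_linear.has_vector_derivative[OF bounded_linear_mv R'[OF that]]
        bounded_linear.has_vector_derivative[OF bounded_linear_mv Rt'[OF that]] by auto
    show "norm (mv (D t (R t)) - mv (D t (transpose (R t)))) \<le> (2 * b + 2 * g * \<rho>) * norm (mv (R t) - mv (transpose (R t)))"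
      if "t \<in> {0..T}" for t
      unfolding mvD by (rule riccati_lipschitz) (use b g \<rho> that in \<open>auto simp: norm_mv_transpose\<close>)
    show "mv (R 0) = mv (transpose (R 0))" using R R0 by (simp add: filter_riccati_def)
  qed
  then have "blinfun_apply (mv (R t)) x = blinfun_apply (mv (transpose (R t))) x" for x by simp
  then show ?thesis by (simp add: matrix_eq del: transpose_matrix_vector)
qed

section \<open>Completion of squares\<close>

text \<open>The integrand is the time derivative of \<open>V\<close>, the candidate value function
  up to a summand depending on time alone, and \<open>V\<close> vanishes at \<open>T\<close>. The
  equations for \<open>X\<close> and \<open>p\<close> are exactly those under which state and input
  occur together only through \<open>\<pi>\<close>, the gradient of \<open>V\<close>. The identity
  holds for every input \<open>\<beta>\<close>, optimal or not.\<close>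

lemma completion_of_squares:
  fixes X A A' S C :: "real \<Rightarrow> 'e::euclidean_space \<Rightarrow>\<^sub>L 'e" and p z b l \<beta> :: "real \<Rightarrow> 'e"
  assumes T: "0 \<le> T"
    and X: "\<And>t. t \<in> {0..T} \<Longrightarrow> (X has_vector_derivative - riccati_map (A t) (A' t) (S t) (C t) (X t)) (at t within {0..T})"
    and p: "\<And>t. t \<in> {0..T} \<Longrightarrow> (p has_vector_derivative - (A' t (p t) - X t (S t (p t)) + X t (b t) + l t)) (at t within {0..T})"
    and z: "\<And>t. t \<in> {0..T} \<Longrightarrow> (z has_vector_derivative A t (z t) + b t + \<beta> t) (at t within {0..T})"
    and XT: "X T = 0" "p T = 0"
    and sym: "\<And>t x y. t \<in> {0..T} \<Longrightarrow> X t x \<bullet> y = x \<bullet> X t y" "\<And>t x y. t \<in> {0..T} \<Longrightarrow> S t x \<bullet> y = x \<bullet> S t y"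
      "\<And>t x y. t \<in> {0..T} \<Longrightarrow> A t x \<bullet> y = x \<bullet> A' t y"
  defines "\<pi> \<equiv> \<lambda>t. X t (z t) + p t"
  shows "((\<lambda>t. \<pi> t \<bullet> \<beta> t + (1/2) * (\<pi> t \<bullet> S t (\<pi> t)) + (1/2) * (z t \<bullet> C t (z t)) - l t \<bullet> z t
      + (p t \<bullet> b t - (1/2) * (p t \<bullet> S t (p t)))) has_integral - ((1/2) * (z 0 \<bullet> X 0 (z 0)) + p 0 \<bullet> z 0)) {0..T}"
proof -
  define V where "V t = (1/2) * (z t \<bullet> X t (z t)) + p t \<bullet> z t" for t
  have "(V has_vector_derivative \<pi> t \<bullet> \<beta> t + (1/2) * (\<pi> t \<bullet> S t (\<pi> t)) + (1/2) * (z t \<bullet> C t (z t)) - l t \<bullet> z t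
      + (p t \<bullet> b t - (1/2) * (p t \<bullet> S t (p t)))) (at t within {0..T})" if t: "t \<in> {0..T}" for t
  proof -
    let ?X' = "- riccati_map (A t) (A' t) (S t) (C t) (X t)"
    let ?p' = "- (A' t (p t) - X t (S t (p t)) + X t (b t) + l t)"
    let ?z' = "A t (z t) + b t + \<beta> t"
    have "((\<lambda>t. X t (z t)) has_vector_derivative X t ?z' + ?X' (z t)) (at t within {0..T})"
      by (rule bounded_bilinear.has_vector_derivative[OF bounded_bilinear_blinfun_apply X[OF t] z[OF t]])
    from bounded_bilinear.has_vector_derivative[OF bounded_bilinear_inner z[OF t] this]
    have "((\<lambda>t. z t \<bullet> X t (z t)) has_vector_derivative z t \<bullet> (X t ?z' + ?X' (z t)) + ?z' \<bullet> X t (z t)) (at t within {0..T})" .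
    moreover have "((\<lambda>t. p t \<bullet> z t) has_vector_derivative p t \<bullet> ?z' + ?p' \<bullet> z t) (at t within {0..T})"
      by (rule bounded_bilinear.has_vector_derivative[OF bounded_bilinear_inner p[OF t] z[OF t]])
    ultimately have "(V has_vector_derivative (1/2) * (z t \<bullet> (X t ?z' + ?X' (z t)) + ?z' \<bullet> X t (z t)) + (p t \<bullet> ?z' + ?p' \<bullet> z t)) (at t within {0..T})"
      unfolding V_def by (intro has_vector_derivative_add has_vector_derivative_mult_right) auto
    moreover have "(1/2) * (z t \<bullet> (X t ?z' + ?X' (z t)) + ?z' \<bullet> X t (z t)) + (p t \<bullet> ?z' + ?p' \<bullet> z t)
        = \<pi> t \<bullet> \<beta> t + (1/2) * (\<pi> t \<bullet> S t (\<pi> t)) + (1/2) * (z t \<bullet> C t (z t)) - l t \<bullet> z t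
          + (p t \<bullet> b t - (1/2) * (p t \<bullet> S t (p t)))"
    proof -
      \<comment> \<open>The adjoint relations are oriented so that \<open>X\<close> and
        \<open>A\<close> act on \<open>z\<close> and \<open>S\<close> acts on \<open>p\<close>; what
        remains is a linear identity between inner products.\<close>
      note s = sym(1)[OF t] sym(2)[OF t] sym(3)[OF t]
      have e1: "z t \<bullet> X t y = X t (z t) \<bullet> y" for y by (rule s(1)[symmetric])
      have e2: "z t \<bullet> A' t y = A t (z t) \<bullet> y" for y by (rule s(3)[symmetric])
      have e3: "A' t (p t) \<bullet> z t = A t (z t) \<bullet> p t" using e2[of "p t"] by (simp add: inner_commute)
      have e4: "X t y \<bullet> z t = X t (z t) \<bullet> y" for y by (subst s(1)) (rule inner_commute)
      have e5: "p t \<bullet> S t y = S t (p t) \<bullet> y" for y by (rule s(2)[symmetric])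
      have e6: "X t (z t) \<bullet> S t (p t) = S t (p t) \<bullet> X t (z t)" by (simp add: inner_commute)
      show ?thesis
        unfolding \<pi>_def riccati_map_def
        by (simp add: blinfun.bilinear_simps inner_simps e1 e2 e3 e4 e5)
          (simp add: algebra_simps inner_commute add_divide_distrib)
    qed
    ultimately show ?thesis by simp
  qed
  from fundamental_theorem_of_calculus[OF T this]
  show ?thesis by (simp add: V_def XT)
qed

lemma square_completion:
  fixes P :: "real^'n^'n"
  assumes P: "pd_mat P"
  shows "(1/2) * (x \<bullet> (P *v x)) + x \<bullet> q + (1/2) * (q \<bullet> (matrix_inv P *v q))
    = (1/2) * ((x + matrix_inv P *v q) \<bullet> (P *v (x + matrix_inv P *v q)))"
proof -
  have sym: "transpose P = P" using P by (simp add: pd_mat_def sym_mat_def)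
  have PP: "P *v (matrix_inv P *v q) = q" by (simp add: matrix_vector_mul_assoc pd_mat_inverse[OF P])
  have "(matrix_inv P *v q) \<bullet> (P *v x) = q \<bullet> x"
    using inner_transpose[of P "matrix_inv P *v q" x] sym PP by simp
  then show ?thesis by (simp add: matrix_vector_linear inner_simps PP inner_commute algebra_simps)
qed

section \<open>The attacked system\<close>

lemma integral_Pair:
  fixes f :: "real \<Rightarrow> 'b::euclidean_space" and g :: "real \<Rightarrow> 'c::euclidean_space"
  assumes f: "continuous_on {a..b} f" and g: "continuous_on {a..b} g"
  shows "integral {a..b} (\<lambda>s. (f s, g s)) = (integral {a..b} f, integral {a..b} g)"
proof -
  have int: "(\<lambda>s. (f s, g s)) integrable_on {a..b}" by (intro integrable_continuous_real continuous_on_Pair f g)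
  show ?thesis
    using integral_linear[OF int bounded_linear_fst] integral_linear[OF int bounded_linear_snd]
    by (simp add: prod_eq_iff o_def)
qed

lemma stoch_sum_measurable:
  assumes Z: "\<And>s. s \<in> {0..t} \<Longrightarrow> Z s \<in> borel_measurable M" and t: "0 \<le> t"
  shows "stoch_sum f Z t n \<in> borel_measurable M"
proof -
  have Zk: "Z (t * real k / real n) \<in> borel_measurable M" if "k \<le> n" for k
    by (rule Z[OF grid_point[OF t that]])
  have "(\<lambda>\<omega>. f (t * real k / real n) *v (Z (t * real (Suc k) / real n) \<omega> - Z (t * real k / real n) \<omega>)) \<in> borel_measurable M"
    if "k < n" for k
    by (rule measurable_compose[OF borel_measurable_diff[OF Zk Zk]
          borel_measurable_continuous_onI[OF linear_continuous_on[OF matrix_vector_mul_bounded_linear]]])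
      (use that in auto)
  then show ?thesis unfolding stoch_sum_def[abs_def] by (intro borel_measurable_sum) auto
qed

text \<open>Pathwise separation of the observation sums: what remains after removing the Brownian
  sums is driven by the absolutely continuous part \<open>I\<close>, to which the classical Riemann
  limit applies.\<close>

lemma stoch_sum_split:
  assumes Y: "\<And>s. s \<in> {0..t} \<Longrightarrow> Y s \<omega> = I s + \<sigma> *v W s \<omega>" and t: "0 \<le> t"
  shows "stoch_sum f Y t n \<omega> - stoch_sum (\<lambda>s. f s ** \<sigma>) W t n \<omega> = stoch_sum f (\<lambda>s _. I s) t n \<omega>"
proof -
  have Yk: "Y (t * real k / real n) \<omega> = I (t * real k / real n) + \<sigma> *v W (t * real k / real n) \<omega>"
    if "k \<le> n" for k by (rule Y[OF grid_point[OF t that]])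
  show ?thesis
    unfolding stoch_sum_def sum_subtractf[symmetric]
  proof (rule sum.cong[OF refl])
    fix k assume "k \<in> {..<n}"
    then show "f (t * real k / real n) *v (Y (t * real (Suc k) / real n) \<omega> - Y (t * real k / real n) \<omega>)
        - (f (t * real k / real n) ** \<sigma>) *v (W (t * real (Suc k) / real n) \<omega> - W (t * real k / real n) \<omega>)
      = f (t * real k / real n) *v (I (t * real (Suc k) / real n) - I (t * real k / real n))"
      using Yk[of k] Yk[of "Suc k"]
      by (simp add: matrix_vector_linear algebra_simps flip: matrix_vector_mul_assoc del: of_nat_Suc)
  qed
qed

text \<open>The derived quantities \<open>K\<close>, \<open>\<T>\<close>, \<open>\<Lambda>\<close>,
  \<open>Pinv\<close> and \<open>u\<close> are parameters tied down by equations, so that the locale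
  can be interpreted with the names introduced by \<open>defines\<close> in the theorem.\<close>

locale attack_setup = prob_space M for M :: "'w measure" +
  fixes T lam :: real
    and A :: "real \<Rightarrow> real^'d^'d" and B :: "real \<Rightarrow> real^'c^'d" and H :: "real \<Rightarrow> real^'d^'m"
    and a r f :: "real \<Rightarrow> real^'d" and h :: "real \<Rightarrow> real^'m"
    and \<sigma>V :: "real^'p^'d" and \<sigma>W :: "real^'q^'m"
    and Q F R P :: "real \<Rightarrow> real^'d^'d" and S :: "real \<Rightarrow> real^'c^'c"
    and x0 :: "real^'d" and R0 :: "real^'d^'d" and X0 :: "'w \<Rightarrow> real^'d"
    and V :: "real \<Rightarrow> 'w \<Rightarrow> real^'p" and W :: "real \<Rightarrow> 'w \<Rightarrow> real^'q"
    and Xc Xa Xh :: "(real \<Rightarrow> real^'d) \<Rightarrow> (real \<Rightarrow> real^'m) \<Rightarrow> real \<Rightarrow> 'w \<Rightarrow> real^'d"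
    and Yc :: "(real \<Rightarrow> real^'d) \<Rightarrow> (real \<Rightarrow> real^'m) \<Rightarrow> real \<Rightarrow> 'w \<Rightarrow> real^'m"
    and K :: "real \<Rightarrow> real^'d^'d" and \<T> :: "real \<Rightarrow> real^'m^'d" and \<Lambda> Pinv :: "real \<Rightarrow> real^'d^'d"
    and u :: "real \<Rightarrow> real^'d \<Rightarrow> real^'c"
  assumes K_def: "K = (\<lambda>t. B t ** matrix_inv (S t) ** transpose (B t))"
    and \<T>_def: "\<T> = (\<lambda>t. R t ** transpose (H t) ** matrix_inv (\<sigma>W ** transpose \<sigma>W))"
    and \<Lambda>_def: "\<Lambda> = (\<lambda>t. R t ** transpose (H t) ** matrix_inv (\<sigma>W ** transpose \<sigma>W) ** H t ** R t)"
    and Pinv_def: "Pinv = (\<lambda>t. matrix_inv (P t))"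
    and u_def: "u = u_star B S F f"
    and T: "0 < T" and rankW: "rank \<sigma>W = CARD('m)"
    and cont_A: "continuous_on {0..T} A" and cont_B: "continuous_on {0..T} B" and cont_H: "continuous_on {0..T} H"
    and cont_a: "continuous_on {0..T} a" and cont_h: "continuous_on {0..T} h"
    and cont_Q: "continuous_on {0..T} Q" and psd_Q: "\<And>t. t \<in> {0..T} \<Longrightarrow> psd_mat (Q t)"
    and cont_S: "continuous_on {0..T} S" and pd_S: "\<And>t. t \<in> {0..T} \<Longrightarrow> pd_mat (S t)"
    and cont_r: "continuous_on {0..T} r" and psd_R0: "psd_mat R0"
    and agent: "agent_feedback_system T A K Q a r F f"
    and filter: "filter_riccati T A H \<sigma>V \<sigma>W R0 R"
    and lam: "0 \<le> lam"
    and cont_P: "continuous_on {0..T} P" and pd_P: "\<And>t. t \<in> {0..T} \<Longrightarrow> pd_mat (P t)"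
    and brownian: "brownian_motion M V" "brownian_motion M W"
    and X0: "gaussian_vector M X0 x0 R0"
    and system: "\<And>\<rho> \<tau>. (\<rho>, \<tau>) \<in> det_attacks T \<Longrightarrow>
      attacked_system M T A B H a h \<sigma>V \<sigma>W \<T> u x0 X0 V W \<rho> \<tau> (Xc \<rho> \<tau>) (Yc \<rho> \<tau>) (Xa \<rho> \<tau>) (Xh \<rho> \<tau>)"
begin

abbreviation \<Sigma>inv :: "real^'m^'m" where
  "\<Sigma>inv \<equiv> matrix_inv (\<sigma>W ** transpose \<sigma>W)"

lemma pd_\<Sigma>: "pd_mat (\<sigma>W ** transpose \<sigma>W)"
  by (rule pd_mat_gram[OF rankW])

lemma cont_F: "continuous_on {0..T} F" and cont_f: "continuous_on {0..T} f"
  using agent unfolding agent_feedback_system_def by (auto intro: derivative_imp_continuous)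

lemma cont_R: "continuous_on {0..T} R"
  using filter unfolding filter_riccati_def by (auto intro: derivative_imp_continuous)

lemma cont_K: "continuous_on {0..T} K"
  unfolding K_def by (intro continuous_on_matrix_mult continuous_on_transpose continuous_on_matrix_inv cont_B cont_S pd_S)

lemma cont_\<T>: "continuous_on {0..T} \<T>"
  unfolding \<T>_def by (intro continuous_on_matrix_mult continuous_on_transpose continuous_on_const cont_R cont_H)

lemma cont_\<Lambda>: "continuous_on {0..T} \<Lambda>"
  unfolding \<Lambda>_def by (intro continuous_on_matrix_mult continuous_on_transpose continuous_on_const cont_R cont_H)

lemma cont_Pinv: "continuous_on {0..T} Pinv"
  unfolding Pinv_def by (intro continuous_on_matrix_inv cont_P pd_P)

lemma sym_F: "t \<in> {0..T} \<Longrightarrow> transpose (F t) = F t"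
  using agent by (auto simp: agent_feedback_system_def sym_mat_def)

lemma sym_Q: "t \<in> {0..T} \<Longrightarrow> transpose (Q t) = Q t"
  using psd_Q by (auto simp: psd_mat_def sym_mat_def)

lemma sym_S: "t \<in> {0..T} \<Longrightarrow> transpose (S t) = S t"
  using pd_S by (auto simp: pd_mat_def sym_mat_def)

lemma sym_K: "t \<in> {0..T} \<Longrightarrow> transpose (K t) = K t"
  by (simp add: K_def matrix_transpose_mul transpose_matrix_inv[OF pd_S] matrix_mul_assoc)

lemma sym_Pinv: "t \<in> {0..T} \<Longrightarrow> transpose (Pinv t) = Pinv t"
  by (simp add: Pinv_def transpose_matrix_inv[OF pd_P])

lemma sym_R: "t \<in> {0..T} \<Longrightarrow> transpose (R t) = R t"
  using psd_R0 by (intro filter_riccati_symmetric[OF filter _ pd_\<Sigma> cont_A cont_H]) (auto simp: psd_mat_def sym_mat_def)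

lemma sym_\<Lambda>: "t \<in> {0..T} \<Longrightarrow> transpose (\<Lambda> t) = \<Lambda> t"
  by (simp add: \<Lambda>_def matrix_transpose_mul transpose_matrix_inv[OF pd_\<Sigma>] sym_R matrix_mul_assoc)

lemma B_u: "B t *v u t x = - ((K t ** F t) *v x) - (1/2) *\<^sub>R (K t *v f t)"
  by (simp add: u_def u_star_def K_def matrix_vector_linear matrix_vector_mul_assoc matrix_mul_assoc)

lemma cont_u: "continuous_on {0..T} x \<Longrightarrow> continuous_on {0..T} (\<lambda>t. u t (x t))"
  unfolding u_def u_star_def
  by (intro continuous_intros continuous_on_matrix_vector continuous_on_matrix_mult continuous_on_transpose
      continuous_on_matrix_inv cont_S pd_S cont_B cont_F cont_f)

lemma u_quadratic:
  assumes t: "t \<in> {0..T}"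
  shows "u t x \<bullet> (S t *v u t x) = (F t *v x + (1/2) *\<^sub>R f t) \<bullet> (K t *v (F t *v x + (1/2) *\<^sub>R f t))"
proof -
  define w where "w = F t *v x + (1/2) *\<^sub>R f t"
  define v where "v = transpose (B t) *v w"
  have "u t x = - (matrix_inv (S t) *v v)"
    by (simp add: u_def u_star_def v_def w_def matrix_vector_linear matrix_vector_mul_assoc matrix_mul_assoc
        del: transpose_matrix_vector)
  then have "u t x \<bullet> (S t *v u t x) = (matrix_inv (S t) *v v) \<bullet> v"
    by (simp add: matrix_vector_linear matrix_vector_mul_assoc pd_mat_inverse[OF pd_S[OF t]])
  also have "\<dots> = w \<bullet> (B t *v (matrix_inv (S t) *v v))"
    using inner_transpose[of "B t" "matrix_inv (S t) *v v" w] by (simp add: v_def inner_commute del: transpose_matrix_vector)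
  finally show ?thesis
    by (simp add: v_def K_def w_def matrix_vector_mul_assoc matrix_mul_assoc del: transpose_matrix_vector)
qed

subsection \<open>Noise and mean trajectory\<close>

text \<open>What is left of the agent's filter when the drift of the observation is removed as well:
  a version of the Wiener integral of \<open>\<T> ** \<sigma>W\<close> against \<open>W\<close>.
  Defining it through the paths makes it continuous in time from the start.\<close>

definition noise :: "(real \<Rightarrow> real^'d) \<Rightarrow> (real \<Rightarrow> real^'m) \<Rightarrow> real \<Rightarrow> 'w \<Rightarrow> real^'d" where
  "noise \<rho> \<tau> t \<omega> = Xa \<rho> \<tau> t \<omega> - x0
     - integral {0..t} (\<lambda>s. A s *v Xa \<rho> \<tau> s \<omega> + B s *v u s (Xa \<rho> \<tau> s \<omega>) + a s - \<T> s *v (H s *v Xa \<rho> \<tau> s \<omega> + h s))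
     - integral {0..t} (\<lambda>s. \<T> s *v (H s *v Xc \<rho> \<tau> s \<omega> + h s + \<tau> s))"

text \<open>The dynamics in the original controls, hence with the filter term \<open>\<T> H\<close>
  that is absent from \<open>drift_blk\<close>. Processes and mean trajectory share it for every
  attack.\<close>

definition sys_drift :: "real \<Rightarrow> 'd state_pair \<Rightarrow>\<^sub>L 'd state_pair" where
  "sys_drift t = blk (A t) (- (K t ** F t)) (\<T> t ** H t) (A t - K t ** F t - \<T> t ** H t)"

definition sys_input :: "(real \<Rightarrow> real^'d) \<Rightarrow> (real \<Rightarrow> real^'m) \<Rightarrow> real \<Rightarrow> 'd state_pair" where
  "sys_input \<rho> \<tau> t = (offset K a f t + \<rho> t, offset K a f t + \<T> t *v \<tau> t)"

text \<open>The pair of means, introduced as an ODE solution and not as expectations: the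
  fluctuation can then be defined before any integrability of the states is known.
  \<open>means\<close> identifies the two afterwards.\<close>

definition traj :: "(real \<Rightarrow> real^'d) \<Rightarrow> (real \<Rightarrow> real^'m) \<Rightarrow> real \<Rightarrow> 'd state_pair" where
  "traj \<rho> \<tau> = (SOME z. z 0 = (x0, x0) \<and>
     (\<forall>t\<in>{0..T}. (z has_vector_derivative sys_drift t (z t) + sys_input \<rho> \<tau> t) (at t within {0..T})))"

lemma cont_sys_drift: "continuous_on {0..T} sys_drift"
  unfolding sys_drift_def[abs_def]
  by (intro continuous_on_blk continuous_on_matrix_mult continuous_intros cont_A cont_K cont_F cont_\<T> cont_H)

lemma cont_sys_input: "(\<rho>, \<tau>) \<in> det_attacks T \<Longrightarrow> continuous_on {0..T} (sys_input \<rho> \<tau>)"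
  unfolding sys_input_def[abs_def] offset_def det_attacks_def
  by (auto intro!: continuous_intros continuous_on_matrix_vector cont_a cont_K cont_f cont_\<T>)

lemma traj:
  assumes "(\<rho>, \<tau>) \<in> det_attacks T"
  shows "traj \<rho> \<tau> 0 = (x0, x0)"
    "\<And>t. t \<in> {0..T} \<Longrightarrow> (traj \<rho> \<tau> has_vector_derivative sys_drift t (traj \<rho> \<tau> t) + sys_input \<rho> \<tau> t) (at t within {0..T})"
  using someI_ex[OF linear_ode_exists[OF less_imp_le[OF T] cont_sys_drift cont_sys_input[OF assms], of "(x0, x0)"]]
  unfolding traj_def[symmetric] by auto

lemma cont_traj: "(\<rho>, \<tau>) \<in> det_attacks T \<Longrightarrow> continuous_on {0..T} (traj \<rho> \<tau>)"
  by (rule derivative_imp_continuous[OF traj(2)])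

context
  fixes \<rho> :: "real \<Rightarrow> real^'d" and \<tau> :: "real \<Rightarrow> real^'m"
  assumes att: "(\<rho>, \<tau>) \<in> det_attacks T"
begin

lemma cont_attack: "continuous_on {0..T} \<rho>" "continuous_on {0..T} \<tau>"
  using att by (auto simp: det_attacks_def)

lemma sys_continuous:
  "continuous_process M {0..T} (Xc \<rho> \<tau>)" "continuous_process M {0..T} (Yc \<rho> \<tau>)"
  "continuous_process M {0..T} (Xa \<rho> \<tau>)" "continuous_process M {0..T} (Xh \<rho> \<tau>)"
  using system[OF att] by (auto simp: attacked_system_def)

lemma path_continuous:
  assumes "\<omega> \<in> space M"
  shows "continuous_on {0..T} (\<lambda>t. Xc \<rho> \<tau> t \<omega>)" "continuous_on {0..T} (\<lambda>t. Xa \<rho> \<tau> t \<omega>)" "continuous_on {0..T} (\<lambda>t. Xh \<rho> \<tau> t \<omega>)"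
  using sys_continuous assms by (auto simp: continuous_process_def)

lemma observation_drift_continuous:
  "\<omega> \<in> space M \<Longrightarrow> continuous_on {0..T} (\<lambda>s. H s *v Xc \<rho> \<tau> s \<omega> + h s + \<tau> s)"
  "\<omega> \<in> space M \<Longrightarrow> continuous_on {0..T} (\<lambda>s. \<T> s *v (H s *v Xc \<rho> \<tau> s \<omega> + h s + \<tau> s))"
  by (intro continuous_intros continuous_on_matrix_vector path_continuous cont_H cont_h cont_\<T> cont_attack; assumption)+

lemma filter_drift_continuous:
  "\<omega> \<in> space M \<Longrightarrow> continuous_on {0..T} (\<lambda>s. A s *v Xa \<rho> \<tau> s \<omega> + B s *v u s (Xa \<rho> \<tau> s \<omega>) + a s - \<T> s *v (H s *v Xa \<rho> \<tau> s \<omega> + h s))"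
  by (intro continuous_intros continuous_on_matrix_vector path_continuous cont_H cont_h cont_\<T> cont_A cont_B cont_u cont_a; assumption)

lemma noise_continuous: "\<omega> \<in> space M \<Longrightarrow> continuous_on {0..T} (\<lambda>t. noise \<rho> \<tau> t \<omega>)"
  unfolding noise_def
  by (intro continuous_intros path_continuous indefinite_integral_continuous_1 integrable_continuous_real
      observation_drift_continuous filter_drift_continuous; assumption)

text \<open>The filter integral is the limit of sums against the observation. Subtracting the sums
  against \<open>W\<close> leaves sums against an absolutely continuous path, which converge
  pathwise to the drift term in \<open>noise\<close>. The remaining Wiener sums do not involve the
  attack.\<close>

lemma noise_conv_prob:
  assumes t: "t \<in> {0..T}"
  shows "conv_prob M (\<lambda>n. stoch_sum (\<lambda>s. \<T> s ** \<sigma>W) W t n) (noise \<rho> \<tau> t)"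
proof -
  define I where "I \<omega> = Xa \<rho> \<tau> t \<omega> - x0 - integral {0..t} (\<lambda>s. A s *v Xa \<rho> \<tau> s \<omega> + B s *v u s (Xa \<rho> \<tau> s \<omega>) + a s
      - \<T> s *v (H s *v Xa \<rho> \<tau> s \<omega> + h s))" for \<omega>
  define D where "D \<omega> = integral {0..t} (\<lambda>s. \<T> s *v (H s *v Xc \<rho> \<tau> s \<omega> + h s + \<tau> s))" for \<omega>
  have W_meas: "W s \<in> borel_measurable M" if "s \<in> {0..t}" for s
    using brownian(2) that by (auto simp: brownian_motion_def continuous_process_def)
  have Y_meas: "Yc \<rho> \<tau> s \<in> borel_measurable M" if "s \<in> {0..t}" for s
    using sys_continuous(2) that t by (auto simp: continuous_process_def)
  have sums[measurable]: "stoch_sum \<T> (Yc \<rho> \<tau>) t n \<in> borel_measurable M"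
    "stoch_sum (\<lambda>s. \<T> s ** \<sigma>W) W t n \<in> borel_measurable M" for n
    using t by (auto intro: stoch_sum_measurable W_meas Y_meas)
  have "has_stoch_integral M \<T> (Yc \<rho> \<tau>) t I"
    using system[OF att] t unfolding attacked_system_def I_def by blast
  then have I: "conv_prob M (stoch_sum \<T> (Yc \<rho> \<tau>) t) I"
    using sums by (simp add: has_stoch_integral_def conv_prob_def)
  have D: "conv_prob M (\<lambda>n \<omega>. stoch_sum \<T> (Yc \<rho> \<tau>) t n \<omega> - stoch_sum (\<lambda>s. \<T> s ** \<sigma>W) W t n \<omega>) D"
  proof (rule AE_tendsto_conv_prob)
    show "D \<in> borel_measurable M"
      unfolding D_def
    proof (rule process_integral_measurable[OF _ t])
      have "(\<lambda>\<omega>. \<T> s *v (H s *v Xc \<rho> \<tau> s \<omega> + h s + \<tau> s)) \<in> borel_measurable M" if s: "s \<in> {0..T}" for s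
      proof (rule measurable_compose[OF continuous_process_measurable[OF sys_continuous(1) s]])
        show "(\<lambda>x. \<T> s *v (H s *v x + h s + \<tau> s)) \<in> borel_measurable borel"
          by (intro borel_measurable_continuous_onI continuous_intros continuous_on_matrix_vector)
      qed
      then show "continuous_process M {0..T} (\<lambda>s \<omega>. \<T> s *v (H s *v Xc \<rho> \<tau> s \<omega> + h s + \<tau> s))"
        using observation_drift_continuous by (simp add: continuous_process_def)
    qed
    have "AE \<omega> in M. \<forall>t\<in>{0..T}. Yc \<rho> \<tau> t \<omega> = integral {0..t} (\<lambda>s. H s *v Xc \<rho> \<tau> s \<omega> + h s + \<tau> s) + \<sigma>W *v W t \<omega>"
      using system[OF att] unfolding attacked_system_def by blast
    then show "AE \<omega> in M. (\<lambda>n. stoch_sum \<T> (Yc \<rho> \<tau>) t n \<omega> - stoch_sum (\<lambda>s. \<T> s ** \<sigma>W) W t n \<omega>) \<longlonglongrightarrow> D \<omega>"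
      using AE_space
    proof eventually_elim
      case (elim \<omega>)
      let ?I = "\<lambda>s. integral {0..s} (\<lambda>s. H s *v Xc \<rho> \<tau> s \<omega> + h s + \<tau> s)"
      have sub: "{0..t} \<subseteq> {0..T}" using t by auto
      have "stoch_sum \<T> (Yc \<rho> \<tau>) t n \<omega> - stoch_sum (\<lambda>s. \<T> s ** \<sigma>W) W t n \<omega> = stoch_sum \<T> (\<lambda>s _. ?I s) t n \<omega>" for n
        using elim t by (intro stoch_sum_split) auto
      moreover have "(\<lambda>n. stoch_sum \<T> (\<lambda>s _. ?I s) t n \<omega>) \<longlonglongrightarrow> D \<omega>"
        unfolding D_def
        using t by (intro stoch_sum_absolutely_continuous[where c = 0] continuous_on_subset[OF cont_\<T> sub]
            continuous_on_subset[OF observation_drift_continuous(1)[OF elim(2)] sub]) auto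
      ultimately show ?case by simp
    qed
  qed (use sums in measurable)
  from conv_prob_diff[OF I D] show ?thesis
    by (simp add: I_def D_def noise_def[abs_def])
qed

text \<open>Second-moment bound and zero mean hold for the sums, uniformly in \<open>n\<close> and
  \<open>t\<close>, and pass to the limit in probability.\<close>

lemma noise_l2: "l2_process M T (noise \<rho> \<tau>)" "\<And>t. t \<in> {0..T} \<Longrightarrow> expectation (noise \<rho> \<tau> t) = 0"
proof -
  obtain C where C: "0 \<le> C" "\<And>s. s \<in> {0..T} \<Longrightarrow> norm (mv (\<T> s ** \<sigma>W)) \<le> C"
    using continuous_on_bounded_norm[OF continuous_on_mv[OF continuous_on_matrix_mult[OF cont_\<T> continuous_on_const[of _ \<sigma>W]]]]
    by blast
  have bound: "norm ((\<T> s ** \<sigma>W) *v x) \<le> C * norm x" if "s \<in> {0..T}" for s x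
    using order_trans[OF norm_blinfun[of "mv (\<T> s ** \<sigma>W)" x] mult_right_mono[OF C(2)[OF that]]] by simp
  have m: "sq_integrable M (noise \<rho> \<tau> t) \<and> expectation (\<lambda>\<omega>. (norm (noise \<rho> \<tau> t \<omega>))\<^sup>2) \<le> C\<^sup>2 * CARD('q) * T
      \<and> expectation (noise \<rho> \<tau> t) = 0" if t: "t \<in> {0..T}" for t
  proof -
    note s = stoch_sum_moments[OF brownian(2), of t "\<lambda>s. \<T> s ** \<sigma>W" C]
    have s': "sq_integrable M (stoch_sum (\<lambda>s. \<T> s ** \<sigma>W) W t n)" "expectation (stoch_sum (\<lambda>s. \<T> s ** \<sigma>W) W t n) = 0"
      "expectation (\<lambda>\<omega>. (norm (stoch_sum (\<lambda>s. \<T> s ** \<sigma>W) W t n \<omega>))\<^sup>2) \<le> C\<^sup>2 * CARD('q) * t" for n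
      using t by (auto intro!: s bound C)
    have "C\<^sup>2 * CARD('q) * t \<le> C\<^sup>2 * CARD('q) * T" using t by (intro mult_left_mono) auto
    then show ?thesis
      using conv_prob_second_moment[OF noise_conv_prob[OF t] s'(1,3)]
        conv_prob_expectation_zero[OF noise_conv_prob[OF t] s'(1,3,2)] by auto
  qed
  have "continuous_process M {0..T} (noise \<rho> \<tau>)"
    using m noise_continuous by (auto simp: continuous_process_def sq_integrable_def)
  then show "l2_process M T (noise \<rho> \<tau>)" using m unfolding l2_process_def by blast
  show "\<And>t. t \<in> {0..T} \<Longrightarrow> expectation (noise \<rho> \<tau> t) = 0" using m by blast
qed

section \<open>Fluctuations around the mean trajectory\<close>

definition forcing :: "real \<Rightarrow> 'w \<Rightarrow> 'd state_pair" where
  "forcing t \<omega> = ((X0 \<omega> - x0) + \<sigma>V *v V t \<omega>, noise \<rho> \<tau> t \<omega>)"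

definition fluct :: "real \<Rightarrow> 'w \<Rightarrow> 'd state_pair" where
  "fluct t \<omega> = (Xc \<rho> \<tau> t \<omega>, Xa \<rho> \<tau> t \<omega>) - traj \<rho> \<tau> t"

lemma forcing_l2: "l2_process M T forcing" "\<And>t. t \<in> {0..T} \<Longrightarrow> expectation (forcing t) = 0"
proof -
  have psd: "0 \<le> v \<bullet> (R0 *v v)" for v using psd_R0 by (simp add: psd_mat_def)
  note X0m = gaussian_vector_moments[OF X0 psd]
  have X0l2: "sq_integrable M (\<lambda>\<omega>. X0 \<omega> - x0)"
    using sq_integrable_add[OF X0m(1) sq_integrable_const[of "- x0"]] by simp
  have V0: "V 0 \<omega> = 0" if "\<omega> \<in> space M" for \<omega> using brownian(1) that by (simp add: brownian_motion_def)
  have V_eq: "expectation (\<lambda>\<omega>. (norm (V t \<omega> - V 0 \<omega>))\<^sup>2) = expectation (\<lambda>\<omega>. (norm (V t \<omega>))\<^sup>2)"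
    "expectation (\<lambda>\<omega>. V t \<omega> - V 0 \<omega>) = expectation (V t)"
    "integrable M (\<lambda>\<omega>. (norm (V t \<omega> - V 0 \<omega>))\<^sup>2) \<longleftrightarrow> integrable M (\<lambda>\<omega>. (norm (V t \<omega>))\<^sup>2)" for t
    using V0 by (auto cong: Bochner_Integration.integral_cong Bochner_Integration.integrable_cong)
  have Vc: "continuous_process M {0..T} V"
    using brownian(1) unfolding brownian_motion_def continuous_process_def by (auto intro: continuous_on_subset)
  have V: "sq_integrable M (V t) \<and> expectation (\<lambda>\<omega>. (norm (V t \<omega>))\<^sup>2) \<le> CARD('p) * T \<and> expectation (V t) = 0"
    if t: "t \<in> {0..T}" for t
    using brownian_increment[OF brownian(1), of 0 t] t continuous_process_measurable[OF Vc t]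
    by (auto simp: V_eq sq_integrable_def)
  have Vl2: "l2_process M T V" using V Vc unfolding l2_process_def by blast
  have \<sigma>Vl2: "l2_process M T (\<lambda>t \<omega>. \<sigma>V *v V t \<omega>)"
    using l2_process_linear[OF Vl2 continuous_on_const[of _ "mv \<sigma>V"]] by simp
  show "l2_process M T forcing"
    unfolding forcing_def[abs_def] by (intro l2_process_Pair l2_process_add l2_process_const X0l2 \<sigma>Vl2 noise_l2)
  fix t assume t: "t \<in> {0..T}"
  have "expectation (\<lambda>\<omega>. \<sigma>V *v V t \<omega>) = 0"
    by (rule mean_zero_linear[OF l2_process_integrable[OF Vl2 t] _ matrix_vector_mul_bounded_linear]) (use V[OF t] in blast)
  moreover have "expectation (\<lambda>\<omega>. X0 \<omega> - x0) = 0"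
    using X0m sq_integrable_imp_integrable[OF X0m(1)] by (simp add: prob_space)
  moreover have int: "integrable M (\<lambda>\<omega>. X0 \<omega> - x0)" "integrable M (\<lambda>\<omega>. \<sigma>V *v V t \<omega>)" "integrable M (noise \<rho> \<tau> t)"
    by (intro sq_integrable_imp_integrable[OF X0l2] l2_process_integrable[OF \<sigma>Vl2 t] l2_process_integrable[OF noise_l2(1) t])+
  ultimately have "expectation (\<lambda>\<omega>. (X0 \<omega> - x0) + \<sigma>V *v V t \<omega>) = 0" by simp
  moreover have "integrable M (forcing t)"
    using \<open>l2_process M T forcing\<close> t by (rule l2_process_integrable)
  ultimately show "expectation (forcing t) = 0"
    using integral_bounded_linear[OF bounded_linear_fst, of M "forcing t"]
      integral_bounded_linear[OF bounded_linear_snd, of M "forcing t"] noise_l2(2)[OF t]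
    by (simp add: prod_eq_iff forcing_def[abs_def])
qed

lemma traj_integral:
  assumes t: "t \<in> {0..T}"
  shows "traj \<rho> \<tau> t = (x0, x0) + integral {0..t} (\<lambda>s. sys_drift s (traj \<rho> \<tau> s) + sys_input \<rho> \<tau> s)"
  using integral_unique[OF ode_integral[OF traj(2)[OF att] t]] traj(1)[OF att] by (simp add: algebra_simps)

text \<open>The deterministic inputs enter the states and the trajectory identically and cancel in
  the difference. The attack survives only in \<open>noise\<close>.\<close>

lemma fluct_equation: "AE \<omega> in M. \<forall>t\<in>{0..T}. fluct t \<omega> = forcing t \<omega> + integral {0..t} (\<lambda>s. sys_drift s (fluct s \<omega>))"
proof -
  have "AE \<omega> in M. \<forall>t\<in>{0..T}. Xc \<rho> \<tau> t \<omega> = X0 \<omega>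
      + integral {0..t} (\<lambda>s. A s *v Xc \<rho> \<tau> s \<omega> + B s *v u s (Xa \<rho> \<tau> s \<omega>) + a s + \<rho> s) + \<sigma>V *v V t \<omega>"
    using system[OF att] unfolding attacked_system_def by blast
  then show ?thesis
    using AE_space
  proof eventually_elim
    case (elim \<omega>)
    show ?case
    proof
      fix t assume t: "t \<in> {0..T}"
      have sub: "{0..t} \<subseteq> {0..T}" using t by auto
      note pc = path_continuous[OF elim(2)]
      define x where "x s = (Xc \<rho> \<tau> s \<omega>, Xa \<rho> \<tau> s \<omega>)" for s
      have xc: "continuous_on {0..T} x" unfolding x_def by (intro continuous_on_Pair pc)
      \<comment> \<open>\<open>g2\<close> contains both time integrals removed in
        \<open>noise\<close>: the filter drift and the drift of the observation after multiplication
        by the gain.\<close>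
      define g1 g2 where "g1 s = A s *v Xc \<rho> \<tau> s \<omega> + B s *v u s (Xa \<rho> \<tau> s \<omega>) + a s + \<rho> s"
        and "g2 s = (A s *v Xa \<rho> \<tau> s \<omega> + B s *v u s (Xa \<rho> \<tau> s \<omega>) + a s - \<T> s *v (H s *v Xa \<rho> \<tau> s \<omega> + h s))
          + \<T> s *v (H s *v Xc \<rho> \<tau> s \<omega> + h s + \<tau> s)" for s
      have g1: "continuous_on {0..T} g1"
        unfolding g1_def by (intro continuous_intros continuous_on_matrix_vector pc cont_A cont_B cont_u cont_a cont_attack)
      have g2: "continuous_on {0..T} g2"
        unfolding g2_def by (rule continuous_on_add[OF filter_drift_continuous[OF elim(2)] observation_drift_continuous(2)[OF elim(2)]])
      have g: "(g1 s, g2 s) = sys_drift s (x s) + sys_input \<rho> \<tau> s" for s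
        by (simp add: g1_def g2_def x_def sys_drift_def sys_input_def blk_apply offset_def B_u matrix_vector_linear
            matrix_vector_mul_assoc algebra_simps)
      have i2: "integral {0..t} g2 = integral {0..t} (\<lambda>s. A s *v Xa \<rho> \<tau> s \<omega> + B s *v u s (Xa \<rho> \<tau> s \<omega>) + a s
            - \<T> s *v (H s *v Xa \<rho> \<tau> s \<omega> + h s)) + integral {0..t} (\<lambda>s. \<T> s *v (H s *v Xc \<rho> \<tau> s \<omega> + h s + \<tau> s))"
        unfolding g2_def
        by (intro Henstock_Kurzweil_Integration.integral_add integrable_continuous_real
            continuous_on_subset[OF filter_drift_continuous[OF elim(2)] sub]
            continuous_on_subset[OF observation_drift_continuous(2)[OF elim(2)] sub])
      have "x t = (X0 \<omega> + \<sigma>V *v V t \<omega>, x0 + noise \<rho> \<tau> t \<omega>) + (integral {0..t} g1, integral {0..t} g2)"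
        using elim(1) t unfolding i2 by (simp add: x_def g1_def[abs_def] noise_def algebra_simps)
      also have "(integral {0..t} g1, integral {0..t} g2) = integral {0..t} (\<lambda>s. (g1 s, g2 s))"
        by (intro integral_Pair[symmetric] continuous_on_subset[OF g1 sub] continuous_on_subset[OF g2 sub])
      also have "\<dots> = integral {0..t} (\<lambda>s. sys_drift s (x s) + sys_input \<rho> \<tau> s)" by (simp only: g)
      finally have xt: "x t = (X0 \<omega> + \<sigma>V *v V t \<omega>, x0 + noise \<rho> \<tau> t \<omega>) + \<dots>" .
      have int: "(\<lambda>s. sys_drift s (y s) + sys_input \<rho> \<tau> s) integrable_on {0..t}" if "continuous_on {0..T} y" for y
        by (intro integrable_continuous_real continuous_on_subset[OF _ sub] continuous_intros cont_sys_drift cont_sys_input att that)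
      have "integral {0..t} (\<lambda>s. sys_drift s (fluct s \<omega>))
          = integral {0..t} (\<lambda>s. (sys_drift s (x s) + sys_input \<rho> \<tau> s) - (sys_drift s (traj \<rho> \<tau> s) + sys_input \<rho> \<tau> s))"
        by (simp add: fluct_def x_def blinfun.diff_right)
      also have "\<dots> = integral {0..t} (\<lambda>s. sys_drift s (x s) + sys_input \<rho> \<tau> s)
          - integral {0..t} (\<lambda>s. sys_drift s (traj \<rho> \<tau> s) + sys_input \<rho> \<tau> s)"
        by (intro Henstock_Kurzweil_Integration.integral_diff int xc cont_traj att)
      finally show "fluct t \<omega> = forcing t \<omega> + integral {0..t} (\<lambda>s. sys_drift s (fluct s \<omega>))"
        using xt traj_integral[OF t] by (simp add: fluct_def forcing_def x_def prod_eq_iff algebra_simps)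
    qed
  qed
qed

lemma fluct_continuous: "continuous_process M {0..T} fluct"
  unfolding continuous_process_def
proof (intro conjI ballI)
  show "fluct t \<in> borel_measurable M" if t: "t \<in> {0..T}" for t
    unfolding fluct_def[abs_def]
    by (intro borel_measurable_diff borel_measurable_Pair continuous_process_measurable[OF sys_continuous(1) t]
        continuous_process_measurable[OF sys_continuous(3) t] borel_measurable_const)
  show "continuous_on {0..T} (\<lambda>t. fluct t \<omega>)" if "\<omega> \<in> space M" for \<omega>
    unfolding fluct_def by (intro continuous_intros path_continuous that cont_traj att)
qed

lemma fluct_l2: "l2_process M T fluct" "\<And>t. t \<in> {0..T} \<Longrightarrow> expectation (fluct t) = 0"
  using linear_process_moments[OF T cont_sys_drift forcing_l2 fluct_continuous fluct_equation] by auto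

lemma fluct_components:
  "l2_process M T (\<lambda>t \<omega>. fst (fluct t \<omega>))" "l2_process M T (\<lambda>t \<omega>. snd (fluct t \<omega>))"
  "\<And>t. t \<in> {0..T} \<Longrightarrow> expectation (\<lambda>\<omega>. fst (fluct t \<omega>)) = 0" "\<And>t. t \<in> {0..T} \<Longrightarrow> expectation (\<lambda>\<omega>. snd (fluct t \<omega>)) = 0"
  "\<And>t. t \<in> {0..T} \<Longrightarrow> integrable M (fluct t)"
proof -
  show int: "integrable M (fluct t)" if "t \<in> {0..T}" for t
    using fluct_l2(1) that by (rule l2_process_integrable)
  show "l2_process M T (\<lambda>t \<omega>. fst (fluct t \<omega>))"
    using l2_process_linear[OF fluct_l2(1) continuous_on_const[of _ "Blinfun fst"]]
    by (simp add: bounded_linear_Blinfun_apply bounded_linear_fst)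
  show "l2_process M T (\<lambda>t \<omega>. snd (fluct t \<omega>))"
    using l2_process_linear[OF fluct_l2(1) continuous_on_const[of _ "Blinfun snd"]]
    by (simp add: bounded_linear_Blinfun_apply bounded_linear_snd)
  show "expectation (\<lambda>\<omega>. fst (fluct t \<omega>)) = 0" "expectation (\<lambda>\<omega>. snd (fluct t \<omega>)) = 0" if "t \<in> {0..T}" for t
    by (intro mean_zero_linear[OF int[OF that] fluct_l2(2)[OF that]] bounded_linear_fst bounded_linear_snd)+
qed

lemma state_decomposition:
  "Xc \<rho> \<tau> t \<omega> = fst (traj \<rho> \<tau> t) + fst (fluct t \<omega>)" "Xa \<rho> \<tau> t \<omega> = snd (traj \<rho> \<tau> t) + snd (fluct t \<omega>)"
  by (simp_all add: fluct_def)

lemma means: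
  assumes t: "t \<in> {0..T}"
  shows "expectation (Xc \<rho> \<tau> t) = fst (traj \<rho> \<tau> t)" "expectation (Xa \<rho> \<tau> t) = snd (traj \<rho> \<tau> t)"
    "integrable M (Xc \<rho> \<tau> t)"
proof -
  have X: "Xc \<rho> \<tau> t = (\<lambda>\<omega>. fst (traj \<rho> \<tau> t) + fst (fluct t \<omega>))" "Xa \<rho> \<tau> t = (\<lambda>\<omega>. snd (traj \<rho> \<tau> t) + snd (fluct t \<omega>))"
    by (auto simp: state_decomposition)
  note i = fluct_components(5)[OF t]
  show "expectation (Xc \<rho> \<tau> t) = fst (traj \<rho> \<tau> t)" "expectation (Xa \<rho> \<tau> t) = snd (traj \<rho> \<tau> t)"
    "integrable M (Xc \<rho> \<tau> t)"
    unfolding X using i fluct_components(3,4)[OF t] by (simp_all add: prob_space)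
qed

end

end

section \<open>Comparison of two attacks\<close>

text \<open>Jensen's inequality for the square, component by component; the squared norm is the sum
  of the squared components.\<close>

lemma (in prob_space) vec_cond_exp_moments:
  fixes X :: "'a \<Rightarrow> real^'n"
  assumes G: "subalgebra M G" and X: "sq_integrable M X"
  shows "sq_integrable M (vec_cond_exp M G X)" "expectation (vec_cond_exp M G X) = expectation X"
    "expectation (\<lambda>\<omega>. (norm (vec_cond_exp M G X \<omega>))\<^sup>2) \<le> expectation (\<lambda>\<omega>. (norm (X \<omega>))\<^sup>2)"
proof -
  interpret G: sigma_finite_subalgebra M G by (rule sigma_finite_subalgebraI[OF G])
  have Xi: "integrable M (\<lambda>\<omega>. X \<omega> $ i)" "(\<lambda>\<omega>. X \<omega> $ i) \<in> borel_measurable M" for i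
    using integral_vec_nth(1)[OF sq_integrable_imp_integrable[OF X]] by auto
  have Xi2: "integrable M (\<lambda>\<omega>. (X \<omega> $ i)\<^sup>2)" for i
    using sq_integrable_linear[OF X bounded_linear_vec_nth, of i] by (simp add: sq_integrable_def)
  have conv: "convex_on UNIV (\<lambda>x :: real. x\<^sup>2)" by (rule convex_power2)
  define C where "C i = real_cond_exp M G (\<lambda>\<omega>. X \<omega> $ i)" for i
  have nth: "vec_cond_exp M G X \<omega> $ i = C i \<omega>" for \<omega> i by (simp add: vec_cond_exp_def C_def)
  have Cint: "integrable M (C i)" "expectation (C i) = expectation (\<lambda>\<omega>. X \<omega> $ i)" for i
    unfolding C_def by (rule G.real_cond_exp_int[OF Xi(1)])+
  have C2: "integrable M (\<lambda>\<omega>. (C i \<omega>)\<^sup>2)" for i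
    unfolding C_def by (rule G.integrable_convex_cond_exp[OF Xi(1) _ _ Xi2 conv]) auto
  have le: "expectation (\<lambda>\<omega>. (C i \<omega>)\<^sup>2) \<le> expectation (\<lambda>\<omega>. (X \<omega> $ i)\<^sup>2)" for i
  proof -
    have "AE \<omega> in M. (C i \<omega>)\<^sup>2 \<le> real_cond_exp M G (\<lambda>\<omega>. (X \<omega> $ i)\<^sup>2) \<omega>"
      unfolding C_def by (rule G.real_cond_exp_jensens_inequality(2)[OF Xi(1) _ _ Xi2 conv]) auto
    then have "expectation (\<lambda>\<omega>. (C i \<omega>)\<^sup>2) \<le> expectation (real_cond_exp M G (\<lambda>\<omega>. (X \<omega> $ i)\<^sup>2))"
      by (intro integral_mono_AE C2 G.real_cond_exp_int(1) Xi2)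
    then show ?thesis using G.real_cond_exp_int(2)[OF Xi2] by simp
  qed
  have meas: "vec_cond_exp M G X \<in> borel_measurable M"
  proof -
    have "(\<lambda>\<omega>. vec_cond_exp M G X \<omega> \<bullet> b) \<in> borel_measurable M" if "b \<in> Basis" for b
      using that Cint(1) by (auto simp: Basis_vec_def inner_axis nth)
    then show ?thesis by (simp add: borel_measurable_euclidean_space[of "vec_cond_exp M G X"])
  qed
  show sq: "sq_integrable M (vec_cond_exp M G X)"
    unfolding sq_integrable_def norm_vec_square nth using meas C2 by auto
  show "expectation (vec_cond_exp M G X) = expectation X"
    using integral_vec_nth(2)[OF sq_integrable_imp_integrable[OF sq]] integral_vec_nth(2)[OF sq_integrable_imp_integrable[OF X]] Cint(2)
    by (simp add: vec_eq_iff nth)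
  show "expectation (\<lambda>\<omega>. (norm (vec_cond_exp M G X \<omega>))\<^sup>2) \<le> expectation (\<lambda>\<omega>. (norm (X \<omega>))\<^sup>2)"
    unfolding norm_vec_square nth using C2 Xi2 le by (simp add: sum_mono)
qed

lemma (in prob_space) l2_process_deterministic:
  fixes y :: "real \<Rightarrow> 'b::euclidean_space"
  assumes y: "continuous_on {0..T} y" shows "l2_process M T (\<lambda>t \<omega>. y t)"
proof -
  obtain B where B: "\<And>t. t \<in> {0..T} \<Longrightarrow> norm (y t) \<le> B" using continuous_on_bounded_norm[OF y] by blast
  then have "(norm (y t))\<^sup>2 \<le> B\<^sup>2" if "t \<in> {0..T}" for t using that by (intro power_mono) auto
  then show ?thesis
    using y by (auto simp: l2_process_def continuous_process_def sq_integrable_const prob_space intro!: exI[of _ "B\<^sup>2"])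
qed

context attack_setup
begin

context
  fixes \<rho> \<rho>' :: "real \<Rightarrow> real^'d" and \<tau> \<tau>' :: "real \<Rightarrow> real^'m"
  assumes att: "(\<rho>, \<tau>) \<in> det_attacks T" and att': "(\<rho>', \<tau>') \<in> det_attacks T"
begin

text \<open>Both sides are limits in probability of the same Wiener sums, hence equal at each time
  almost surely, and then at all times by continuity.\<close>

lemma noise_eq: "AE \<omega> in M. \<forall>t\<in>{0..T}. noise \<rho> \<tau> t \<omega> = noise \<rho>' \<tau>' t \<omega>"
  by (intro AE_paths_eq noise_continuous att att' conv_prob_unique[OF noise_conv_prob noise_conv_prob])

text \<open>Equal noises give equal forcings, so the difference of the two fluctuations solves a
  homogeneous linear equation path by path.\<close>

lemma fluct_eq: "AE \<omega> in M. \<forall>t\<in>{0..T}. fluct \<rho> \<tau> t \<omega> = fluct \<rho>' \<tau>' t \<omega>"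
  using fluct_equation[OF att] fluct_equation[OF att'] noise_eq AE_space
proof eventually_elim
  case (elim \<omega>)
  obtain C where C: "0 \<le> C" "\<And>t. t \<in> {0..T} \<Longrightarrow> norm (sys_drift t) \<le> C"
    using continuous_on_bounded_norm[OF cont_sys_drift] by blast
  define D where "D t = fluct \<rho> \<tau> t \<omega> - fluct \<rho>' \<tau>' t \<omega>" for t
  note c = continuous_process_path[OF fluct_continuous[OF att] elim(4)]
  note c' = continuous_process_path[OF fluct_continuous[OF att'] elim(4)]
  have "D t = 0 + integral {0..t} (\<lambda>s. sys_drift s (D s))" if t: "t \<in> {0..T}" for t
  proof -
    have sub: "{0..t} \<subseteq> {0..T}" using t by auto
    have "forcing \<rho> \<tau> t \<omega> = forcing \<rho>' \<tau>' t \<omega>" using elim(3) t by (simp add: forcing_def att att')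
    then have "D t = integral {0..t} (\<lambda>s. sys_drift s (fluct \<rho> \<tau> s \<omega>)) - integral {0..t} (\<lambda>s. sys_drift s (fluct \<rho>' \<tau>' s \<omega>))"
      using elim(1,2) t by (simp add: D_def)
    also have "\<dots> = integral {0..t} (\<lambda>s. sys_drift s (fluct \<rho> \<tau> s \<omega>) - sys_drift s (fluct \<rho>' \<tau>' s \<omega>))"
      by (intro Henstock_Kurzweil_Integration.integral_diff[symmetric] integrable_continuous_real
          continuous_on_subset[OF _ sub] continuous_intros cont_sys_drift c c')
    finally show ?thesis by (simp add: D_def blinfun.diff_right)
  qed
  moreover have "continuous_on {0..T} D" unfolding D_def by (intro continuous_intros c c')
  ultimately have "D t = 0" if "t \<in> {0..T}" for t
    using linear_integral_equation_bound[OF _ continuous_on_const cont_sys_drift C _ that, of D 0] by simp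
  then show ?case by (simp add: D_def)
qed

lemma observation_shift:
  "AE \<omega> in M. \<forall>s\<in>{0..T}. Yc \<rho> \<tau> s \<omega> = Yc \<rho>' \<tau>' s \<omega>
     + integral {0..s} (\<lambda>v. H v *v (fst (traj \<rho> \<tau> v) - fst (traj \<rho>' \<tau>' v)) + (\<tau> v - \<tau>' v))"
proof -
  have Y: "AE \<omega> in M. \<forall>t\<in>{0..T}. Yc \<rho> \<tau> t \<omega> = integral {0..t} (\<lambda>s. H s *v Xc \<rho> \<tau> s \<omega> + h s + \<tau> s) + \<sigma>W *v W t \<omega>"
    "AE \<omega> in M. \<forall>t\<in>{0..T}. Yc \<rho>' \<tau>' t \<omega> = integral {0..t} (\<lambda>s. H s *v Xc \<rho>' \<tau>' s \<omega> + h s + \<tau>' s) + \<sigma>W *v W t \<omega>"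
    using system[OF att] system[OF att'] unfolding attacked_system_def by blast+
  show ?thesis
    using Y fluct_eq AE_space
  proof eventually_elim
    case (elim \<omega>)
    show ?case
    proof
      fix s assume s: "s \<in> {0..T}"
      have sub: "{0..s} \<subseteq> {0..T}" using s by auto
      have "integral {0..s} (\<lambda>s. H s *v Xc \<rho> \<tau> s \<omega> + h s + \<tau> s) - integral {0..s} (\<lambda>s. H s *v Xc \<rho>' \<tau>' s \<omega> + h s + \<tau>' s)
          = integral {0..s} (\<lambda>s. (H s *v Xc \<rho> \<tau> s \<omega> + h s + \<tau> s) - (H s *v Xc \<rho>' \<tau>' s \<omega> + h s + \<tau>' s))"
        by (intro Henstock_Kurzweil_Integration.integral_diff[symmetric] integrable_continuous_real
            continuous_on_subset[OF observation_drift_continuous(1)[OF att elim(4)] sub]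
            continuous_on_subset[OF observation_drift_continuous(1)[OF att' elim(4)] sub])
      also have "\<dots> = integral {0..s} (\<lambda>v. H v *v (fst (traj \<rho> \<tau> v) - fst (traj \<rho>' \<tau>' v)) + (\<tau> v - \<tau>' v))"
      proof (rule Henstock_Kurzweil_Integration.integral_cong)
        fix v assume "v \<in> {0..s}"
        then have "fluct \<rho> \<tau> v \<omega> = fluct \<rho>' \<tau>' v \<omega>" using elim(3) s by auto
        then show "(H v *v Xc \<rho> \<tau> v \<omega> + h v + \<tau> v) - (H v *v Xc \<rho>' \<tau>' v \<omega> + h v + \<tau>' v)
            = H v *v (fst (traj \<rho> \<tau> v) - fst (traj \<rho>' \<tau>' v)) + (\<tau> v - \<tau>' v)"
          by (simp add: state_decomposition[OF att] state_decomposition[OF att'] matrix_vector_linear)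
      qed
      finally show "Yc \<rho> \<tau> s \<omega> = Yc \<rho>' \<tau>' s \<omega>
          + integral {0..s} (\<lambda>v. H v *v (fst (traj \<rho> \<tau> v) - fst (traj \<rho>' \<tau>' v)) + (\<tau> v - \<tau>' v))"
        using elim(1,2) s by (simp add: algebra_simps)
    qed
  qed
qed

text \<open>Deterministic attacks shift the observations by a deterministic path, so up to null sets all
  of them generate the same filtration; no explicit filter equation for \<open>Xh\<close> is needed.\<close>

lemma estimate_shift:
  assumes t: "t \<in> {0..T}"
  shows "AE \<omega> in M. Xh \<rho> \<tau> t \<omega> - fst (traj \<rho> \<tau> t) = Xh \<rho>' \<tau>' t \<omega> - fst (traj \<rho>' \<tau>' t)"
proof -
  let ?F = "process_sigma M {0..t} (Yc \<rho> \<tau>)" and ?F' = "process_sigma M {0..t} (Yc \<rho>' \<tau>')"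
  have Ym: "Yc \<rho> \<tau> s \<in> borel_measurable M" "Yc \<rho>' \<tau>' s \<in> borel_measurable M" if "s \<in> {0..t}" for s
    using that t continuous_process_measurable[OF sys_continuous(2)[OF att]]
      continuous_process_measurable[OF sys_continuous(2)[OF att']] by auto
  have sub': "subalgebra M ?F'" by (rule subalgebra_process_sigma[OF Ym(2)])
  interpret F': sigma_finite_subalgebra M ?F' by (rule sigma_finite_subalgebraI[OF sub'])
  define k where "k = fst (traj \<rho> \<tau> t) - fst (traj \<rho>' \<tau>' t)"
  have comp: "AE \<omega> in M. real_cond_exp M ?F (\<lambda>\<omega>. Xc \<rho> \<tau> t \<omega> $ i) \<omega> = real_cond_exp M ?F' (\<lambda>\<omega>. Xc \<rho>' \<tau>' t \<omega> $ i) \<omega> + k $ i" for i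
  proof -
    note int = integral_vec_nth(1)[OF means(3)[OF att t], of i] and int' = integral_vec_nth(1)[OF means(3)[OF att' t], of i]
    have "AE \<omega> in M. \<forall>s\<in>{0..t}. Yc \<rho> \<tau> s \<omega> = Yc \<rho>' \<tau>' s \<omega>
        + integral {0..s} (\<lambda>v. H v *v (fst (traj \<rho> \<tau> v) - fst (traj \<rho>' \<tau>' v)) + (\<tau> v - \<tau>' v))"
      using observation_shift by eventually_elim (use t in auto)
    \<comment> \<open>The filtration is exchanged first and the integrand afterwards, so that all
      further identities concern the single sigma-algebra \<open>?F'\<close>.\<close>
    from real_cond_exp_process_shift[OF Ym this int]
    have 1: "AE \<omega> in M. real_cond_exp M ?F (\<lambda>\<omega>. Xc \<rho> \<tau> t \<omega> $ i) \<omega> = real_cond_exp M ?F' (\<lambda>\<omega>. Xc \<rho> \<tau> t \<omega> $ i) \<omega>"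
      by simp
    have "AE \<omega> in M. Xc \<rho> \<tau> t \<omega> $ i = Xc \<rho>' \<tau>' t \<omega> $ i + k $ i"
      using fluct_eq by eventually_elim
        (use t in \<open>simp add: state_decomposition(1)[OF att] state_decomposition(1)[OF att'] k_def\<close>)
    then have 2: "AE \<omega> in M. real_cond_exp M ?F' (\<lambda>\<omega>. Xc \<rho> \<tau> t \<omega> $ i) \<omega> = real_cond_exp M ?F' (\<lambda>\<omega>. Xc \<rho>' \<tau>' t \<omega> $ i + k $ i) \<omega>"
      using int int' by (intro F'.real_cond_exp_cong) auto
    have 3: "AE \<omega> in M. real_cond_exp M ?F' (\<lambda>\<omega>. Xc \<rho>' \<tau>' t \<omega> $ i + k $ i) \<omega>
        = real_cond_exp M ?F' (\<lambda>\<omega>. Xc \<rho>' \<tau>' t \<omega> $ i) \<omega> + real_cond_exp M ?F' (\<lambda>\<omega>. k $ i) \<omega>"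
      by (rule F'.real_cond_exp_add[OF int']) simp
    have 4: "AE \<omega> in M. real_cond_exp M ?F' (\<lambda>\<omega>. k $ i) \<omega> = k $ i"
      by (rule F'.real_cond_exp_F_meas) auto
    show ?thesis using 1 2 3 4 by eventually_elim simp
  qed
  have "AE \<omega> in M. \<forall>i\<in>UNIV. real_cond_exp M ?F (\<lambda>\<omega>. Xc \<rho> \<tau> t \<omega> $ i) \<omega> = real_cond_exp M ?F' (\<lambda>\<omega>. Xc \<rho>' \<tau>' t \<omega> $ i) \<omega> + k $ i"
    by (rule AE_finite_allI) (auto intro: comp)
  moreover have "AE \<omega> in M. Xh \<rho> \<tau> t \<omega> = vec_cond_exp M ?F (Xc \<rho> \<tau> t) \<omega>" "AE \<omega> in M. Xh \<rho>' \<tau>' t \<omega> = vec_cond_exp M ?F' (Xc \<rho>' \<tau>' t) \<omega>"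
    using system[OF att] system[OF att'] t unfolding attacked_system_def by blast+
  ultimately show ?thesis
    by eventually_elim (simp add: vec_eq_iff vec_cond_exp_def k_def)
qed

end

text \<open>The centred part of \<open>\<Delta>X\<close>; it is the random part of the detection
  term that remains once \<open>detect\<close> is split off.\<close>

definition est_fluct :: "(real \<Rightarrow> real^'d) \<Rightarrow> (real \<Rightarrow> real^'m) \<Rightarrow> real \<Rightarrow> 'w \<Rightarrow> real^'d" where
  "est_fluct \<rho> \<tau> t \<omega> = (Xh \<rho> \<tau> t \<omega> - fst (traj \<rho> \<tau> t)) - snd (fluct \<rho> \<tau> t \<omega>)"

lemma est_fluct_eq:
  assumes att: "(\<rho>, \<tau>) \<in> det_attacks T" and att': "(\<rho>', \<tau>') \<in> det_attacks T"
  shows "AE \<omega> in M. \<forall>t\<in>{0..T}. est_fluct \<rho> \<tau> t \<omega> = est_fluct \<rho>' \<tau>' t \<omega>"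
proof -
  have "AE \<omega> in M. \<forall>t\<in>{0..T}. Xh \<rho> \<tau> t \<omega> - fst (traj \<rho> \<tau> t) = Xh \<rho>' \<tau>' t \<omega> - fst (traj \<rho>' \<tau>' t)"
    by (intro AE_paths_eq estimate_shift[OF att att'] continuous_intros path_continuous(3)[OF att] path_continuous(3)[OF att']
        cont_traj att att')
  with fluct_eq[OF att att'] show ?thesis by eventually_elim (simp add: est_fluct_def)
qed

context
  fixes \<rho> :: "real \<Rightarrow> real^'d" and \<tau> :: "real \<Rightarrow> real^'m"
  assumes att: "(\<rho>, \<tau>) \<in> det_attacks T"
begin

lemma estimate_l2: "l2_process M T (Xh \<rho> \<tau>)" "\<And>t. t \<in> {0..T} \<Longrightarrow> expectation (Xh \<rho> \<tau> t) = fst (traj \<rho> \<tau> t)"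
proof -
  have "l2_process M T (\<lambda>t \<omega>. fst (traj \<rho> \<tau> t) + fst (fluct \<rho> \<tau> t \<omega>))"
    by (intro l2_process_add l2_process_deterministic fluct_components[OF att] continuous_intros cont_traj[OF att])
  then have "l2_process M T (Xc \<rho> \<tau>)" by (simp add: state_decomposition(1)[OF att, symmetric])
  then obtain B where B: "\<And>t. t \<in> {0..T} \<Longrightarrow> sq_integrable M (Xc \<rho> \<tau> t)"
    "\<And>t. t \<in> {0..T} \<Longrightarrow> expectation (\<lambda>\<omega>. (norm (Xc \<rho> \<tau> t \<omega>))\<^sup>2) \<le> B" by (rule l2_processE) blast
  have m: "sq_integrable M (Xh \<rho> \<tau> t) \<and> expectation (\<lambda>\<omega>. (norm (Xh \<rho> \<tau> t \<omega>))\<^sup>2) \<le> B \<and> expectation (Xh \<rho> \<tau> t) = fst (traj \<rho> \<tau> t)"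
    if t: "t \<in> {0..T}" for t
  proof -
    let ?F = "process_sigma M {0..t} (Yc \<rho> \<tau>)"
    have "subalgebra M ?F"
      by (rule subalgebra_process_sigma) (use t continuous_process_measurable[OF sys_continuous(2)[OF att]] in auto)
    note v = vec_cond_exp_moments[OF this B(1)[OF t]]
    have ae: "AE \<omega> in M. Xh \<rho> \<tau> t \<omega> = vec_cond_exp M ?F (Xc \<rho> \<tau> t) \<omega>"
      using system[OF att] t unfolding attacked_system_def by blast
    have [measurable]: "Xh \<rho> \<tau> t \<in> borel_measurable M" by (rule continuous_process_measurable[OF sys_continuous(4)[OF att] t])
    have [measurable]: "vec_cond_exp M ?F (Xc \<rho> \<tau> t) \<in> borel_measurable M" using v(1) by (simp add: sq_integrable_def)
    have "integrable M (\<lambda>\<omega>. (norm (Xh \<rho> \<tau> t \<omega>))\<^sup>2)"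
      using v(1) by (subst integrable_cong_AE[of _ _ "\<lambda>\<omega>. (norm (vec_cond_exp M ?F (Xc \<rho> \<tau> t) \<omega>))\<^sup>2"])
        (use ae in \<open>auto simp: sq_integrable_def elim!: eventually_mono\<close>)
    moreover have "expectation (\<lambda>\<omega>. (norm (Xh \<rho> \<tau> t \<omega>))\<^sup>2) = expectation (\<lambda>\<omega>. (norm (vec_cond_exp M ?F (Xc \<rho> \<tau> t) \<omega>))\<^sup>2)"
      by (rule integral_cong_AE) (use ae in \<open>auto elim!: eventually_mono\<close>)
    moreover have "expectation (Xh \<rho> \<tau> t) = expectation (vec_cond_exp M ?F (Xc \<rho> \<tau> t))"
      by (rule integral_cong_AE) (use ae in auto)
    ultimately show ?thesis using v B(2)[OF t] means(1)[OF att t] by (auto simp: sq_integrable_def)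
  qed
  show "l2_process M T (Xh \<rho> \<tau>)" using m sys_continuous(4)[OF att] unfolding l2_process_def by blast
  show "\<And>t. t \<in> {0..T} \<Longrightarrow> expectation (Xh \<rho> \<tau> t) = fst (traj \<rho> \<tau> t)" using m by blast
qed

lemma est_fluct_l2: "l2_process M T (est_fluct \<rho> \<tau>)" "\<And>t. t \<in> {0..T} \<Longrightarrow> expectation (est_fluct \<rho> \<tau> t) = 0"
proof -
  have neg: "l2_process M T (\<lambda>t \<omega>. - snd (fluct \<rho> \<tau> t \<omega>))"
    using l2_process_linear[OF fluct_components(2)[OF att] continuous_on_const[of _ "- id_blinfun"]]
    by (simp add: blinfun.minus_left)
  have "l2_process M T (\<lambda>t \<omega>. (Xh \<rho> \<tau> t \<omega> + - fst (traj \<rho> \<tau> t)) + - snd (fluct \<rho> \<tau> t \<omega>))"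
    by (intro l2_process_add estimate_l2 l2_process_deterministic neg continuous_intros cont_traj[OF att])
  then show "l2_process M T (est_fluct \<rho> \<tau>)" by (simp add: est_fluct_def[abs_def])
  show "expectation (est_fluct \<rho> \<tau> t) = 0" if t: "t \<in> {0..T}" for t
    unfolding est_fluct_def[abs_def]
    using l2_process_integrable[OF estimate_l2(1) t] l2_process_integrable[OF fluct_components(2)[OF att] t]
      estimate_l2(2)[OF t] fluct_components(4)[OF att t] by (simp add: prob_space)
qed

end

section \<open>The objective as a deterministic functional\<close>

definition u_lin :: "real \<Rightarrow> real^'d^'c" where
  "u_lin t = - (matrix_inv (S t) ** transpose (B t) ** F t)"

lemma cont_u_lin: "continuous_on {0..T} u_lin"
  unfolding u_lin_def[abs_def]
  by (intro continuous_intros continuous_on_matrix_mult continuous_on_transpose continuous_on_matrix_inv cont_S pd_S cont_B cont_F)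

definition residual_cost :: "(real \<Rightarrow> real^'d) \<Rightarrow> (real \<Rightarrow> real^'m) \<Rightarrow> real" where
  "residual_cost \<rho> \<tau> =
     (1/2) * expectation (\<lambda>\<omega>. integral {0..T} (\<lambda>t. (H t *v est_fluct \<rho> \<tau> t \<omega>) \<bullet> (\<Sigma>inv *v (H t *v est_fluct \<rho> \<tau> t \<omega>))))
     - lam * (expectation (\<lambda>\<omega>. integral {0..T} (\<lambda>t. fst (fluct \<rho> \<tau> t \<omega>) \<bullet> (Q t *v fst (fluct \<rho> \<tau> t \<omega>))))
       + expectation (\<lambda>\<omega>. integral {0..T} (\<lambda>t. (u_lin t *v snd (fluct \<rho> \<tau> t \<omega>)) \<bullet> (S t *v (u_lin t *v snd (fluct \<rho> \<tau> t \<omega>))))))"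

text \<open>The control variable \<open>w\<close>, seen as a function of the attack; it is the mean
  of \<open>H \<Delta>X + \<tau>\<close>.\<close>

definition detect :: "(real \<Rightarrow> real^'d) \<Rightarrow> (real \<Rightarrow> real^'m) \<Rightarrow> real \<Rightarrow> real^'m" where
  "detect \<rho> \<tau> t = H t *v (fst (traj \<rho> \<tau> t) - snd (traj \<rho> \<tau> t)) + \<tau> t"

definition objective :: "(real \<Rightarrow> real^'d) \<Rightarrow> (real \<Rightarrow> real^'m) \<Rightarrow> real" where
  "objective \<rho> \<tau> = cost_S M T H \<sigma>W \<tau> (Xh \<rho> \<tau>) (Xa \<rho> \<tau>) - lam * cost_D M T Q S r u (Xc \<rho> \<tau>) (Xa \<rho> \<tau>)
     + (1/2) * integral {0..T} (\<lambda>t. \<rho> t \<bullet> (P t *v \<rho> t))"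

definition running_cost :: "(real \<Rightarrow> real^'d) \<Rightarrow> (real \<Rightarrow> real^'m) \<Rightarrow> real \<Rightarrow> real" where
  "running_cost \<rho> \<tau> t = (1/2) * (detect \<rho> \<tau> t \<bullet> (\<Sigma>inv *v detect \<rho> \<tau> t)) + (1/2) * (\<rho> t \<bullet> (P t *v \<rho> t))
     - lam * ((fst (traj \<rho> \<tau> t) - r t) \<bullet> (Q t *v (fst (traj \<rho> \<tau> t) - r t))
       + u t (snd (traj \<rho> \<tau> t)) \<bullet> (S t *v u t (snd (traj \<rho> \<tau> t))))"

lemma residual_cost_const:
  assumes att: "(\<rho>, \<tau>) \<in> det_attacks T" and att': "(\<rho>', \<tau>') \<in> det_attacks T"
  shows "residual_cost \<rho> \<tau> = residual_cost \<rho>' \<tau>'"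
proof -
  have cong: "expectation (\<lambda>\<omega>. integral {0..T} (\<lambda>t. (D t *v Z t \<omega>) \<bullet> (q t *v (D t *v Z t \<omega>))))
      = expectation (\<lambda>\<omega>. integral {0..T} (\<lambda>t. (D t *v Z' t \<omega>) \<bullet> (q t *v (D t *v Z' t \<omega>))))"
    if Z: "l2_process M T Z" "l2_process M T Z'" and ae: "AE \<omega> in M. \<forall>t\<in>{0..T}. Z t \<omega> = Z' t \<omega>"
      and D: "continuous_on {0..T} D" and q: "continuous_on {0..T} q"
    for Z Z' :: "real \<Rightarrow> 'w \<Rightarrow> real^'d" and D :: "real \<Rightarrow> real^'d^'k" and q :: "real \<Rightarrow> real^'k^'k"
  proof (rule integral_cong_AE)
    have "(\<lambda>\<omega>. integral {0..T} (\<lambda>t. (D t *v Z t \<omega>) \<bullet> (q t *v (D t *v Z t \<omega>)))) \<in> borel_measurable M"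
      if Z: "l2_process M T Z" for Z :: "real \<Rightarrow> 'w \<Rightarrow> real^'d"
    proof (rule process_integral_measurable)
      have Zc: "continuous_process M {0..T} Z" using Z by (simp add: l2_process_def)
      have "(\<lambda>\<omega>. (D t *v Z t \<omega>) \<bullet> (q t *v (D t *v Z t \<omega>))) \<in> borel_measurable M" if t: "t \<in> {0..T}" for t
      proof (rule measurable_compose[OF continuous_process_measurable[OF Zc t]])
        show "(\<lambda>x. (D t *v x) \<bullet> (q t *v (D t *v x))) \<in> borel_measurable borel"
          by (intro borel_measurable_continuous_onI continuous_intros continuous_on_matrix_vector)
      qed
      then show "continuous_process M {0..T} (\<lambda>t \<omega>. (D t *v Z t \<omega>) \<bullet> (q t *v (D t *v Z t \<omega>)))"
        unfolding continuous_process_def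
        by (intro conjI ballI continuous_intros continuous_on_matrix_vector D q continuous_process_path[OF Zc])
      show "T \<in> {0..T}" using T by simp
    qed
    then show "(\<lambda>\<omega>. integral {0..T} (\<lambda>t. (D t *v Z t \<omega>) \<bullet> (q t *v (D t *v Z t \<omega>)))) \<in> borel_measurable M"
      "(\<lambda>\<omega>. integral {0..T} (\<lambda>t. (D t *v Z' t \<omega>) \<bullet> (q t *v (D t *v Z' t \<omega>)))) \<in> borel_measurable M"
      using Z by auto
    show "AE \<omega> in M. integral {0..T} (\<lambda>t. (D t *v Z t \<omega>) \<bullet> (q t *v (D t *v Z t \<omega>)))
        = integral {0..T} (\<lambda>t. (D t *v Z' t \<omega>) \<bullet> (q t *v (D t *v Z' t \<omega>)))"
      using ae by eventually_elim (auto intro!: Henstock_Kurzweil_Integration.integral_cong)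
  qed
  have fe: "AE \<omega> in M. \<forall>t\<in>{0..T}. fst (fluct \<rho> \<tau> t \<omega>) = fst (fluct \<rho>' \<tau>' t \<omega>)"
    "AE \<omega> in M. \<forall>t\<in>{0..T}. snd (fluct \<rho> \<tau> t \<omega>) = snd (fluct \<rho>' \<tau>' t \<omega>)"
    using fluct_eq[OF att att'] by (eventually_elim, simp)+
  show ?thesis
    unfolding residual_cost_def
    using cong[OF est_fluct_l2(1)[OF att] est_fluct_l2(1)[OF att'] est_fluct_eq[OF att att'] cont_H continuous_on_const[of _ \<Sigma>inv]]
      cong[OF fluct_components(1)[OF att] fluct_components(1)[OF att'] fe(1) continuous_on_const[of _ "mat 1"] cont_Q]
      cong[OF fluct_components(2)[OF att] fluct_components(2)[OF att'] fe(2) cont_u_lin cont_S]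
    by simp
qed

lemma objective_split:
  assumes att: "(\<rho>, \<tau>) \<in> det_attacks T"
  shows "objective \<rho> \<tau> = integral {0..T} (running_cost \<rho> \<tau>) + residual_cost \<rho> \<tau>"
    "continuous_on {0..T} (detect \<rho> \<tau>)"
proof -
  have zc: "continuous_on {0..T} (\<lambda>t. fst (traj \<rho> \<tau> t))" and za: "continuous_on {0..T} (\<lambda>t. snd (traj \<rho> \<tau> t))"
    by (intro continuous_intros cont_traj att)+
  show det: "continuous_on {0..T} (detect \<rho> \<tau>)"
    unfolding detect_def[abs_def]
    by (intro continuous_intros continuous_on_matrix_vector cont_H zc za cont_attack[OF att])
  have c1: "continuous_on {0..T} (\<lambda>t. fst (traj \<rho> \<tau> t) - r t)" by (intro continuous_intros zc cont_r)
  have c2: "continuous_on {0..T} (\<lambda>t. u t (snd (traj \<rho> \<tau> t)))" by (rule cont_u[OF za])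
  have sym\<Sigma>: "transpose \<Sigma>inv = \<Sigma>inv" by (rule transpose_matrix_inv[OF pd_\<Sigma>])
  have l3: "l2_process M T (\<lambda>t \<omega>. u_lin t *v snd (fluct \<rho> \<tau> t \<omega>))" "l2_process M T (\<lambda>t \<omega>. H t *v est_fluct \<rho> \<tau> t \<omega>)"
    using l2_process_linear[OF fluct_components(2)[OF att] continuous_on_mv[OF cont_u_lin]]
      l2_process_linear[OF est_fluct_l2(1)[OF att] continuous_on_mv[OF cont_H]] by simp_all
  have m3: "expectation (\<lambda>\<omega>. u_lin t *v snd (fluct \<rho> \<tau> t \<omega>)) = 0" "expectation (\<lambda>\<omega>. H t *v est_fluct \<rho> \<tau> t \<omega>) = 0"
    if t: "t \<in> {0..T}" for t
    by (rule mean_zero_linear[OF l2_process_integrable[OF fluct_components(2)[OF att] t] fluct_components(4)[OF att t] matrix_vector_mul_bounded_linear])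
      (rule mean_zero_linear[OF l2_process_integrable[OF est_fluct_l2(1)[OF att] t] est_fluct_l2(2)[OF att t] matrix_vector_mul_bounded_linear])
  let ?e1 = "\<lambda>\<omega>. integral {0..T} (\<lambda>t. ((fst (traj \<rho> \<tau> t) - r t) + fst (fluct \<rho> \<tau> t \<omega>)) \<bullet>
    (Q t *v ((fst (traj \<rho> \<tau> t) - r t) + fst (fluct \<rho> \<tau> t \<omega>))))"
  let ?e2 = "\<lambda>\<omega>. integral {0..T} (\<lambda>t. (u t (snd (traj \<rho> \<tau> t)) + u_lin t *v snd (fluct \<rho> \<tau> t \<omega>)) \<bullet>
    (S t *v (u t (snd (traj \<rho> \<tau> t)) + u_lin t *v snd (fluct \<rho> \<tau> t \<omega>))))"
  have s1: "integrable M ?e1" "expectation ?e1 = integral {0..T} (\<lambda>t. (fst (traj \<rho> \<tau> t) - r t) \<bullet> (Q t *v (fst (traj \<rho> \<tau> t) - r t)))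
        + expectation (\<lambda>\<omega>. integral {0..T} (\<lambda>t. fst (fluct \<rho> \<tau> t \<omega>) \<bullet> (Q t *v fst (fluct \<rho> \<tau> t \<omega>))))"
    by (rule quadratic_cost_split[OF T fluct_components(1)[OF att] fluct_components(3)[OF att] c1 cont_Q sym_Q]; assumption)+
  have s2: "integrable M ?e2" "expectation ?e2 = integral {0..T} (\<lambda>t. u t (snd (traj \<rho> \<tau> t)) \<bullet> (S t *v u t (snd (traj \<rho> \<tau> t))))
        + expectation (\<lambda>\<omega>. integral {0..T} (\<lambda>t. (u_lin t *v snd (fluct \<rho> \<tau> t \<omega>)) \<bullet> (S t *v (u_lin t *v snd (fluct \<rho> \<tau> t \<omega>)))))"
    by (rule quadratic_cost_split[OF T l3(1) m3(1) c2 cont_S sym_S]; assumption)+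
  have s3: "expectation (\<lambda>\<omega>. integral {0..T} (\<lambda>t. (detect \<rho> \<tau> t + H t *v est_fluct \<rho> \<tau> t \<omega>) \<bullet>
        (\<Sigma>inv *v (detect \<rho> \<tau> t + H t *v est_fluct \<rho> \<tau> t \<omega>))))
      = integral {0..T} (\<lambda>t. detect \<rho> \<tau> t \<bullet> (\<Sigma>inv *v detect \<rho> \<tau> t))
      + expectation (\<lambda>\<omega>. integral {0..T} (\<lambda>t. (H t *v est_fluct \<rho> \<tau> t \<omega>) \<bullet> (\<Sigma>inv *v (H t *v est_fluct \<rho> \<tau> t \<omega>))))"
    by (rule quadratic_cost_split(2)[OF T l3(2) m3(2) det continuous_on_const sym\<Sigma>])
  have uX: "u t (Xa \<rho> \<tau> t \<omega>) = u t (snd (traj \<rho> \<tau> t)) + u_lin t *v snd (fluct \<rho> \<tau> t \<omega>)" for t \<omega>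
    unfolding u_def u_star_def u_lin_def state_decomposition(2)[OF att] by (simp add: matrix_vector_linear)
  have XcX: "Xc \<rho> \<tau> t \<omega> - r t = (fst (traj \<rho> \<tau> t) - r t) + fst (fluct \<rho> \<tau> t \<omega>)" for t \<omega>
    unfolding state_decomposition(1)[OF att] by simp
  have det_eq: "H t *v (Xh \<rho> \<tau> t \<omega> - Xa \<rho> \<tau> t \<omega>) + \<tau> t = detect \<rho> \<tau> t + H t *v est_fluct \<rho> \<tau> t \<omega>" for t \<omega>
    unfolding state_decomposition(2)[OF att] detect_def est_fluct_def by (simp add: matrix_vector_linear)
  have S: "cost_S M T H \<sigma>W \<tau> (Xh \<rho> \<tau>) (Xa \<rho> \<tau>) = (1/2) * (integral {0..T} (\<lambda>t. detect \<rho> \<tau> t \<bullet> (\<Sigma>inv *v detect \<rho> \<tau> t))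
      + expectation (\<lambda>\<omega>. integral {0..T} (\<lambda>t. (H t *v est_fluct \<rho> \<tau> t \<omega>) \<bullet> (\<Sigma>inv *v (H t *v est_fluct \<rho> \<tau> t \<omega>)))))"
    unfolding cost_S_def det_eq s3 ..
  have "cost_D M T Q S r u (Xc \<rho> \<tau>) (Xa \<rho> \<tau>)
      = expectation (\<lambda>\<omega>. integral {0..T} (\<lambda>t. (Xc \<rho> \<tau> t \<omega> - r t) \<bullet> (Q t *v (Xc \<rho> \<tau> t \<omega> - r t)))
        + integral {0..T} (\<lambda>t. u t (Xa \<rho> \<tau> t \<omega>) \<bullet> (S t *v u t (Xa \<rho> \<tau> t \<omega>))))"
    unfolding cost_D_def
  proof (rule Bochner_Integration.integral_cong[OF refl])
    fix \<omega> assume \<omega>: "\<omega> \<in> space M"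
    show "integral {0..T} (\<lambda>t. (Xc \<rho> \<tau> t \<omega> - r t) \<bullet> (Q t *v (Xc \<rho> \<tau> t \<omega> - r t)) + u t (Xa \<rho> \<tau> t \<omega>) \<bullet> (S t *v u t (Xa \<rho> \<tau> t \<omega>)))
        = integral {0..T} (\<lambda>t. (Xc \<rho> \<tau> t \<omega> - r t) \<bullet> (Q t *v (Xc \<rho> \<tau> t \<omega> - r t)))
        + integral {0..T} (\<lambda>t. u t (Xa \<rho> \<tau> t \<omega>) \<bullet> (S t *v u t (Xa \<rho> \<tau> t \<omega>)))"
      by (intro Henstock_Kurzweil_Integration.integral_add integrable_continuous_real continuous_intros
          continuous_on_matrix_vector path_continuous[OF att \<omega>] cont_r cont_Q cont_u cont_S)
  qed
  also have "\<dots> = (integral {0..T} (\<lambda>t. (fst (traj \<rho> \<tau> t) - r t) \<bullet> (Q t *v (fst (traj \<rho> \<tau> t) - r t)))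
        + expectation (\<lambda>\<omega>. integral {0..T} (\<lambda>t. fst (fluct \<rho> \<tau> t \<omega>) \<bullet> (Q t *v fst (fluct \<rho> \<tau> t \<omega>)))))
      + (integral {0..T} (\<lambda>t. u t (snd (traj \<rho> \<tau> t)) \<bullet> (S t *v u t (snd (traj \<rho> \<tau> t))))
        + expectation (\<lambda>\<omega>. integral {0..T} (\<lambda>t. (u_lin t *v snd (fluct \<rho> \<tau> t \<omega>)) \<bullet> (S t *v (u_lin t *v snd (fluct \<rho> \<tau> t \<omega>))))))"
    unfolding uX XcX s1(2)[symmetric] s2(2)[symmetric] by (rule Bochner_Integration.integral_add[OF s1(1) s2(1)])
  finally have D: "cost_D M T Q S r u (Xc \<rho> \<tau>) (Xa \<rho> \<tau>) = \<dots>" .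
  have i1: "(\<lambda>t. detect \<rho> \<tau> t \<bullet> (\<Sigma>inv *v detect \<rho> \<tau> t)) integrable_on {0..T}"
    and i2: "(\<lambda>t. \<rho> t \<bullet> (P t *v \<rho> t)) integrable_on {0..T}"
    and i3: "(\<lambda>t. (fst (traj \<rho> \<tau> t) - r t) \<bullet> (Q t *v (fst (traj \<rho> \<tau> t) - r t))) integrable_on {0..T}"
    and i4: "(\<lambda>t. u t (snd (traj \<rho> \<tau> t)) \<bullet> (S t *v u t (snd (traj \<rho> \<tau> t)))) integrable_on {0..T}"
    by (intro integrable_continuous_real continuous_on_inner continuous_on_matrix_vector continuous_on_const
        det c1 c2 cont_attack[OF att] cont_P cont_Q cont_S)+
  have "(running_cost \<rho> \<tau> has_integral (1/2) * integral {0..T} (\<lambda>t. detect \<rho> \<tau> t \<bullet> (\<Sigma>inv *v detect \<rho> \<tau> t))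
      + (1/2) * integral {0..T} (\<lambda>t. \<rho> t \<bullet> (P t *v \<rho> t))
      - lam * (integral {0..T} (\<lambda>t. (fst (traj \<rho> \<tau> t) - r t) \<bullet> (Q t *v (fst (traj \<rho> \<tau> t) - r t)))
        + integral {0..T} (\<lambda>t. u t (snd (traj \<rho> \<tau> t)) \<bullet> (S t *v u t (snd (traj \<rho> \<tau> t)))))) {0..T}"
    unfolding running_cost_def[abs_def]
    by (intro has_integral_diff has_integral_add has_integral_mult_right integrable_integral i1 i2 i3 i4)
  from integral_unique[OF this]
  show "objective \<rho> \<tau> = integral {0..T} (running_cost \<rho> \<tau>) + residual_cost \<rho> \<tau>"
    unfolding objective_def S D residual_cost_def by (simp add: algebra_simps)
qed

section \<open>Verification\<close>

lemma matrix_inv_matrix_inv: "pd_mat N \<Longrightarrow> matrix_inv (matrix_inv N) = N"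
  using pd_mat_inverse(1)[of N] pd_mat_inverse(1)[OF pd_mat_matrix_inv, of N]
  by (metis matrix_mul_assoc matrix_mul_lid matrix_mul_rid)

context
  fixes Fc Fa Gc Ga :: "real \<Rightarrow> real^'d^'d" and f\<rho> g\<tau> :: "real \<Rightarrow> real^'d"
  assumes ode: "attack_ode T lam A K F Q Pinv \<Lambda> a r f Fc Fa Gc Ga f\<rho> g\<tau>"
begin

definition value_blk :: "real \<Rightarrow> 'd state_pair \<Rightarrow>\<^sub>L 'd state_pair" where
  "value_blk t = blk (Fc t) (Fa t) (Gc t) (Ga t)"

definition costate :: "'d state_pair \<Rightarrow> real \<Rightarrow> 'd state_pair" where
  "costate z t = value_blk t z + (f\<rho> t, g\<tau> t)"

lemma value_riccati: "attack_riccati A K F Q Pinv \<Lambda> lam T value_blk"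
  and value_costate: "attack_costate A K F Q Pinv \<Lambda> a r f lam T value_blk (\<lambda>t. (f\<rho> t, g\<tau> t))"
  using ode unfolding attack_ode_iff value_blk_def[abs_def] by blast+

lemma value_symmetric: "t \<in> {0..T} \<Longrightarrow> value_blk t x \<bullet> y = x \<bullet> value_blk t y"
  using attack_riccati_symmetric[OF cont_A cont_K cont_F cont_Q cont_Pinv cont_\<Lambda> cont_a cont_r cont_f
      value_riccati[unfolded value_blk_def[abs_def]] _ sym_F sym_K sym_Q sym_Pinv sym_\<Lambda>]
  by (simp add: value_blk_def blk_adjoint)

lemma cont_value: "continuous_on {0..T} value_blk" and cont_fg: "continuous_on {0..T} (\<lambda>t. (f\<rho> t, g\<tau> t))"
  using value_riccati value_costate unfolding attack_riccati_def attack_costate_def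
  by (auto intro: derivative_imp_continuous)

lemma cont_f\<rho>: "continuous_on {0..T} f\<rho>" and cont_g\<tau>: "continuous_on {0..T} g\<tau>"
  using continuous_on_fst[OF cont_fg] continuous_on_snd[OF cont_fg] by simp_all

lemma \<T>_adjoint:
  assumes "t \<in> {0..T}" shows "(\<T> t *v w) \<bullet> q = w \<bullet> (\<Sigma>inv *v (H t *v (R t *v q)))"
  by (simp add: inner_transpose \<T>_def matrix_transpose_mul transpose_matrix_inv[OF pd_\<Sigma>] sym_R[OF assms]
      matrix_vector_mul_assoc matrix_mul_assoc del: transpose_matrix_vector)

text \<open>The two completed squares: deviations of \<open>\<rho>\<close> and of \<open>w\<close>
  from the minimisers of the Hamiltonian at the current costate, weighted by the control
  penalties.\<close>

definition gap :: "(real \<Rightarrow> real^'d) \<Rightarrow> (real \<Rightarrow> real^'m) \<Rightarrow> real \<Rightarrow> real" where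
  "gap \<rho> \<tau> t = (let \<pi> = costate (traj \<rho> \<tau> t) t; x = \<rho> t + Pinv t *v fst \<pi>; y = detect \<rho> \<tau> t + H t *v (R t *v snd \<pi>) in
     (1/2) * (x \<bullet> (P t *v x)) + (1/2) * (y \<bullet> (\<Sigma>inv *v y)))"

text \<open>The value function at the initial means plus the terms free of state and control.
  Together with \<open>residual_cost\<close> it is the optimal value.\<close>

definition base_cost :: real where
  "base_cost = (1/2) * ((x0, x0) \<bullet> value_blk 0 (x0, x0)) + (f\<rho> 0, g\<tau> 0) \<bullet> (x0, x0)
     + integral {0..T} (\<lambda>t. ((f\<rho> t, g\<tau> t) \<bullet> (offset K a f t, offset K a f t) - (1/2) * ((f\<rho> t, g\<tau> t) \<bullet> gain_blk Pinv \<Lambda> t (f\<rho> t, g\<tau> t)))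
         - lam * (r t \<bullet> (Q t *v r t) + (1/4) * (f t \<bullet> (K t *v f t))))"

context
  fixes \<rho> :: "real \<Rightarrow> real^'d" and \<tau> :: "real \<Rightarrow> real^'m"
  assumes att: "(\<rho>, \<tau>) \<in> det_attacks T"
begin

lemma gap_nonneg: "t \<in> {0..T} \<Longrightarrow> 0 \<le> gap \<rho> \<tau> t"
  and gap_zero_iff: "t \<in> {0..T} \<Longrightarrow> gap \<rho> \<tau> t = 0 \<longleftrightarrow>
    \<rho> t + Pinv t *v fst (costate (traj \<rho> \<tau> t) t) = 0 \<and> detect \<rho> \<tau> t + H t *v (R t *v snd (costate (traj \<rho> \<tau> t) t)) = 0"
proof -
  have pd: "0 \<le> x \<bullet> (N *v x)" "x \<bullet> (N *v x) = 0 \<longleftrightarrow> x = 0" if "pd_mat N" for N :: "real^'k^'k" and x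
    using that unfolding pd_mat_def by (cases "x = 0"; fastforce)+
  show "t \<in> {0..T} \<Longrightarrow> 0 \<le> gap \<rho> \<tau> t"
    using pd(1)[OF pd_P] pd(1)[OF pd_mat_matrix_inv[OF pd_\<Sigma>]] by (simp add: gap_def Let_def)
  show "t \<in> {0..T} \<Longrightarrow> gap \<rho> \<tau> t = 0 \<longleftrightarrow>
    \<rho> t + Pinv t *v fst (costate (traj \<rho> \<tau> t) t) = 0 \<and> detect \<rho> \<tau> t + H t *v (R t *v snd (costate (traj \<rho> \<tau> t) t)) = 0"
    using pd[OF pd_P, of t "\<rho> t + Pinv t *v fst (costate (traj \<rho> \<tau> t) t)"]
      pd[OF pd_mat_matrix_inv[OF pd_\<Sigma>], of "detect \<rho> \<tau> t + H t *v (R t *v snd (costate (traj \<rho> \<tau> t) t))"]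
    by (simp add: gap_def Let_def add_nonneg_eq_0_iff)
qed

lemma cont_gap: "continuous_on {0..T} (gap \<rho> \<tau>)"
  unfolding gap_def[abs_def] Let_def costate_def
  by (intro continuous_intros continuous_on_matrix_vector cont_traj[OF att] cont_value cont_fg cont_P cont_Pinv cont_H cont_R
      objective_split(2)[OF att] cont_attack[OF att])

text \<open>The integrand of \<open>completion_of_squares\<close> is subtracted and its part free of
  state and control is added back. The remaining terms then assemble into the two squares of
  \<open>gap\<close>, while the subtracted expression integrates to boundary terms.\<close>

lemma running_cost_gap:
  assumes t: "t \<in> {0..T}"
  defines "z \<equiv> traj \<rho> \<tau> t" and "p \<equiv> (f\<rho> t, g\<tau> t)" and "b \<equiv> (offset K a f t, offset K a f t)"
    and "\<beta> \<equiv> (\<rho> t, \<T> t *v detect \<rho> \<tau> t)" and "\<pi> \<equiv> costate (traj \<rho> \<tau> t) t"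
  shows "running_cost \<rho> \<tau> t = gap \<rho> \<tau> t
    - (\<pi> \<bullet> \<beta> + (1/2) * (\<pi> \<bullet> gain_blk Pinv \<Lambda> t \<pi>) + (1/2) * (z \<bullet> cost_blk K F Q lam t z) - lin_cost K F Q r f lam t \<bullet> z
        + (p \<bullet> b - (1/2) * (p \<bullet> gain_blk Pinv \<Lambda> t p)))
    + ((p \<bullet> b - (1/2) * (p \<bullet> gain_blk Pinv \<Lambda> t p)) - lam * (r t \<bullet> (Q t *v r t) + (1/4) * (f t \<bullet> (K t *v f t))))"
proof -
  obtain z1 z2 where z: "z = (z1, z2)" by (cases z)
  obtain p1 p2 where \<pi>: "\<pi> = (p1, p2)" by (cases \<pi>)
  define w where "w = detect \<rho> \<tau> t"
  \<comment> \<open>\<open>q\<close> is the transpose of \<open>\<T>\<close> applied to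
    \<open>p2\<close>, that is, the linear coefficient of \<open>w\<close>. Completing the square
    with weight \<open>\<Sigma>inv\<close> shifts \<open>w\<close> by the inverse of that weight
    applied to \<open>q\<close>, which is \<open>H R p2\<close>.\<close>
  define q where "q = \<Sigma>inv *v (H t *v (R t *v p2))"
  have \<Sigma>q: "matrix_inv \<Sigma>inv *v q = H t *v (R t *v p2)"
    unfolding q_def matrix_inv_matrix_inv[OF pd_\<Sigma>] by (simp add: matrix_vector_mul_assoc pd_mat_inverse[OF pd_\<Sigma>] matrix_mul_assoc)
  have \<Lambda>p: "\<Lambda> t *v p2 = \<T> t *v (H t *v (R t *v p2))"
    by (simp add: \<Lambda>_def \<T>_def matrix_vector_mul_assoc matrix_mul_assoc)
  have wq: "(\<T> t *v w) \<bullet> p2 = w \<bullet> q" "(\<Lambda> t *v p2) \<bullet> p2 = q \<bullet> (matrix_inv \<Sigma>inv *v q)"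
    unfolding \<Lambda>p \<T>_adjoint[OF t] q_def[symmetric] \<Sigma>q by (simp_all add: inner_commute)
  have sq1: "(1/2) * (\<rho> t \<bullet> (P t *v \<rho> t)) + \<rho> t \<bullet> p1 + (1/2) * (p1 \<bullet> (Pinv t *v p1))
      = (1/2) * ((\<rho> t + Pinv t *v p1) \<bullet> (P t *v (\<rho> t + Pinv t *v p1)))"
    unfolding Pinv_def by (rule square_completion[OF pd_P[OF t]])
  have sq2: "(1/2) * (w \<bullet> (\<Sigma>inv *v w)) + w \<bullet> q + (1/2) * (q \<bullet> (matrix_inv \<Sigma>inv *v q))
      = (1/2) * ((w + H t *v (R t *v p2)) \<bullet> (\<Sigma>inv *v (w + H t *v (R t *v p2))))"
    using square_completion[OF pd_mat_matrix_inv[OF pd_\<Sigma>], of w q] unfolding \<Sigma>q .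
  have gap: "gap \<rho> \<tau> t = (1/2) * (\<rho> t \<bullet> (P t *v \<rho> t)) + (1/2) * (w \<bullet> (\<Sigma>inv *v w)) + \<pi> \<bullet> \<beta> + (1/2) * (\<pi> \<bullet> gain_blk Pinv \<Lambda> t \<pi>)"
    unfolding gap_def Let_def \<pi>_def[symmetric] w_def[symmetric] \<beta>_def \<pi> fst_conv snd_conv sq1[symmetric] sq2[symmetric]
    by (simp add: gain_blk_def blk_apply matrix_vector_linear inner_commute[of p2] wq inner_commute[of p1 "\<rho> t"])
  have F_adj: "(F t *v z2) \<bullet> y = z2 \<bullet> (F t *v y)" for y
    using inner_transpose[of "F t" z2 y] by (simp only: sym_F[OF t])
  have "f t \<bullet> (K t *v (F t *v z2)) = (K t *v f t) \<bullet> (F t *v z2)"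
    using inner_transpose[of "K t" "f t" "F t *v z2"] by (simp only: sym_K[OF t])
  also have "\<dots> = z2 \<bullet> (F t *v (K t *v f t))" by (subst inner_commute) (rule F_adj)
  finally have K_adj: "f t \<bullet> (K t *v (F t *v z2)) = z2 \<bullet> (F t *v (K t *v f t))" .
  have "r t \<bullet> (Q t *v z1) = z1 \<bullet> (Q t *v r t)"
    using inner_transpose[of "Q t" "r t" z1] by (simp only: sym_Q[OF t] inner_commute)
  with F_adj K_adj have quad: "lam * ((z1 - r t) \<bullet> (Q t *v (z1 - r t)) + u t z2 \<bullet> (S t *v u t z2))
      = (1/2) * (z \<bullet> cost_blk K F Q lam t z) - lin_cost K F Q r f lam t \<bullet> z
        + lam * (r t \<bullet> (Q t *v r t) + (1/4) * (f t \<bullet> (K t *v f t)))"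
    unfolding u_quadratic[OF t] z cost_blk_def lin_cost_def
    by (simp add: blk_apply matrix_vector_linear inner_simps matrix_vector_mul_assoc[symmetric] inner_commute[of _ z1] inner_commute[of _ z2] algebra_simps)
  show ?thesis
    unfolding running_cost_def gap w_def[symmetric] z_def[symmetric] using quad unfolding z fst_conv snd_conv by (simp add: algebra_simps)
qed

lemma objective_gap: "objective \<rho> \<tau> = integral {0..T} (gap \<rho> \<tau>) + base_cost + residual_cost \<rho> \<tau>"
proof -
  let ?z = "traj \<rho> \<tau>" and ?p = "\<lambda>t. (f\<rho> t, g\<tau> t)" and ?b = "\<lambda>t. (offset K a f t, offset K a f t)"
  let ?\<pi> = "\<lambda>t. costate (traj \<rho> \<tau> t) t" and ?\<beta> = "\<lambda>t. (\<rho> t, \<T> t *v detect \<rho> \<tau> t)"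
  let ?e1 = "\<lambda>t. ?\<pi> t \<bullet> ?\<beta> t + (1/2) * (?\<pi> t \<bullet> gain_blk Pinv \<Lambda> t (?\<pi> t)) + (1/2) * (?z t \<bullet> cost_blk K F Q lam t (?z t))
    - lin_cost K F Q r f lam t \<bullet> ?z t + (?p t \<bullet> ?b t - (1/2) * (?p t \<bullet> gain_blk Pinv \<Lambda> t (?p t)))"
  let ?e2 = "\<lambda>t. (?p t \<bullet> ?b t - (1/2) * (?p t \<bullet> gain_blk Pinv \<Lambda> t (?p t))) - lam * (r t \<bullet> (Q t *v r t) + (1/4) * (f t \<bullet> (K t *v f t)))"
  note cb = continuous_on_coefficient_blk[OF cont_A cont_K cont_F cont_Q cont_Pinv cont_\<Lambda> cont_a cont_r cont_f]
  have "(?e1 has_integral - ((1/2) * (?z 0 \<bullet> value_blk 0 (?z 0)) + ?p 0 \<bullet> ?z 0)) {0..T}"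
    unfolding costate_def
  proof (rule completion_of_squares[where A = "drift_blk A K F" and A' = "adjoint_blk A K F"])
    show "0 \<le> T" using T by simp
    show "value_blk T = 0" "?p T = 0" using value_riccati value_costate by (auto simp: attack_riccati_def attack_costate_def)
    fix t assume t: "t \<in> {0..T}"
    show "(value_blk has_vector_derivative - riccati_map (drift_blk A K F t) (adjoint_blk A K F t) (gain_blk Pinv \<Lambda> t)
        (cost_blk K F Q lam t) (value_blk t)) (at t within {0..T})"
      using value_riccati t by (simp add: attack_riccati_def)
    show "(?p has_vector_derivative - (adjoint_blk A K F t (?p t) - value_blk t (gain_blk Pinv \<Lambda> t (?p t)) + value_blk t (?b t)
        + lin_cost K F Q r f lam t)) (at t within {0..T})"
      using value_costate t by (simp add: attack_costate_def)
    \<comment> \<open>The change of control: the filter term in the difference of the means moves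
      from the drift into the input, where it combines with \<open>\<tau>\<close> to
      \<open>detect\<close>.\<close>
    have "sys_drift t (?z t) + sys_input \<rho> \<tau> t = drift_blk A K F t (?z t) + ?b t + ?\<beta> t"
      by (simp add: sys_drift_def sys_input_def drift_blk_def detect_def blk_apply matrix_vector_linear matrix_vector_mul_assoc algebra_simps)
    then show "(?z has_vector_derivative drift_blk A K F t (?z t) + ?b t + ?\<beta> t) (at t within {0..T})"
      using traj(2)[OF att t] by simp
    show "value_blk t x \<bullet> y = x \<bullet> value_blk t y" for x y by (rule value_symmetric[OF t])
    show "gain_blk Pinv \<Lambda> t x \<bullet> y = x \<bullet> gain_blk Pinv \<Lambda> t y" for x y
      by (simp add: gain_blk_def blk_adjoint sym_Pinv[OF t] sym_\<Lambda>[OF t] transpose_linear)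
    show "drift_blk A K F t x \<bullet> y = x \<bullet> adjoint_blk A K F t y" for x y
      by (simp add: drift_blk_def adjoint_blk_def blk_adjoint transpose_linear matrix_transpose_mul sym_F[OF t] sym_K[OF t])
  qed
  moreover have "?e2 integrable_on {0..T}"
    by (intro integrable_continuous_real continuous_intros continuous_on_matrix_vector cont_fg cb cont_r cont_Q cont_f cont_K)
  moreover have "gap \<rho> \<tau> integrable_on {0..T}" by (intro integrable_continuous_real cont_gap)
  ultimately have "((\<lambda>t. gap \<rho> \<tau> t - ?e1 t + ?e2 t) has_integral
      integral {0..T} (gap \<rho> \<tau>) - - ((1/2) * (?z 0 \<bullet> value_blk 0 (?z 0)) + ?p 0 \<bullet> ?z 0) + integral {0..T} ?e2) {0..T}"
    by (intro has_integral_add has_integral_diff integrable_integral)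
  then have "integral {0..T} (\<lambda>t. gap \<rho> \<tau> t - ?e1 t + ?e2 t) = integral {0..T} (gap \<rho> \<tau>) + base_cost"
    unfolding traj(1)[OF att] base_cost_def by (simp add: integral_unique)
  moreover have "integral {0..T} (running_cost \<rho> \<tau>) = integral {0..T} (\<lambda>t. gap \<rho> \<tau> t - ?e1 t + ?e2 t)"
    by (intro Henstock_Kurzweil_Integration.integral_cong running_cost_gap)
  ultimately show ?thesis by (simp add: objective_split(1)[OF att])
qed

text \<open>A continuous nonnegative function on an interval of positive length has integral 0 only
  if it vanishes throughout. The left-hand side is a fixed point condition, since the means on its
  right belong to the attack itself.\<close>

lemma feedback_iff_gap:
  "(\<forall>t\<in>{0..T}. \<rho> t = - (Pinv t *v (Fc t *v expectation (Xc \<rho> \<tau> t) + Fa t *v expectation (Xa \<rho> \<tau> t) + f\<rho> t)) \<and>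
     \<tau> t = - ((H t ** R t ** Gc t + H t) *v expectation (Xc \<rho> \<tau> t)) - (H t ** R t ** Ga t - H t) *v expectation (Xa \<rho> \<tau> t)
       - (H t ** R t) *v g\<tau> t) \<longleftrightarrow> integral {0..T} (gap \<rho> \<tau>) = 0"
proof -
  have "integral {0..T} (gap \<rho> \<tau>) = 0 \<longleftrightarrow> (\<forall>t\<in>{0..T}. gap \<rho> \<tau> t = 0)"
    using integral_cbox_eq_0_iff[of 0 T "gap \<rho> \<tau>"] cont_gap gap_nonneg T by simp
  moreover have "gap \<rho> \<tau> t = 0 \<longleftrightarrow> \<rho> t = - (Pinv t *v (Fc t *v expectation (Xc \<rho> \<tau> t) + Fa t *v expectation (Xa \<rho> \<tau> t) + f\<rho> t)) \<and>
     \<tau> t = - ((H t ** R t ** Gc t + H t) *v expectation (Xc \<rho> \<tau> t)) - (H t ** R t ** Ga t - H t) *v expectation (Xa \<rho> \<tau> t)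
       - (H t ** R t) *v g\<tau> t" if t: "t \<in> {0..T}" for t
    unfolding gap_zero_iff[OF t] means[OF att t]
    by (simp add: costate_def value_blk_def blk_apply detect_def matrix_vector_linear matrix_vector_mul_assoc matrix_mul_assoc
        eq_neg_iff_add_eq_0 algebra_simps)
  ultimately show ?thesis by simp
qed

end

text \<open>The implicit feedback formula is resolved by solving the closed-loop equation for the
  means first; the attack is read off from its solution.\<close>

lemma feedback_exists: "\<exists>\<rho> \<tau>. (\<rho>, \<tau>) \<in> det_attacks T \<and> integral {0..T} (gap \<rho> \<tau>) = 0"
proof -
  let ?b = "\<lambda>t. (offset K a f t, offset K a f t)" and ?p = "\<lambda>t. (f\<rho> t, g\<tau> t)"
  note cb = continuous_on_coefficient_blk[OF cont_A cont_K cont_F cont_Q cont_Pinv cont_\<Lambda> cont_a cont_r cont_f]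
  obtain z where z0: "z 0 = (x0, x0)" and z: "\<And>t. t \<in> {0..T} \<Longrightarrow> (z has_vector_derivative
      (drift_blk A K F t - (gain_blk Pinv \<Lambda> t o\<^sub>L value_blk t)) (z t) + (?b t - gain_blk Pinv \<Lambda> t (?p t))) (at t within {0..T})"
  proof -
    have "continuous_on {0..T} (\<lambda>t. drift_blk A K F t - (gain_blk Pinv \<Lambda> t o\<^sub>L value_blk t))"
      "continuous_on {0..T} (\<lambda>t. ?b t - gain_blk Pinv \<Lambda> t (?p t))"
      by (intro continuous_intros cb cont_value cont_fg)+
    from linear_ode_exists[OF less_imp_le[OF T] this, of "(x0, x0)"] show ?thesis using that by blast
  qed
  have zc: "continuous_on {0..T} z" by (rule derivative_imp_continuous[OF z])
  define \<rho> where "\<rho> t = - (Pinv t *v fst (costate (z t) t))" for t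
  \<comment> \<open>The optimal \<open>w\<close> is \<open>- H R\<close> applied to the second
    costate component; subtracting \<open>H (m^c - m^a)\<close> returns from \<open>w\<close> to
    \<open>\<tau>\<close>.\<close>
  define \<tau> where "\<tau> t = - (H t *v (fst (z t) - snd (z t))) - H t *v (R t *v snd (costate (z t) t))" for t
  have att: "(\<rho>, \<tau>) \<in> det_attacks T"
    unfolding det_attacks_def \<rho>_def \<tau>_def costate_def
    by (auto intro!: continuous_intros continuous_on_matrix_vector cont_Pinv cont_H cont_R zc cont_value cont_f\<rho> cont_g\<tau>)
  have z': "(z has_vector_derivative sys_drift t (z t) + sys_input \<rho> \<tau> t) (at t within {0..T})" if t: "t \<in> {0..T}" for t
  proof -
    have "\<Lambda> t = \<T> t ** H t ** R t" by (simp add: \<Lambda>_def \<T>_def matrix_mul_assoc)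
    then have "(drift_blk A K F t - (gain_blk Pinv \<Lambda> t o\<^sub>L value_blk t)) (z t) + (?b t - gain_blk Pinv \<Lambda> t (?p t))
        = sys_drift t (z t) + sys_input \<rho> \<tau> t"
      by (simp add: blinfun.bilinear_simps costate_def \<rho>_def \<tau>_def sys_drift_def sys_input_def drift_blk_def gain_blk_def
          blk_apply matrix_vector_linear matrix_vector_mul_assoc matrix_mul_assoc algebra_simps)
    then show ?thesis using z[OF t] by simp
  qed
  obtain C where C: "\<And>t. t \<in> {0..T} \<Longrightarrow> norm (sys_drift t) \<le> C" using continuous_on_bounded_norm[OF cont_sys_drift] by blast
  \<comment> \<open>\<open>traj\<close> is merely some solution for this attack; uniqueness
    identifies it with the closed-loop path on \<open>{0..T}\<close>.\<close>
  have traj_z: "traj \<rho> \<tau> t = z t" if t: "t \<in> {0..T}" for t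
  proof (rule ode_unique[OF traj(2)[OF att] z' _ _ t, where L = C])
    show "norm (sys_drift t (traj \<rho> \<tau> t) + sys_input \<rho> \<tau> t - (sys_drift t (z t) + sys_input \<rho> \<tau> t)) \<le> C * norm (traj \<rho> \<tau> t - z t)"
      if "t \<in> {0..T}" for t
    proof -
      have "norm (sys_drift t (traj \<rho> \<tau> t - z t)) \<le> C * norm (traj \<rho> \<tau> t - z t)"
        using C[OF that] by (intro order_trans[OF norm_blinfun] mult_right_mono) auto
      then show ?thesis by (simp add: blinfun.diff_right)
    qed
  qed (simp_all add: traj(1)[OF att] z0)
  have "gap \<rho> \<tau> t = 0" if t: "t \<in> {0..T}" for t
    unfolding gap_zero_iff[OF att t] traj_z[OF t] detect_def by (simp add: \<rho>_def \<tau>_def)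
  then have "integral {0..T} (gap \<rho> \<tau>) = integral {0..T} (\<lambda>t. 0)" by (intro Henstock_Kurzweil_Integration.integral_cong)
  then show ?thesis using att by auto
qed

text \<open>Objectives of two attacks differ by their gap integrals alone, as all other terms are
  common constants. Since the gap 0 is attained, a minimiser cannot have a positive one.\<close>

lemma arg_min_iff_gap:
  "is_arg_min (\<lambda>(\<rho>, \<tau>). objective \<rho> \<tau>) (\<lambda>x. x \<in> det_attacks T) (\<rho>, \<tau>) \<longleftrightarrow>
     (\<rho>, \<tau>) \<in> det_attacks T \<and> integral {0..T} (gap \<rho> \<tau>) = 0"
proof -
  obtain \<rho>' \<tau>' where opt: "(\<rho>', \<tau>') \<in> det_attacks T" "integral {0..T} (gap \<rho>' \<tau>') = 0" using feedback_exists by blast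
  have obj: "objective \<rho> \<tau> = integral {0..T} (gap \<rho> \<tau>) + objective \<rho>' \<tau>'" if "(\<rho>, \<tau>) \<in> det_attacks T" for \<rho> \<tau>
    using objective_gap[OF that] objective_gap[OF opt(1)] residual_cost_const[OF that opt(1)] opt(2) by simp
  have nn: "0 \<le> integral {0..T} (gap \<rho> \<tau>)" if "(\<rho>, \<tau>) \<in> det_attacks T" for \<rho> \<tau>
    by (intro Henstock_Kurzweil_Integration.integral_nonneg integrable_continuous_real cont_gap that gap_nonneg)
  show ?thesis
  proof
    assume "is_arg_min (\<lambda>(\<rho>, \<tau>). objective \<rho> \<tau>) (\<lambda>x. x \<in> det_attacks T) (\<rho>, \<tau>)"
    then have att: "(\<rho>, \<tau>) \<in> det_attacks T" and "\<not> objective \<rho>' \<tau>' < objective \<rho> \<tau>"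
      using opt(1) by (force simp: is_arg_min_def)+
    then show "(\<rho>, \<tau>) \<in> det_attacks T \<and> integral {0..T} (gap \<rho> \<tau>) = 0"
      using obj[OF att] nn[OF att] by simp
  next
    assume *: "(\<rho>, \<tau>) \<in> det_attacks T \<and> integral {0..T} (gap \<rho> \<tau>) = 0"
    have "\<not> objective \<rho>'' \<tau>'' < objective \<rho> \<tau>" if "(\<rho>'', \<tau>'') \<in> det_attacks T" for \<rho>'' \<tau>''
      using obj[OF that] nn[OF that] obj[of \<rho> \<tau>] * by simp
    with * show "is_arg_min (\<lambda>(\<rho>, \<tau>). objective \<rho> \<tau>) (\<lambda>x. x \<in> det_attacks T) (\<rho>, \<tau>)"
      by (auto simp: is_arg_min_def)
  qed
qed

end

end

theorem theorem13:
  fixes T lam :: real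
    and A :: "real \<Rightarrow> real^'d^'d" and B :: "real \<Rightarrow> real^'c^'d" and H :: "real \<Rightarrow> real^'d^'m"
    and a r f :: "real \<Rightarrow> real^'d" and h :: "real \<Rightarrow> real^'m"
    and \<sigma>V :: "real^'p^'d" and \<sigma>W :: "real^'q^'m"
    and Q F R P :: "real \<Rightarrow> real^'d^'d" and S :: "real \<Rightarrow> real^'c^'c"
    and x0 :: "real^'d" and R0 :: "real^'d^'d"
    and M :: "'w measure" and X0 :: "'w \<Rightarrow> real^'d"
    and V :: "real \<Rightarrow> 'w \<Rightarrow> real^'p" and W :: "real \<Rightarrow> 'w \<Rightarrow> real^'q"
    and Xc Xa Xh :: "(real \<Rightarrow> real^'d) \<Rightarrow> (real \<Rightarrow> real^'m) \<Rightarrow> real \<Rightarrow> 'w \<Rightarrow> real^'d"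
    and Yc :: "(real \<Rightarrow> real^'d) \<Rightarrow> (real \<Rightarrow> real^'m) \<Rightarrow> real \<Rightarrow> 'w \<Rightarrow> real^'m"
  defines "K \<equiv> \<lambda>t. B t ** matrix_inv (S t) ** transpose (B t)"
    and "\<T> \<equiv> \<lambda>t. R t ** transpose (H t) ** matrix_inv (\<sigma>W ** transpose \<sigma>W)"
    and "\<Lambda> \<equiv> \<lambda>t. R t ** transpose (H t) ** matrix_inv (\<sigma>W ** transpose \<sigma>W) ** H t ** R t"
    and "Pinv \<equiv> \<lambda>t. matrix_inv (P t)"
    and "u \<equiv> u_star B S F f"
  defines "J \<equiv> \<lambda>(\<rho>, \<tau>). cost_S M T H \<sigma>W \<tau> (Xh \<rho> \<tau>) (Xa \<rho> \<tau>)
                - lam * cost_D M T Q S r u (Xc \<rho> \<tau>) (Xa \<rho> \<tau>)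
                + (1/2) * integral {0..T} (\<lambda>t. \<rho> t \<bullet> (P t *v \<rho> t))"
    and "mc \<equiv> \<lambda>\<rho> \<tau> t. (LINT \<omega>|M. Xc \<rho> \<tau> t \<omega>)"
    and "ma \<equiv> \<lambda>\<rho> \<tau> t. (LINT \<omega>|M. Xa \<rho> \<tau> t \<omega>)"
  assumes "0 < T" and "CARD('d) \<le> CARD('p)" and "CARD('m) \<le> CARD('q)"
    and "rank \<sigma>V = CARD('d)" and "rank \<sigma>W = CARD('m)"
    and "continuous_on {0..T} A" and "continuous_on {0..T} B" and "continuous_on {0..T} H"
    and "continuous_on {0..T} a" and "continuous_on {0..T} h"
    and "continuous_on {0..T} Q" and "\<And>t. t \<in> {0..T} \<Longrightarrow> psd_mat (Q t)"
    and "continuous_on {0..T} S" and "\<And>t. t \<in> {0..T} \<Longrightarrow> pd_mat (S t)"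
    and "continuous_on {0..T} r" and "psd_mat R0"
    and "agent_feedback_system T A K Q a r F f"
    and "filter_riccati T A H \<sigma>V \<sigma>W R0 R"
    and "0 \<le> lam"
    and "continuous_on {0..T} P" and "\<And>t. t \<in> {0..T} \<Longrightarrow> pd_mat (P t)"
    and "prob_space M"
    and "brownian_motion M V" and "brownian_motion M W"
    and "prob_space.indep_set M (sets (process_sigma M {0..} V)) (sets (process_sigma M {0..} W))"
    and "gaussian_vector M X0 x0 R0"
    and "prob_space.indep_set M (sets (vimage_algebra (space M) X0 borel))
           (sets (process_sigma M {0..} (\<lambda>t \<omega>. (V t \<omega>, W t \<omega>))))"
    and "\<And>\<rho> \<tau>. (\<rho>, \<tau>) \<in> det_attacks T \<Longrightarrow>
           attacked_system M T A B H a h \<sigma>V \<sigma>W \<T> u x0 X0 V W \<rho> \<tau>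
             (Xc \<rho> \<tau>) (Yc \<rho> \<tau>) (Xa \<rho> \<tau>) (Xh \<rho> \<tau>)"
  shows "(\<forall>Fc Fa Gc Ga f\<rho> g\<tau>. attack_ode T lam A K F Q Pinv \<Lambda> a r f Fc Fa Gc Ga f\<rho> g\<tau> \<longrightarrow>
            (\<exists>\<rho> \<tau>. is_arg_min J (\<lambda>x. x \<in> det_attacks T) (\<rho>, \<tau>)) \<and>
            (\<forall>\<rho> \<tau>. (\<rho>, \<tau>) \<in> det_attacks T \<longrightarrow>
               (is_arg_min J (\<lambda>x. x \<in> det_attacks T) (\<rho>, \<tau>) \<longleftrightarrow>
                (\<forall>t\<in>{0..T}.
                   \<rho> t = - (Pinv t *v (Fc t *v mc \<rho> \<tau> t + Fa t *v ma \<rho> \<tau> t + f\<rho> t)) \<and>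
                   \<tau> t = - ((H t ** R t ** Gc t + H t) *v mc \<rho> \<tau> t)
                          - (H t ** R t ** Ga t - H t) *v ma \<rho> \<tau> t
                          - (H t ** R t) *v g\<tau> t))))
       \<and> (horizon_bound T lam A K F Q Pinv \<Lambda> \<longrightarrow>
            attack_ode_uniquely_solvable T lam A K F Q Pinv \<Lambda> a r f)
       \<and> (lam = 0 \<longrightarrow> attack_ode_uniquely_solvable T lam A K F Q Pinv \<Lambda> a r f)"
proof -
  interpret attack_setup M T lam A B H a r f h \<sigma>V \<sigma>W Q F R P S x0 R0 X0 V W Xc Xa Xh Yc K \<T> \<Lambda> Pinv u
  proof (intro attack_setup.intro attack_setup_axioms.intro)
    show "K = (\<lambda>t. B t ** matrix_inv (S t) ** transpose (B t))" by (simp only: K_def)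
    show "\<T> = (\<lambda>t. R t ** transpose (H t) ** matrix_inv (\<sigma>W ** transpose \<sigma>W))" by (simp only: \<T>_def)
    show "\<Lambda> = (\<lambda>t. R t ** transpose (H t) ** matrix_inv (\<sigma>W ** transpose \<sigma>W) ** H t ** R t)" by (simp only: \<Lambda>_def)
    show "Pinv = (\<lambda>t. matrix_inv (P t))" by (simp only: Pinv_def)
    show "u = u_star B S F f" by (simp only: u_def)
  qed (fact | (rule assms; assumption))+
  have J: "J = (\<lambda>(\<rho>, \<tau>). objective \<rho> \<tau>)"
    by (simp add: J_def objective_def)
  note cont = cont_A cont_K cont_F cont_Q cont_Pinv cont_\<Lambda> cont_a cont_r cont_f
  show ?thesis
  proof (intro conjI allI impI)
    fix Fc Fa Gc Ga f\<rho> g\<tau>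
    assume ode: "attack_ode T lam A K F Q Pinv \<Lambda> a r f Fc Fa Gc Ga f\<rho> g\<tau>"
    show "\<exists>\<rho> \<tau>. is_arg_min J (\<lambda>x. x \<in> det_attacks T) (\<rho>, \<tau>)"
      unfolding J arg_min_iff_gap[OF ode] by (rule feedback_exists[OF ode])
    fix \<rho> :: "real \<Rightarrow> real^'d" and \<tau> :: "real \<Rightarrow> real^'m"
    assume att: "(\<rho>, \<tau>) \<in> det_attacks T"
    show "is_arg_min J (\<lambda>x. x \<in> det_attacks T) (\<rho>, \<tau>) \<longleftrightarrow>
      (\<forall>t\<in>{0..T}.
         \<rho> t = - (Pinv t *v (Fc t *v mc \<rho> \<tau> t + Fa t *v ma \<rho> \<tau> t + f\<rho> t)) \<and>
         \<tau> t = - ((H t ** R t ** Gc t + H t) *v mc \<rho> \<tau> t)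
                - (H t ** R t ** Ga t - H t) *v ma \<rho> \<tau> t
                - (H t ** R t) *v g\<tau> t)"
      unfolding J arg_min_iff_gap[OF ode] mc_def ma_def feedback_iff_gap[OF ode att] using att by simp
  next
    assume "horizon_bound T lam A K F Q Pinv \<Lambda>"
    then show "attack_ode_uniquely_solvable T lam A K F Q Pinv \<Lambda> a r f"
      by (intro attack_ode_solvable_horizon[OF cont less_imp_le[OF T] lam] sym_F sym_K)
  next
    assume "lam = 0"
    then show "attack_ode_uniquely_solvable T lam A K F Q Pinv \<Lambda> a r f"
      by (rule attack_ode_solvable_zero[OF cont _ less_imp_le[OF T]])
  qed
qed

end
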